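(* Let $\pi$ be a finitely generated, nilpotent group, with Malcev–Lie algebra $\mathfrak{n}$, and let $V_\theta$ be a non-zero finite-dimensional $\mathfrak{g}$-module, with structure map $\theta\colon\mathfrak{g}\to\mathfrak{gl}(V)$, where $\mathfrak{g}=\mathfrak{sl}_2$ or $\mathfrak{sol}_2$. Then, for every integer $k\ge 0$, $$\mathcal{R}_1^k(\mathcal{C}^\bullet(\mathfrak{n}),\theta)=\begin{cases}\emptyset&\text{if }k>\dim\mathfrak{n},\\ \Pi(\mathcal{C}^\bullet(\mathfrak{n}),\theta)\ne\emptyset&\text{if }k\le\dim\mathfrak{n}.\end{cases}$$
   Context: Everything is over $\mathbb{C}$. $\mathfrak{sol}_2$ is the standard Borel subalgebra of $\mathfrak{sl}_2$. The Malcev–Lie algebra (in the sense of Quillen) of a group $\pi$ is the Lie algebra of primitive elements in the completion of the group algebra $\mathbb{C}[\pi]$ at the augmentation ideal; for $\pi$ finitely generated nilpotent it is a finite-dimensional nilpotent Lie algebra. For a finite-dimensional Lie algebra $\mathfrak{f}$, $\mathcal{C}^\bullet(\mathfrak{f})=(\bigwedge^\bullet\mathfrak{f}^*,d)$ is the Chevalley–Eilenberg cochain algebra, with $d\colon\mathfrak{f}^*\to\mathfrak{f}^*\wedge\mathfrak{f}^*$ equal to minus the dual of the Lie bracket, extended by the graded Leibniz rule. For a connected commutative differential graded algebra $A$ ($A^0=\mathbb{C}\cdot1$) and a Lie algebra $\mathfrak{g}$, $A\otimes\mathfrak{g}$ has bracket $[\alpha\otimes x,\beta\otimes y]=\alpha\beta\otimes[x,y]$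 and differential $\partial(\alpha\otimes x)=d\alpha\otimes x$; the set of flat connections is $\mathcal{F}(A,\mathfrak{g})=\{\omega\in A^1\otimes\mathfrak{g}\mid\partial\omega+\frac12[\omega,\omega]=0\}$. For $\omega=\sum_i\eta_i\otimes g_i\in\mathcal{F}(A,\mathfrak{g})$, put $d_\omega(\alpha\otimes v)=d\alpha\otimes v+\sum_i\eta_i\alpha\otimes\theta(g_i)v$ on $A\otimes V$, and $\mathcal{R}^k_r(A,\theta)=\{\omega\in\mathcal{F}(A,\mathfrak{g})\mid\dim_{\mathbb{C}}H^k(A\otimes V,d_\omega)\ge r\}$. $\Pi(A,\theta)$ is the set of all tensors $\eta\otimes g$ with $\eta\in A^1$, $d\eta=0$, $g\in\mathfrak{g}$ and $\det(\theta(g))=0$. *)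

theory Defs
  imports
    "HOL-Analysis.Analysis"
    "HOL-Library.Function_Algebras"
    "HOL-Library.Poly_Mapping"
    "HOL-Library.Extended_Nat"
begin

section \<open>Complex vector spaces\<close>

class complex_vector = ab_group_add +
  fixes scaleC :: "complex \<Rightarrow> 'a \<Rightarrow> 'a"  (infixr \<open>*\<^sub>C\<close> 75)
  assumes scaleC_add_right: "c *\<^sub>C (x + y) = c *\<^sub>C x + c *\<^sub>C y"
    and scaleC_add_left: "(c + d) *\<^sub>C x = c *\<^sub>C x + d *\<^sub>C x"
    and scaleC_scaleC: "c *\<^sub>C d *\<^sub>C x = (c * d) *\<^sub>C x"
    and scaleC_one: "1 *\<^sub>C x = x"

global_interpretation cvs: vector_space "scaleC :: complex \<Rightarrow> 'a \<Rightarrow> 'a::complex_vector"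
  by unfold_locales (simp_all add: scaleC_add_right scaleC_add_left scaleC_scaleC scaleC_one)

abbreviation clinear :: "('a::complex_vector \<Rightarrow> 'b::complex_vector) \<Rightarrow> bool"
  where "clinear \<equiv> Vector_Spaces.linear scaleC scaleC"

instantiation complex :: complex_vector
begin
definition scaleC_complex :: "complex \<Rightarrow> complex \<Rightarrow> complex" where "scaleC_complex c x = c * x"
instance by standard (simp_all add: scaleC_complex_def algebra_simps)
end

instantiation "fun" :: (type, complex_vector) complex_vector
begin
definition scaleC_fun :: "complex \<Rightarrow> ('a \<Rightarrow> 'b) \<Rightarrow> 'a \<Rightarrow> 'b"
  where "scaleC_fun c f = (\<lambda>x. c *\<^sub>C f x)"
instance by standard (simp_all add: scaleC_fun_def fun_eq_iff
      scaleC_add_right scaleC_add_left scaleC_scaleC scaleC_one)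
end

instantiation vec :: (complex_vector, finite) complex_vector
begin
definition scaleC_vec :: "complex \<Rightarrow> ('a, 'b) vec \<Rightarrow> ('a, 'b) vec"
  where "scaleC_vec c v = (\<chi> i. c *\<^sub>C (v $ i))"
instance by standard (simp_all add: scaleC_vec_def vec_eq_iff
      scaleC_add_right scaleC_add_left scaleC_scaleC scaleC_one)
end

instantiation poly_mapping :: (type, complex_vector) complex_vector
begin
lift_definition scaleC_poly_mapping :: "complex \<Rightarrow> ('a \<Rightarrow>\<^sub>0 'b) \<Rightarrow> 'a \<Rightarrow>\<^sub>0 'b"
  is "\<lambda>c f k. c *\<^sub>C f k"
  by (erule rev_finite_subset) auto
instance by standard (transfer; simp add: fun_eq_iff
      scaleC_add_right scaleC_add_left scaleC_scaleC scaleC_one)+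
end

definition finite_dim :: "'a::complex_vector set \<Rightarrow> bool"
  where "finite_dim S \<longleftrightarrow> (\<exists>B. finite B \<and> S \<subseteq> cvs.span B)"

text \<open>Dimension of the quotient \<open>Z/B\<close> of two subspaces \<open>B \<subseteq> Z\<close>, possibly infinite.\<close>

definition quot_dim :: "'a::complex_vector set \<Rightarrow> 'a set \<Rightarrow> enat"
  where "quot_dim Z B = (SUP S \<in> {S. S \<subseteq> Z \<and> finite S \<and>
           (\<forall>c. (\<Sum>s\<in>S. c s *\<^sub>C s) \<in> B \<longrightarrow> (\<forall>s\<in>S. c s = 0))}. enat (card S))"

text \<open>
  Determinant of an endomorphism of a finite-dimensional space: Leibniz formula for its matrix in
  some basis \<open>B\<close>.  (On an infinite-dimensional space the value is meaningless.)
\<close>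

definition endo_det :: "('v::complex_vector \<Rightarrow> 'v) \<Rightarrow> complex"
  where "endo_det f = (let B = (SOME B. cvs.independent B \<and> cvs.span B = UNIV) in
           \<Sum>p | p permutes B. of_int (sign p) * (\<Prod>b\<in>B. cvs.representation B (f b) (p b)))"


section \<open>Tensor products over the complex numbers\<close>

text \<open>
  The tensor product of two spaces is the free vector space on pairs modulo the bilinearity
  relations.
\<close>

definition tensor_relators ::
    "(('a::complex_vector \<times> 'b::complex_vector) \<Rightarrow>\<^sub>0 complex) set"
  where "tensor_relators =
     {Poly_Mapping.single (a + a', b) 1 - Poly_Mapping.single (a, b) 1
        - Poly_Mapping.single (a', b) 1 |a a' b. True}
   \<union> {Poly_Mapping.single (a, b + b') 1 - Poly_Mapping.single (a, b) 1
        - Poly_Mapping.single (a, b') 1 |a b b'. True}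
   \<union> {Poly_Mapping.single (c *\<^sub>C a, b) 1 - c *\<^sub>C Poly_Mapping.single (a, b) 1 |c a b. True}
   \<union> {Poly_Mapping.single (a, c *\<^sub>C b) 1 - c *\<^sub>C Poly_Mapping.single (a, b) 1 |c a b. True}"

definition tensor_eq :: "(('a::complex_vector \<times> 'b::complex_vector) \<Rightarrow>\<^sub>0 complex)
    \<Rightarrow> (('a \<times> 'b) \<Rightarrow>\<^sub>0 complex) \<Rightarrow> bool"
  where "tensor_eq x y \<longleftrightarrow> x - y \<in> cvs.span tensor_relators"

lemma equivp_tensor_eq:
  "equivp (tensor_eq :: (('a::complex_vector \<times> 'b::complex_vector) \<Rightarrow>\<^sub>0 complex) \<Rightarrow> _)"
  (is "equivp ?R")
proof (rule equivpI)
  show "reflp ?R"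
    by (auto simp: reflp_def tensor_eq_def cvs.span_zero)
  show "symp ?R"
  proof (rule sympI)
    fix x y :: "('a \<times> 'b) \<Rightarrow>\<^sub>0 complex"
    assume "tensor_eq x y"
    then have "- (x - y) \<in> cvs.span tensor_relators"
      unfolding tensor_eq_def by (rule cvs.span_neg)
    then show "tensor_eq y x" by (simp add: tensor_eq_def)
  qed
  show "transp ?R"
  proof (rule transpI)
    fix x y z :: "('a \<times> 'b) \<Rightarrow>\<^sub>0 complex"
    assume "tensor_eq x y" "tensor_eq y z"
    then have "(x - y) + (y - z) \<in> cvs.span tensor_relators"
      unfolding tensor_eq_def by (rule cvs.span_add)
    then show "tensor_eq x z" by (simp add: tensor_eq_def)
  qed
qed

quotient_type (overloaded) ('a, 'b) tensor =
    "(('a::complex_vector \<times> 'b::complex_vector) \<Rightarrow>\<^sub>0 complex)" / tensor_eq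
  by (rule equivp_tensor_eq)

instantiation tensor :: (complex_vector, complex_vector) complex_vector
begin

lift_definition zero_tensor :: "('a, 'b) tensor" is 0 .

lift_definition plus_tensor :: "('a, 'b) tensor \<Rightarrow> ('a, 'b) tensor \<Rightarrow> ('a, 'b) tensor" is "(+)"
proof -
  fix x x' y y' :: "('a \<times> 'b) \<Rightarrow>\<^sub>0 complex"
  assume "tensor_eq x x'" "tensor_eq y y'"
  then have "(x - x') + (y - y') \<in> cvs.span tensor_relators"
    unfolding tensor_eq_def by (rule cvs.span_add)
  then show "tensor_eq (x + y) (x' + y')"
    by (simp add: tensor_eq_def add_diff_add)
qed

lift_definition minus_tensor :: "('a, 'b) tensor \<Rightarrow> ('a, 'b) tensor \<Rightarrow> ('a, 'b) tensor" is "(-)"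
proof -
  fix x x' y y' :: "('a \<times> 'b) \<Rightarrow>\<^sub>0 complex"
  assume "tensor_eq x x'" "tensor_eq y y'"
  then have "(x - x') - (y - y') \<in> cvs.span tensor_relators"
    unfolding tensor_eq_def by (rule cvs.span_diff)
  moreover have "(x - x') - (y - y') = (x - y) - (x' - y')" by simp
  ultimately show "tensor_eq (x - y) (x' - y')"
    by (simp only: tensor_eq_def)
qed

lift_definition uminus_tensor :: "('a, 'b) tensor \<Rightarrow> ('a, 'b) tensor" is "uminus"
proof -
  fix x x' :: "('a \<times> 'b) \<Rightarrow>\<^sub>0 complex"
  assume "tensor_eq x x'"
  then have "- (x - x') \<in> cvs.span tensor_relators"
    unfolding tensor_eq_def by (rule cvs.span_neg)
  moreover have "- (x - x') = - x - - x'" by simp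
  ultimately show "tensor_eq (- x) (- x')"
    by (simp only: tensor_eq_def)
qed

lift_definition scaleC_tensor :: "complex \<Rightarrow> ('a, 'b) tensor \<Rightarrow> ('a, 'b) tensor" is "scaleC"
proof -
  fix c and x x' :: "('a \<times> 'b) \<Rightarrow>\<^sub>0 complex"
  assume "tensor_eq x x'"
  then have "c *\<^sub>C (x - x') \<in> cvs.span tensor_relators"
    unfolding tensor_eq_def by (rule cvs.span_scale)
  then show "tensor_eq (c *\<^sub>C x) (c *\<^sub>C x')"
    by (simp only: tensor_eq_def cvs.scale_right_diff_distrib)
qed

lemma tensor_eqI: "x = y \<Longrightarrow> tensor_eq x y"
  by (simp add: tensor_eq_def cvs.span_zero)

instance
  by (standard; transfer; rule tensor_eqI)
    (simp_all add: add.assoc add.commute scaleC_add_right scaleC_add_left scaleC_scaleC scaleC_one)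

end

lift_definition pure_tensor :: "'a::complex_vector \<Rightarrow> 'b::complex_vector \<Rightarrow> ('a, 'b) tensor"
    (infix \<open>\<otimes>\<^sub>C\<close> 76)
  is "\<lambda>a b. Poly_Mapping.single (a, b) 1" .

definition tensor_sub ::
    "'a::complex_vector set \<Rightarrow> 'b::complex_vector set \<Rightarrow> ('a, 'b) tensor set"
  where "tensor_sub U W = cvs.span {u \<otimes>\<^sub>C w |u w. u \<in> U \<and> w \<in> W}"

text \<open>
  The linear map on \<open>U \<otimes> W\<close> sending \<open>u \<otimes> w\<close> to \<open>f u w\<close>, for \<open>f\<close> bilinear on \<open>U \<times> W\<close>.
\<close>

definition tensor_extend :: "'a::complex_vector set \<Rightarrow> 'b::complex_vector set
    \<Rightarrow> ('a \<Rightarrow> 'b \<Rightarrow> 'c::complex_vector) \<Rightarrow> ('a, 'b) tensor \<Rightarrow> 'c"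
  where "tensor_extend U W f t =
     (THE z. \<exists>ps. set ps \<subseteq> U \<times> W \<and> t = (\<Sum>(u, w)\<leftarrow>ps. u \<otimes>\<^sub>C w) \<and> z = (\<Sum>(u, w)\<leftarrow>ps. f u w))"


section \<open>Lie algebras and their modules\<close>

text \<open>A Lie algebra is a subspace of an ambient complex vector space together with a bracket.\<close>

record 'g lie =
  lie_carrier :: "'g set"
  lie_bracket :: "'g \<Rightarrow> 'g \<Rightarrow> 'g"

definition sl2 :: "(complex^2^2) lie"
  where "sl2 = \<lparr>lie_carrier = {X. trace X = 0}, lie_bracket = (\<lambda>X Y. X ** Y - Y ** X)\<rparr>"

text \<open>The standard Borel subalgebra: upper triangular matrices in \<open>sl2\<close>.\<close>

definition sol2 :: "(complex^2^2) lie"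
  where "sol2 = \<lparr>lie_carrier = {X. trace X = 0 \<and> X $ 2 $ 1 = 0},
                 lie_bracket = (\<lambda>X Y. X ** Y - Y ** X)\<rparr>"

text \<open>\<open>\<theta>\<close> makes the type \<open>'v\<close> a module; its values outside the carrier are irrelevant.\<close>

definition lie_module ::
    "'g::complex_vector lie \<Rightarrow> ('g \<Rightarrow> 'v::complex_vector \<Rightarrow> 'v) \<Rightarrow> bool"
  where "lie_module L \<theta> \<longleftrightarrow>
     (\<forall>x\<in>lie_carrier L. clinear (\<theta> x)) \<and>
     (\<forall>x\<in>lie_carrier L. \<forall>y\<in>lie_carrier L. \<forall>v. \<theta> (x + y) v = \<theta> x v + \<theta> y v) \<and>
     (\<forall>c. \<forall>x\<in>lie_carrier L. \<forall>v. \<theta> (c *\<^sub>C x) v = c *\<^sub>C \<theta> x v) \<and>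
     (\<forall>x\<in>lie_carrier L. \<forall>y\<in>lie_carrier L. \<forall>v.
        \<theta> (lie_bracket L x y) v = \<theta> x (\<theta> y v) - \<theta> y (\<theta> x v))"


section \<open>Flat connections and resonance varieties\<close>

record 'a cdga =
  deg_part :: "nat \<Rightarrow> 'a set"
  dg_mult :: "'a \<Rightarrow> 'a \<Rightarrow> 'a"
  dg_one :: 'a
  dg_diff :: "'a \<Rightarrow> 'a"

definition dg_total :: "'a::complex_vector cdga \<Rightarrow> 'a set"
  where "dg_total A = cvs.span (\<Union>k. deg_part A k)"

definition conn_diff ::
    "'a::complex_vector cdga \<Rightarrow> 'g::complex_vector lie \<Rightarrow> ('a, 'g) tensor \<Rightarrow> ('a, 'g) tensor"
  where "conn_diff A L = tensor_extend (dg_total A) (lie_carrier L) (\<lambda>\<alpha> x. dg_diff A \<alpha> \<otimes>\<^sub>C x)"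

definition conn_bracket :: "'a::complex_vector cdga \<Rightarrow> 'g::complex_vector lie
    \<Rightarrow> ('a, 'g) tensor \<Rightarrow> ('a, 'g) tensor \<Rightarrow> ('a, 'g) tensor"
  where "conn_bracket A L s t =
     tensor_extend (dg_total A) (lie_carrier L) (\<lambda>\<alpha> x.
       tensor_extend (dg_total A) (lie_carrier L) (\<lambda>\<beta> y.
         dg_mult A \<alpha> \<beta> \<otimes>\<^sub>C lie_bracket L x y) t) s"

definition flat_connections ::
    "'a::complex_vector cdga \<Rightarrow> 'g::complex_vector lie \<Rightarrow> ('a, 'g) tensor set"
  where "flat_connections A L = {\<omega> \<in> tensor_sub (deg_part A 1) (lie_carrier L).
           conn_diff A L \<omega> + (1/2) *\<^sub>C conn_bracket A L \<omega> \<omega> = 0}"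

text \<open>The differential \<open>d\<^sub>\<omega>\<close> on \<open>A \<otimes> V\<close>, where \<open>V\<close> is the whole type \<open>'v\<close>.\<close>

definition twisted_diff ::
    "'a::complex_vector cdga \<Rightarrow> 'g::complex_vector lie \<Rightarrow> ('g \<Rightarrow> 'v::complex_vector \<Rightarrow> 'v)
      \<Rightarrow> ('a, 'g) tensor \<Rightarrow> ('a, 'v) tensor \<Rightarrow> ('a, 'v) tensor"
  where "twisted_diff A L \<theta> \<omega> =
     tensor_extend (dg_total A) UNIV (\<lambda>\<alpha> v. dg_diff A \<alpha> \<otimes>\<^sub>C v +
       tensor_extend (deg_part A 1) (lie_carrier L) (\<lambda>\<eta> x. dg_mult A \<eta> \<alpha> \<otimes>\<^sub>C \<theta> x v) \<omega>)"

definition twisted_cocycles ::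
    "'a::complex_vector cdga \<Rightarrow> 'g::complex_vector lie \<Rightarrow> ('g \<Rightarrow> 'v::complex_vector \<Rightarrow> 'v)
      \<Rightarrow> ('a, 'g) tensor \<Rightarrow> nat \<Rightarrow> ('a, 'v) tensor set"
  where "twisted_cocycles A L \<theta> \<omega> k =
     {t \<in> tensor_sub (deg_part A k) UNIV. twisted_diff A L \<theta> \<omega> t = 0}"

definition twisted_coboundaries ::
    "'a::complex_vector cdga \<Rightarrow> 'g::complex_vector lie \<Rightarrow> ('g \<Rightarrow> 'v::complex_vector \<Rightarrow> 'v)
      \<Rightarrow> ('a, 'g) tensor \<Rightarrow> nat \<Rightarrow> ('a, 'v) tensor set"
  where "twisted_coboundaries A L \<theta> \<omega> k =
     (case k of 0 \<Rightarrow> {0} | Suc j \<Rightarrow> twisted_diff A L \<theta> \<omega> ` tensor_sub (deg_part A j) UNIV)"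

definition resonance ::
    "'a::complex_vector cdga \<Rightarrow> 'g::complex_vector lie \<Rightarrow> ('g \<Rightarrow> 'v::complex_vector \<Rightarrow> 'v)
      \<Rightarrow> nat \<Rightarrow> nat \<Rightarrow> ('a, 'g) tensor set"
  where "resonance A L \<theta> k r = {\<omega> \<in> flat_connections A L.
     quot_dim (twisted_cocycles A L \<theta> \<omega> k) (twisted_coboundaries A L \<theta> \<omega> k) \<ge> enat r}"

definition Pi_set ::
    "'a::complex_vector cdga \<Rightarrow> 'g::complex_vector lie \<Rightarrow> ('g \<Rightarrow> 'v::complex_vector \<Rightarrow> 'v)
      \<Rightarrow> ('a, 'g) tensor set"
  where "Pi_set A L \<theta> = {\<eta> \<otimes>\<^sub>C x |\<eta> x.
     \<eta> \<in> deg_part A 1 \<and> dg_diff A \<eta> = 0 \<and> x \<in> lie_carrier L \<and> endo_det (\<theta> x) = 0}"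


section \<open>The Chevalley--Eilenberg algebra\<close>

text \<open>
  The exterior algebra on the dual of a finite-dimensional Lie algebra, realised as alternating
  multilinear forms.  All degrees live in one type: a form is a function on finite lists of
  vectors, a \<open>k\<close>-form being supported on lists of length \<open>k\<close> with entries in the carrier.
\<close>

definition alt_forms :: "'g::complex_vector set \<Rightarrow> nat \<Rightarrow> ('g list \<Rightarrow> complex) set"
  where "alt_forms F k = {\<alpha>.
     (\<forall>xs. \<not> (length xs = k \<and> set xs \<subseteq> F) \<longrightarrow> \<alpha> xs = 0) \<and>
     (\<forall>xs ys. \<forall>x\<in>F. \<forall>y\<in>F. set xs \<subseteq> F \<and> set ys \<subseteq> F \<longrightarrow>
        \<alpha> (xs @ (x + y) # ys) = \<alpha> (xs @ x # ys) + \<alpha> (xs @ y # ys)) \<and>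
     (\<forall>xs ys c. \<forall>x\<in>F. set xs \<subseteq> F \<and> set ys \<subseteq> F \<longrightarrow>
        \<alpha> (xs @ (c *\<^sub>C x) # ys) = c * \<alpha> (xs @ x # ys)) \<and>
     (\<forall>xs. \<not> distinct xs \<longrightarrow> \<alpha> xs = 0)}"

text \<open>
  Exterior product: sum over all ways to split the arguments between the two factors, with the
  sign of the shuffle.
\<close>

definition wedge :: "('g list \<Rightarrow> complex) \<Rightarrow> ('g list \<Rightarrow> complex) \<Rightarrow> 'g list \<Rightarrow> complex"
  where "wedge \<alpha> \<beta> xs = (\<Sum>I\<in>Pow {..<length xs}.
     (-1) ^ card {(i, j). i \<in> {..<length xs} - I \<and> j \<in> I \<and> i < j}
       * \<alpha> (nths xs I) * \<beta> (nths xs (- I)))"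

text \<open>
  \<open>(d\<alpha>)(x\<^sub>0, \<dots>, x\<^sub>k) = \<Sum>\<^sub>i\<^sub><\<^sub>j (-1)\<^sup>i\<^sup>+\<^sup>1 \<alpha>(\<dots>, x\<^sub>i omitted, \<dots>, [x\<^sub>i, x\<^sub>j] in place of x\<^sub>j, \<dots>)\<close>.
  The lemmas \<open>ce_diff_one_form\<close> and \<open>ce_diff_Leibniz\<close> below show that this is minus the dual of the
  bracket on one-forms, extended by the graded Leibniz rule.
\<close>

definition ce_diff :: "'g lie \<Rightarrow> ('g list \<Rightarrow> complex) \<Rightarrow> 'g list \<Rightarrow> complex"
  where "ce_diff L \<alpha> xs = (if set xs \<subseteq> lie_carrier L then
     (\<Sum>j<length xs. \<Sum>i<j.
        (-1) ^ (i + 1) * \<alpha> (nths (xs[j := lie_bracket L (xs ! i) (xs ! j)]) (- {i}))) else 0)"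

definition CE :: "'g::complex_vector lie \<Rightarrow> ('g list \<Rightarrow> complex) cdga"
  where "CE L = \<lparr>deg_part = alt_forms (lie_carrier L), dg_mult = wedge,
                 dg_one = (\<lambda>xs. if xs = [] then 1 else 0), dg_diff = ce_diff L\<rparr>"


lemma nths_compl0: "nths (x # xs) (- I) = (if 0 \<in> I then [] else [x]) @ nths xs (- {j. Suc j \<in> I})"
proof -
  have "{j. Suc j \<in> - I} = - {j. Suc j \<in> I}" by auto
  then show ?thesis by (simp add: nths_Cons)
qed

abbreviation (input) signed :: "('g list \<Rightarrow> complex) \<Rightarrow> 'g list \<Rightarrow> complex"
  where "signed \<alpha> \<equiv> (\<lambda>xs. (- 1) ^ length xs * \<alpha> xs)"

abbreviation (input) contr :: "'g \<Rightarrow> ('g list \<Rightarrow> complex) \<Rightarrow> 'g list \<Rightarrow> complex"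
  where "contr x \<alpha> \<equiv> (\<lambda>xs. \<alpha> (x # xs))"

lemma map_prod_Suc_iff:
  "(a, b) \<in> map_prod Suc Suc ` B \<longleftrightarrow> (\<exists>a' b'. a = Suc a' \<and> b = Suc b' \<and> (a', b') \<in> B)"
  by force

lemma inv_count_0:
  assumes "0 \<in> I"
  shows "card {(i, j). i \<in> {..<Suc n} - I \<and> j \<in> I \<and> i < j} =
     card {(i, j). i \<in> {..<n} - {j. Suc j \<in> I} \<and> j \<in> {j. Suc j \<in> I} \<and> i < j}"
proof -
  let ?B = "{(i, j). i \<in> {..<n} - {j. Suc j \<in> I} \<and> j \<in> {j. Suc j \<in> I} \<and> i < j}"
  have eq: "(a, b) \<in> {(i, j). i \<in> {..<Suc n} - I \<and> j \<in> I \<and> i < j}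
      \<longleftrightarrow> (a, b) \<in> map_prod Suc Suc ` ?B" for a b
    unfolding map_prod_Suc_iff using assms by (cases a; cases b) auto
  have e: "{(i, j). i \<in> {..<Suc n} - I \<and> j \<in> I \<and> i < j} = map_prod Suc Suc ` ?B"
    by (rule set_eqI, unfold split_paired_all) (rule eq)
  show ?thesis
    unfolding e by (rule card_image) (auto simp: inj_on_def)
qed

lemma inv_count_1:
  assumes "0 \<notin> I" "I \<subseteq> {..<Suc n}"
  shows "card {(i, j). i \<in> {..<Suc n} - I \<and> j \<in> I \<and> i < j} =
     card {j. Suc j \<in> I} +
     card {(i, j). i \<in> {..<n} - {j. Suc j \<in> I} \<and> j \<in> {j. Suc j \<in> I} \<and> i < j}"
proof -
  let ?B = "{(i, j). i \<in> {..<n} - {j. Suc j \<in> I} \<and> j \<in> {j. Suc j \<in> I} \<and> i < j}"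
  let ?A = "{j. Suc j \<in> I}"
  have eq: "(a, b) \<in> {(i, j). i \<in> {..<Suc n} - I \<and> j \<in> I \<and> i < j}
      \<longleftrightarrow> (a, b) \<in> (\<lambda>j. (0, Suc j)) ` ?A \<union> map_prod Suc Suc ` ?B" for a b
    unfolding Un_iff map_prod_Suc_iff using assms by (cases a; cases b) auto
  have e: "{(i, j). i \<in> {..<Suc n} - I \<and> j \<in> I \<and> i < j}
      = (\<lambda>j. (0, Suc j)) ` ?A \<union> map_prod Suc Suc ` ?B"
    by (rule set_eqI, unfold split_paired_all) (rule eq)
  have fA: "finite ?A" using assms(2) by (auto intro: finite_subset[of _ "{..<n}"])
  have fB: "finite ?B" by (rule finite_subset[of _ "{..<n} \<times> {..<n}"]) (use assms(2) in auto)
  have "card ((\<lambda>j. (0::nat, Suc j)) ` ?A) = card ?A"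
    by (rule card_image) (auto simp: inj_on_def)
  moreover have "card (map_prod Suc Suc ` ?B) = card ?B"
    by (rule card_image) (auto simp: inj_on_def)
  moreover have "(\<lambda>j. (0, Suc j)) ` ?A \<inter> map_prod Suc Suc ` ?B = {}" by auto
  ultimately show ?thesis unfolding e using fA fB by (subst card_Un_disjoint) auto
qed

lemma wedge_Nil: "wedge \<alpha> \<beta> [] = \<alpha> [] * \<beta> []"
  by (simp add: wedge_def)

lemma wedge_Cons: "wedge \<alpha> \<beta> (x # xs) =
   wedge (contr x \<alpha>) \<beta> xs + wedge (signed \<alpha>) (contr x \<beta>) xs"
proof -
  let ?n = "length xs"
  let ?t = "\<lambda>I. (-1) ^ card {(i, j). i \<in> {..<length (x#xs)} - I \<and> j \<in> I \<and> i < j}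
       * \<alpha> (nths (x#xs) I) * \<beta> (nths (x#xs) (- I))"
  have P: "Pow {..<Suc ?n} = (\<lambda>J. insert 0 (Suc ` J)) ` Pow {..<?n} \<union> (\<lambda>J. Suc ` J) ` Pow {..<?n}"
    unfolding lessThan_Suc_eq_insert_0 Pow_insert image_Pow_surj[OF refl, symmetric] image_image
    by (rule Un_commute)
  have s: "{j. Suc j \<in> insert 0 (Suc ` J)} = J" "{j. Suc j \<in> Suc ` J} = J" for J by auto
  have i: "inj_on (\<lambda>J. insert 0 (Suc ` J)) (Pow {..<?n})" "inj_on (\<lambda>J. Suc ` J) (Pow {..<?n})"
    by (rule inj_onI, drule arg_cong[where f = "\<lambda>I. {j. Suc j \<in> I}"], simp only: s)+
  have l: "length (nths xs J) = card J" if "J \<subseteq> {..<?n}" for J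
    unfolding length_nths by (rule arg_cong[where f=card]) (use that in auto)
  have "wedge \<alpha> \<beta> (x # xs) = sum ?t (Pow {..<Suc ?n})" by (simp add: wedge_def)
  also have "\<dots> = sum ?t ((\<lambda>J. insert 0 (Suc ` J)) ` Pow {..<?n}) + sum ?t ((\<lambda>J. Suc ` J) ` Pow {..<?n})"
    unfolding P by (rule sum.union_disjoint) auto
  also have "\<dots> = (\<Sum>J\<in>Pow {..<?n}. ?t (insert 0 (Suc ` J))) + (\<Sum>J\<in>Pow {..<?n}. ?t (Suc ` J))"
    by (simp add: sum.reindex[OF i(1)] sum.reindex[OF i(2)])
  also have "(\<Sum>J\<in>Pow {..<?n}. ?t (insert 0 (Suc ` J))) = wedge (contr x \<alpha>) \<beta> xs"
    unfolding wedge_def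
    by (rule sum.cong[OF refl])
      (simp only: nths_compl0, simp only: list.size add_Suc_right add_0_right
        inv_count_0[OF insertI1] s nths_Cons insertI1 if_True append_Nil append_Cons)
  also have "(\<Sum>J\<in>Pow {..<?n}. ?t (Suc ` J)) = wedge (signed \<alpha>) (contr x \<beta>) xs"
    unfolding wedge_def
  proof (rule sum.cong[OF refl], goal_cases)
    case (1 J)
    have c: "card {(i, j). i \<in> {..<Suc ?n} - Suc ` J \<and> j \<in> Suc ` J \<and> i < j} = card J
       + card {(i, j). i \<in> {..<?n} - J \<and> j \<in> J \<and> i < j}"
      using inv_count_1[of "Suc ` J" ?n] 1 unfolding s by auto
    have "{j. Suc j \<notin> Suc ` J} = - J" by auto
    with c show ?case using 1 l[of J] by (simp add: power_add nths_compl0 s nths_Cons)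
  qed
  finally show ?thesis .
qed

text \<open>
  The proof of the Leibniz rule uses Cartan's formula \<open>\<iota>\<^sub>x d = L\<^sub>x - d \<iota>\<^sub>x\<close>; \<open>L0 [x, -]\<close> is minus the
  Lie derivative, and \<open>d0\<close> is the differential without the restriction to the carrier.
\<close>

definition d0 :: "('g \<Rightarrow> 'g \<Rightarrow> 'g) \<Rightarrow> ('g list \<Rightarrow> complex) \<Rightarrow> 'g list \<Rightarrow> complex" where
 "d0 br \<alpha> xs = (\<Sum>j<length xs. \<Sum>i<j.
        (-1) ^ (i + 1) * \<alpha> (nths (xs[j := br (xs ! i) (xs ! j)]) (- {i})))"
definition L0 :: "('g \<Rightarrow> 'g) \<Rightarrow> ('g list \<Rightarrow> complex) \<Rightarrow> 'g list \<Rightarrow> complex" where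
 "L0 b \<alpha> xs = (\<Sum>j<length xs. \<alpha> (xs[j := b (xs ! j)]))"

lemma L0_Cons: "L0 b \<alpha> (x # xs) = \<alpha> (b x # xs) + L0 b (contr x \<alpha>) xs"
  by (simp add: L0_def sum.lessThan_Suc_shift del: sum.lessThan_Suc)

lemma d0_Cons: "d0 br \<alpha> (x # xs) = - L0 (br x) \<alpha> xs - d0 br (contr x \<alpha>) xs"
proof -
  have a: "nths l (- {0}) = tl l" for l :: "'a list"
  proof (cases l)
    case (Cons a list) then show ?thesis by (simp add: nths_compl0 nths_all)
  qed simp
  have b: "nths (x # l) (- {Suc i}) = x # nths l (- {i})" for l i by (simp add: nths_compl0)
  show ?thesis
  by (simp add: d0_def L0_def sum.lessThan_Suc_shift a b sum.distrib sum_negf sum_subtractf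
      del: sum.lessThan_Suc)
qed

lemma wedge_lin:
  "wedge (\<lambda>xs. a xs + b xs) c xs = wedge a c xs + wedge b c xs"
  "wedge a (\<lambda>xs. b xs + c xs) xs = wedge a b xs + wedge a c xs"
  "wedge (\<lambda>xs. a xs - b xs) c xs = wedge a c xs - wedge b c xs"
  "wedge a (\<lambda>xs. b xs - c xs) xs = wedge a b xs - wedge a c xs"
  "wedge (\<lambda>xs. - a xs) c xs = - wedge a c xs"
  "wedge a (\<lambda>xs. - c xs) xs = - wedge a c xs"
  by (simp_all add: wedge_def algebra_simps sum.distrib sum_subtractf sum_negf)

lemma L0_lin: "L0 f (\<lambda>xs. a xs + b xs) xs = L0 f a xs + L0 f b xs"
  by (simp add: L0_def sum.distrib)
lemma L0_signed: "L0 f (signed a) xs = signed (L0 f a) xs"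
  by (simp add: L0_def sum_distrib_left)

lemma L0_wedge: "L0 f (wedge a b) xs = wedge (L0 f a) b xs + wedge a (L0 f b) xs"
proof (induction xs arbitrary: a b)
  case Nil
  then show ?case by (simp add: L0_def wedge_Nil)
next
  case (Cons x xs)
  show ?case
    by (simp add: L0_Cons wedge_Cons L0_lin Cons.IH wedge_lin L0_signed)
qed

lemma d0_lin: "d0 f (\<lambda>xs. a xs + b xs) xs = d0 f a xs + d0 f b xs"
  by (simp add: d0_def sum.distrib sum_subtractf sum_negf algebra_simps)

lemma d0_signed: "d0 f (signed a) xs = - signed (d0 f a) xs"
proof (induction xs arbitrary: a)
  case Nil
  then show ?case by (simp add: d0_def)
next
  case (Cons x xs)
  have "d0 f (\<lambda>xs. - ((- 1) ^ length xs * a (x # xs))) xs = - d0 f (signed (contr x a)) xs"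
    by (simp add: d0_def sum_negf)
  then show ?case
    by (simp add: d0_Cons L0_signed Cons.IH right_diff_distrib)
qed

lemma d0_wedge: "d0 f (wedge a b) xs = wedge (d0 f a) b xs + wedge (signed a) (d0 f b) xs"
proof (induction xs arbitrary: a b)
  case Nil
  then show ?case by (simp add: d0_def wedge_Nil)
next
  case (Cons x xs)
  have s: "signed (signed c) = c" for c :: "'a list \<Rightarrow> complex"
    by (simp add: fun_eq_iff mult.assoc[symmetric] power_mult_distrib[symmetric])
  show ?case
    by (simp add: d0_Cons wedge_Cons L0_wedge d0_lin Cons.IH wedge_lin d0_signed s)
qed
lemma ce_diff_d0: "set xs \<subseteq> lie_carrier L \<Longrightarrow> ce_diff L \<alpha> xs = d0 (lie_bracket L) \<alpha> xs"
  by (simp add: ce_diff_def d0_def)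

lemma wedge_cong:
  assumes "\<And>ys. set ys \<subseteq> set xs \<Longrightarrow> \<alpha> ys = \<alpha>' ys" "\<And>ys. set ys \<subseteq> set xs \<Longrightarrow> \<beta> ys = \<beta>' ys"
  shows "wedge \<alpha> \<beta> xs = wedge \<alpha>' \<beta>' xs"
  unfolding wedge_def by (rule sum.cong) (simp_all add: assms set_nths_subset)

lemma wedge_outside:
  assumes "\<And>ys. \<not> set ys \<subseteq> F \<Longrightarrow> \<alpha> ys = 0" "\<And>ys. \<not> set ys \<subseteq> F \<Longrightarrow> \<beta> ys = 0" "\<not> set xs \<subseteq> F"
  shows "wedge \<alpha> \<beta> xs = 0"
  unfolding wedge_def
proof (rule sum.neutral, rule ballI)
  fix I
  have "set xs = set (nths xs I) \<union> set (nths xs (- I))"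
    by (auto simp: set_nths) (metis in_set_conv_nth)
  then have "\<alpha> (nths xs I) = 0 \<or> \<beta> (nths xs (- I)) = 0"
    using assms by (metis Un_subset_iff)
  then show "(-1) ^ card {(i, j). i \<in> {..<length xs} - I \<and> j \<in> I \<and> i < j}
       * \<alpha> (nths xs I) * \<beta> (nths xs (- I)) = 0" by auto
qed

lemma alt_formsD:
  "\<alpha> \<in> alt_forms F k \<Longrightarrow> \<not> (length xs = k \<and> set xs \<subseteq> F) \<Longrightarrow> \<alpha> xs = 0"
  unfolding alt_forms_def by blast

lemma ce_diff_one_form:
  assumes "\<alpha> \<in> alt_forms (lie_carrier L) 1"
  shows "ce_diff L \<alpha> xs = (if length xs = 2 \<and> set xs \<subseteq> lie_carrier L
           then - \<alpha> [lie_bracket L (xs ! 0) (xs ! 1)] else 0)"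
proof (cases "set xs \<subseteq> lie_carrier L \<and> length xs = 2")
  case True
  then obtain x y where "xs = [x, y]"
    by (metis (no_types, lifting) One_nat_def Suc_1 length_0_conv length_Suc_conv)
  with True show ?thesis
    by (simp add: ce_diff_def lessThan_Suc nths_Cons)
next
  case False
  have "length (nths (xs[j := b]) (- {i})) \<noteq> 1"
    if "length xs \<noteq> 2" "j < length xs" "i < j" for i j b
  proof -
    have "{k. k < length xs \<and> k \<in> - {i}} = {..<length xs} - {i}" by auto
    then have "length (nths (xs[j := b]) (- {i})) = length xs - 1"
      using that by (simp add: length_nths)
    then show ?thesis using that by linarith
  qed
  then have "\<alpha> (nths (xs[j := b]) (- {i})) = 0"
    if "length xs \<noteq> 2" "j < length xs" "i < j" for i j b
    using that by (blast intro: alt_formsD[OF assms])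
  then show ?thesis using False
    by (auto simp: ce_diff_def intro!: sum.neutral)
qed

lemma ce_diff_Leibniz:
  assumes a: "\<alpha> \<in> alt_forms (lie_carrier L) p" and b: "\<beta> \<in> alt_forms (lie_carrier L) q"
  shows "ce_diff L (wedge \<alpha> \<beta>) xs
           = wedge (ce_diff L \<alpha>) \<beta> xs + (-1) ^ p * wedge \<alpha> (ce_diff L \<beta>) xs"
proof (cases "set xs \<subseteq> lie_carrier L")
  case True
  have s: "signed \<alpha> = (\<lambda>ys. (-1) ^ p * \<alpha> ys)"
  proof
    fix ys show "signed \<alpha> ys = (-1) ^ p * \<alpha> ys"
      by (cases "length ys = p") (auto simp: alt_formsD[OF a])
  qed
  have "ce_diff L (wedge \<alpha> \<beta>) xs = wedge (d0 (lie_bracket L) \<alpha>) \<beta> xs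
      + wedge (signed \<alpha>) (d0 (lie_bracket L) \<beta>) xs"
    using True by (simp add: ce_diff_d0 d0_wedge)
  also have "wedge (d0 (lie_bracket L) \<alpha>) \<beta> xs = wedge (ce_diff L \<alpha>) \<beta> xs"
    by (rule wedge_cong) (use True in \<open>auto simp: ce_diff_d0\<close>)
  also have "wedge (signed \<alpha>) (d0 (lie_bracket L) \<beta>) xs
      = wedge (\<lambda>ys. (-1) ^ p * \<alpha> ys) (ce_diff L \<beta>) xs"
    unfolding s by (rule wedge_cong) (use True in \<open>auto simp: ce_diff_d0\<close>)
  also have "\<dots> = (-1) ^ p * wedge \<alpha> (ce_diff L \<beta>) xs"
    by (simp add: wedge_def sum_distrib_left mult_ac)
  finally show ?thesis .
next
  case False
  have "wedge (ce_diff L \<alpha>) \<beta> xs = 0" "wedge \<alpha> (ce_diff L \<beta>) xs = 0"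
    by (rule wedge_outside[of "lie_carrier L"];
        use False in \<open>auto simp: ce_diff_def alt_formsD[OF a] alt_formsD[OF b]\<close>)+
  then show ?thesis using False by (simp add: ce_diff_def)
qed


section \<open>The Malcev Lie algebra of a group\<close>

text \<open>
  Groups are types of class \<open>group_add\<close>; the operation is written additively but is not assumed
  commutative.  The library's convolution product turns \<open>'p \<Rightarrow>\<^sub>0 complex\<close> into the group algebra.
\<close>

definition add_subgroup :: "'p::group_add set \<Rightarrow> bool"
  where "add_subgroup H \<longleftrightarrow> 0 \<in> H \<and> (\<forall>x\<in>H. \<forall>y\<in>H. x + y \<in> H) \<and> (\<forall>x\<in>H. - x \<in> H)"

definition finitely_generated_group :: "'p::group_add itself \<Rightarrow> bool"
  where "finitely_generated_group _ \<longleftrightarrow> (\<exists>S::'p set. finite S \<and> add_subgroup hull S = UNIV)"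

primrec lower_central :: "nat \<Rightarrow> 'p::group_add set"
  where "lower_central 0 = UNIV"
  | "lower_central (Suc n) = add_subgroup hull {x + y - x - y |x y. y \<in> lower_central n}"

definition nilpotent_group :: "'p::group_add itself \<Rightarrow> bool"
  where "nilpotent_group _ \<longleftrightarrow> (\<exists>n. lower_central n = {0::'p})"

definition lin_ext :: "('k \<Rightarrow> 'b::complex_vector) \<Rightarrow> ('k \<Rightarrow>\<^sub>0 complex) \<Rightarrow> 'b"
  where "lin_ext \<phi> x = (\<Sum>k\<in>Poly_Mapping.keys x. Poly_Mapping.lookup x k *\<^sub>C \<phi> k)"

definition augmentation :: "('p \<Rightarrow>\<^sub>0 complex) \<Rightarrow> complex"
  where "augmentation = lin_ext (\<lambda>_. 1)"

definition push :: "('p \<Rightarrow> 'q) \<Rightarrow> ('p \<Rightarrow>\<^sub>0 complex) \<Rightarrow> 'q \<Rightarrow>\<^sub>0 complex"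
  where "push f = lin_ext (\<lambda>g. Poly_Mapping.single (f g) 1)"

primrec aug_pow :: "nat \<Rightarrow> ('p::group_add \<Rightarrow>\<^sub>0 complex) set"
  where "aug_pow 0 = UNIV"
  | "aug_pow (Suc n) = cvs.span {a * b |a b. augmentation a = 0 \<and> b \<in> aug_pow n}"

lemma lin_ext_superset:
  assumes "finite S" "Poly_Mapping.keys x \<subseteq> S"
  shows "lin_ext \<phi> x = (\<Sum>k\<in>S. Poly_Mapping.lookup x k *\<^sub>C \<phi> k)"
  unfolding lin_ext_def
  by (rule sum.mono_neutral_left) (use assms in \<open>auto simp: in_keys_iff\<close>)

lemma lin_ext_add: "lin_ext \<phi> (x + y) = lin_ext \<phi> x + lin_ext \<phi> y"
proof -
  let ?S = "Poly_Mapping.keys x \<union> Poly_Mapping.keys y"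
  have "lin_ext \<phi> z = (\<Sum>k\<in>?S. Poly_Mapping.lookup z k *\<^sub>C \<phi> k)" if "z \<in> {x, y, x + y}" for z
    by (rule lin_ext_superset) (use that Poly_Mapping.keys_add[of x y] in auto)
  then show ?thesis
    by (simp add: lookup_add scaleC_add_left sum.distrib)
qed

lemma lookup_scaleC [simp]: "Poly_Mapping.lookup (c *\<^sub>C x) k = c *\<^sub>C Poly_Mapping.lookup x k"
  by transfer simp

lemma lin_ext_scaleC: "lin_ext \<phi> (c *\<^sub>C x) = c *\<^sub>C lin_ext \<phi> x"
proof -
  have "lin_ext \<phi> (c *\<^sub>C x) =
      (\<Sum>k\<in>Poly_Mapping.keys x. Poly_Mapping.lookup (c *\<^sub>C x) k *\<^sub>C \<phi> k)"
    by (rule lin_ext_superset) (auto simp: in_keys_iff scaleC_complex_def)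
  also have "\<dots> = c *\<^sub>C lin_ext \<phi> x"
    by (simp add: lin_ext_def cvs.scale_sum_right scaleC_scaleC scaleC_complex_def)
  finally show ?thesis .
qed

lemma lin_ext_zero: "lin_ext \<phi> 0 = 0"
  by (simp add: lin_ext_def)

lemma lin_ext_diff: "lin_ext \<phi> (x - y) = lin_ext \<phi> x - lin_ext \<phi> y"
  using lin_ext_add[of \<phi> "x - y" y] by simp

lemma lin_ext_single: "lin_ext \<phi> (Poly_Mapping.single k c) = c *\<^sub>C \<phi> k"
  by (cases "c = 0") (simp_all add: lin_ext_def)

lemma group_algebra_induct [case_names zero add]:
  assumes "P 0" "\<And>x k c. P x \<Longrightarrow> P (x + Poly_Mapping.single k c)"
  shows "P (x :: 'k \<Rightarrow>\<^sub>0 complex)"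
proof (induction x rule: update_induct)
  case const
  then show ?case using assms(1) by simp
next
  case (update f a b)
  have "Poly_Mapping.update a b f = f + Poly_Mapping.single a b"
    using update by (intro poly_mapping_eqI)
      (auto simp: lookup_update lookup_add lookup_single in_keys_iff when_def)
  then show ?case using assms(2) update by metis
qed

lemma scaleC_mult_left: "(c *\<^sub>C x) * y = c *\<^sub>C (x * y)"
  for x y :: "'p::monoid_add \<Rightarrow>\<^sub>0 complex"
proof -
  have c: "c *\<^sub>C z = Poly_Mapping.single 0 c * z" for z :: "'p \<Rightarrow>\<^sub>0 complex"
  proof (induction z rule: group_algebra_induct)
    case zero
    then show ?case by (simp add: cvs.scale_zero_right)
  next
    case (add z k d)
    have "c *\<^sub>C Poly_Mapping.single k d = Poly_Mapping.single k (c * d)"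
      by (rule poly_mapping_eqI) (simp add: lookup_single when_def scaleC_complex_def)
    then show ?case
      using add by (simp add: scaleC_add_right distrib_left mult_single)
  qed
  show ?thesis unfolding c by (simp add: mult.assoc)
qed

lemma scaleC_mult_right: "x * (c *\<^sub>C y) = c *\<^sub>C (x * y)"
  for x y :: "'p::monoid_add \<Rightarrow>\<^sub>0 complex"
proof -
  have c: "c *\<^sub>C z = z * Poly_Mapping.single 0 c" for z :: "'p \<Rightarrow>\<^sub>0 complex"
  proof (induction z rule: group_algebra_induct)
    case zero
    then show ?case by (simp add: cvs.scale_zero_right)
  next
    case (add z k d)
    have "c *\<^sub>C Poly_Mapping.single k d = Poly_Mapping.single k (d * c)"
      by (rule poly_mapping_eqI) (simp add: lookup_single when_def scaleC_complex_def)
    then show ?case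
      using add by (simp add: scaleC_add_right distrib_right mult_single)
  qed
  show ?thesis unfolding c by (simp add: mult.assoc)
qed

lemma augmentation_mult: "augmentation (x * y) = augmentation x * augmentation y"
  for x y :: "'p::monoid_add \<Rightarrow>\<^sub>0 complex"
proof (induction x rule: group_algebra_induct)
  case zero
  then show ?case by (simp add: augmentation_def lin_ext_zero)
next
  case (add x k c)
  have "augmentation (Poly_Mapping.single k c * y) = c * augmentation y"
    by (induction y rule: group_algebra_induct)
      (simp_all add: augmentation_def lin_ext_zero distrib_left lin_ext_add mult_single
        lin_ext_single scaleC_complex_def)
  then show ?case
    using add by (simp add: distrib_right augmentation_def lin_ext_add lin_ext_single
        scaleC_complex_def)
qed

lemma push_mult:
  assumes f: "\<And>a b. f (a + b) = f a + f b"
  shows "push f (x * y) = push f x * push f y"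
proof (induction x rule: group_algebra_induct)
  case zero
  then show ?case by (simp add: push_def lin_ext_zero)
next
  case (add x k c)
  have "push f (Poly_Mapping.single k c * y) = push f (Poly_Mapping.single k c) * push f y"
    by (induction y rule: group_algebra_induct)
      (simp_all add: push_def lin_ext_zero distrib_left lin_ext_add mult_single
        lin_ext_single scaleC_mult_left scaleC_mult_right scaleC_scaleC f)
  then show ?case
    using add by (simp add: distrib_right push_def lin_ext_add)
qed

lemma augmentation_push: "augmentation (push f x) = augmentation x"
  by (induction x rule: group_algebra_induct)
    (simp_all add: augmentation_def push_def lin_ext_zero lin_ext_add lin_ext_single lin_ext_scaleC)

lemma subspace_aug_pow: "cvs.subspace (aug_pow n)"
  by (cases n) auto

lemma aug_pow_right: "b \<in> aug_pow n \<Longrightarrow> b * r \<in> aug_pow n"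
proof (induction n arbitrary: b)
  case 0
  then show ?case by simp
next
  case (Suc n)
  from Suc.prems have "b \<in> cvs.span {a * b |a b. augmentation a = 0 \<and> b \<in> aug_pow n}" by simp
  then show ?case
  proof (induction b rule: cvs.span_induct_alt)
    case base
    then show ?case by (simp add: cvs.span_zero)
  next
    case (step c x y)
    then obtain a b where ab: "x = a * b" "augmentation a = 0" "b \<in> aug_pow n" by auto
    have "x * r = a * (b * r)" using ab by (simp add: mult.assoc)
    then have "x * r \<in> aug_pow (Suc n)"
      using ab Suc.IH by (auto intro: cvs.span_base)
    then show ?case
      using step subspace_aug_pow
      by (simp only: distrib_right scaleC_mult_left) (blast intro: cvs.subspace_add cvs.subspace_scale)
  qed
qed

lemma aug_pow_left: "b \<in> aug_pow n \<Longrightarrow> r * b \<in> aug_pow n"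
proof (cases n)
  case 0
  then show ?thesis by simp
next
  case (Suc n')
  assume "b \<in> aug_pow n"
  then have "b \<in> cvs.span {a * b |a b. augmentation a = 0 \<and> b \<in> aug_pow n'}"
    by (simp add: Suc)
  then show ?thesis
  proof (induction b rule: cvs.span_induct_alt)
    case base
    then show ?case by (simp add: Suc cvs.span_zero)
  next
    case (step c x y)
    then obtain a b where ab: "x = a * b" "augmentation a = 0" "b \<in> aug_pow n'" by auto
    have "r * x = (r * a) * b" using ab by (simp add: mult.assoc)
    moreover have "augmentation (r * a) = 0" using ab by (simp add: augmentation_mult)
    ultimately have "r * x \<in> aug_pow n"
      using ab Suc by (auto intro!: cvs.span_base)
    then show ?case
      using step subspace_aug_pow
      by (simp only: distrib_left scaleC_mult_right) (blast intro: cvs.subspace_add cvs.subspace_scale)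
  qed
qed

lemma push_aug_pow:
  assumes f: "\<And>a b. f (a + b) = f a + f b" and "x \<in> aug_pow n"
  shows "push f x \<in> aug_pow n"
  using assms(2)
proof (induction n arbitrary: x)
  case 0
  then show ?case by simp
next
  case (Suc n)
  from Suc.prems have "x \<in> cvs.span {a * b |a b. augmentation a = 0 \<and> b \<in> aug_pow n}" by simp
  then show ?case
  proof (induction x rule: cvs.span_induct_alt)
    case base
    then show ?case by (simp add: push_def lin_ext_zero cvs.span_zero)
  next
    case (step c x y)
    then obtain a b where ab: "x = a * b" "augmentation a = 0" "b \<in> aug_pow n" by auto
    have "push f x = push f a * push f b" using ab by (simp add: push_mult[OF f])
    moreover have "augmentation (push f a) = 0" using ab by (simp add: augmentation_push)
    ultimately have "push f x \<in> aug_pow (Suc n)"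
      using ab Suc.IH by (auto intro!: cvs.span_base)
    moreover have "push f (c *\<^sub>C x + y) = c *\<^sub>C push f x + push f y"
      by (simp add: push_def lin_ext_add lin_ext_scaleC)
    ultimately show ?case
      using step subspace_aug_pow by (metis cvs.subspace_add cvs.subspace_scale)
  qed
qed

lemma augmentation_aug_pow_Suc: "x \<in> aug_pow (Suc n) \<Longrightarrow> augmentation x = 0"
proof -
  assume "x \<in> aug_pow (Suc n)"
  then have "x \<in> cvs.span {a * b |a b. augmentation a = 0 \<and> b \<in> aug_pow n}" by simp
  then show ?thesis
  proof (induction x rule: cvs.span_induct_alt)
    case base
    then show ?case by (simp add: augmentation_def lin_ext_zero)
  next
    case (step c x y)
    then obtain a b where "x = a * b" "augmentation a = 0" by auto
    then have "augmentation x = 0" by (simp add: augmentation_mult)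
    then show ?case
      using step by (simp add: augmentation_def lin_ext_add lin_ext_scaleC cvs.scale_zero_right)
  qed
qed

text \<open>
  The completion \<open>lim\<^sub>n \<complex>[\<pi>]/I\<^sup>n\<close>: a compatible family of cosets is given by representatives
  \<open>x n\<close>, each of which matters only modulo \<open>I\<^sup>n\<close>.
\<close>

definition compatible :: "(nat \<Rightarrow> 'p::group_add \<Rightarrow>\<^sub>0 complex) \<Rightarrow> bool"
  where "compatible x \<longleftrightarrow> (\<forall>n. x (Suc n) - x n \<in> aug_pow n)"

definition completion_eq ::
    "(nat \<Rightarrow> 'p::group_add \<Rightarrow>\<^sub>0 complex) \<Rightarrow> (nat \<Rightarrow> 'p \<Rightarrow>\<^sub>0 complex) \<Rightarrow> bool"
  where "completion_eq x y \<longleftrightarrow> compatible x \<and> compatible y \<and> (\<forall>n. x n - y n \<in> aug_pow n)"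

lemma aug_pow_simps:
  "0 \<in> aug_pow n" "a \<in> aug_pow n \<Longrightarrow> b \<in> aug_pow n \<Longrightarrow> a + b \<in> aug_pow n"
  "a \<in> aug_pow n \<Longrightarrow> b \<in> aug_pow n \<Longrightarrow> a - b \<in> aug_pow n"
  "a \<in> aug_pow n \<Longrightarrow> - a \<in> aug_pow n" "a \<in> aug_pow n \<Longrightarrow> c *\<^sub>C a \<in> aug_pow n"
  using subspace_aug_pow[of n]
  by (blast intro: cvs.subspace_0 cvs.subspace_add cvs.subspace_diff cvs.subspace_neg
      cvs.subspace_scale)+

lemma part_equivp_completion_eq:
  "part_equivp (completion_eq :: (nat \<Rightarrow> 'a::group_add \<Rightarrow>\<^sub>0 complex) \<Rightarrow> _)"
  (is "part_equivp ?R")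
proof (rule part_equivpI)
  show "\<exists>x. ?R x x"
    by (rule exI[of _ 0]) (simp add: completion_eq_def compatible_def aug_pow_simps)
  show "symp ?R"
    by (rule sympI) (use aug_pow_simps(4) in \<open>fastforce simp: completion_eq_def\<close>)
  show "transp ?R"
  proof (rule transpI)
    fix x y z :: "nat \<Rightarrow> 'a \<Rightarrow>\<^sub>0 complex"
    assume xy: "completion_eq x y" and yz: "completion_eq y z"
    have "x n - z n \<in> aug_pow n" for n
    proof -
      have "(x n - y n) + (y n - z n) \<in> aug_pow n"
        using xy yz unfolding completion_eq_def by (blast intro: aug_pow_simps(2))
      then show ?thesis by simp
    qed
    then show "completion_eq x z"
      using xy yz by (simp add: completion_eq_def)
  qed
qed

quotient_type (overloaded) 'p completed_group_algebra =
    "nat \<Rightarrow> 'p::group_add \<Rightarrow>\<^sub>0 complex" / partial: completion_eq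
  by (rule part_equivp_completion_eq)

lemma mult_diff_aug_pow:
  assumes "a - a' \<in> aug_pow n" "b - b' \<in> aug_pow n"
  shows "a * b - a' * b' \<in> aug_pow n"
proof -
  have "a * b - a' * b' = (a - a') * b + a' * (b - b')" by (simp add: algebra_simps)
  then show ?thesis using assms by (simp add: aug_pow_simps aug_pow_left aug_pow_right)
qed

lemma add_diff_aug_pow:
  assumes "a - a' \<in> aug_pow n" "b - b' \<in> aug_pow n"
  shows "(a + b) - (a' + b') \<in> aug_pow n"
  using aug_pow_simps(2)[OF assms] by (simp add: algebra_simps)

lemma diff_diff_aug_pow:
  assumes "a - a' \<in> aug_pow n" "b - b' \<in> aug_pow n"
  shows "(a - b) - (a' - b') \<in> aug_pow n"
  using aug_pow_simps(3)[OF assms] by (simp add: algebra_simps)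

lemma neg_diff_aug_pow:
  assumes "a - a' \<in> aug_pow n"
  shows "(- a) - (- a') \<in> aug_pow n"
  using aug_pow_simps(4)[OF assms] by (simp add: algebra_simps)

lemma scaleC_diff_aug_pow:
  assumes "a - a' \<in> aug_pow n"
  shows "c *\<^sub>C a - c *\<^sub>C a' \<in> aug_pow n"
  using aug_pow_simps(5)[OF assms] by (simp add: cvs.scale_right_diff_distrib)

lemma compatible_intros:
  "compatible (\<lambda>_. c)"
  "compatible x \<Longrightarrow> compatible y \<Longrightarrow> compatible (\<lambda>n. x n + y n)"
  "compatible x \<Longrightarrow> compatible y \<Longrightarrow> compatible (\<lambda>n. x n - y n)"
  "compatible x \<Longrightarrow> compatible (\<lambda>n. - x n)"
  "compatible x \<Longrightarrow> compatible y \<Longrightarrow> compatible (\<lambda>n. x n * y n)"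
  "compatible x \<Longrightarrow> compatible (\<lambda>n. a *\<^sub>C x n)"
  unfolding compatible_def
  by (simp add: aug_pow_simps)
    (blast intro: add_diff_aug_pow diff_diff_aug_pow neg_diff_aug_pow mult_diff_aug_pow
      scaleC_diff_aug_pow)+

lemma completion_eqI: "compatible x \<Longrightarrow> x = y \<Longrightarrow> completion_eq x y"
  by (simp add: completion_eq_def aug_pow_simps)

instantiation completed_group_algebra :: (group_add) ring_1
begin

lift_definition zero_completed_group_algebra :: "'a completed_group_algebra" is "\<lambda>_. 0"
  by (simp add: completion_eq_def compatible_def aug_pow_simps)

lift_definition one_completed_group_algebra :: "'a completed_group_algebra" is "\<lambda>_. 1"
  by (simp add: completion_eq_def compatible_def aug_pow_simps)

lift_definition plus_completed_group_algebra ::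
    "'a completed_group_algebra \<Rightarrow> 'a completed_group_algebra \<Rightarrow> 'a completed_group_algebra"
  is "\<lambda>x y n. x n + y n"
  by (simp add: completion_eq_def compatible_def add_diff_aug_pow)

lift_definition minus_completed_group_algebra ::
    "'a completed_group_algebra \<Rightarrow> 'a completed_group_algebra \<Rightarrow> 'a completed_group_algebra"
  is "\<lambda>x y n. x n - y n"
  by (simp add: completion_eq_def compatible_def diff_diff_aug_pow)

lift_definition uminus_completed_group_algebra ::
    "'a completed_group_algebra \<Rightarrow> 'a completed_group_algebra"
  is "\<lambda>x n. - x n"
  unfolding completion_eq_def compatible_def by (intro conjI allI neg_diff_aug_pow) auto

lift_definition times_completed_group_algebra ::
    "'a completed_group_algebra \<Rightarrow> 'a completed_group_algebra \<Rightarrow> 'a completed_group_algebra"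
  is "\<lambda>x y n. x n * y n"
  by (simp add: completion_eq_def compatible_def mult_diff_aug_pow)

instance
proof
  fix a b c :: "'a completed_group_algebra"
  show "(0 :: 'a completed_group_algebra) \<noteq> 1"
  proof (transfer, rule notI)
    assume "completion_eq (\<lambda>_. 0) (\<lambda>_. 1 :: 'a \<Rightarrow>\<^sub>0 complex)"
    then have "0 - (1 :: 'a \<Rightarrow>\<^sub>0 complex) \<in> aug_pow (Suc 0)"
      unfolding completion_eq_def by blast
    then have "augmentation (0 - (1 :: 'a \<Rightarrow>\<^sub>0 complex)) = 0"
      by (rule augmentation_aug_pow_Suc)
    then show False
      by (simp add: augmentation_def lin_ext_diff lin_ext_zero lin_ext_single scaleC_complex_def
          flip: single_one del: diff_0)
  qed
qed (transfer, rule completion_eqI,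
    (intro compatible_intros; simp add: completion_eq_def), simp add: algebra_simps)+

end

instantiation completed_group_algebra :: (group_add) complex_vector
begin

lift_definition scaleC_completed_group_algebra ::
    "complex \<Rightarrow> 'a completed_group_algebra \<Rightarrow> 'a completed_group_algebra"
  is "\<lambda>c x n. c *\<^sub>C x n"
  by (simp add: completion_eq_def compatible_def scaleC_diff_aug_pow)

instance
  by (standard; transfer, rule completion_eqI,
      (intro compatible_intros; simp add: completion_eq_def),
      simp add: scaleC_add_right scaleC_add_left scaleC_scaleC scaleC_one)

end

text \<open>
  The maps \<open>\<Delta>\<close>, \<open>x \<mapsto> x \<otimes> 1\<close> and \<open>x \<mapsto> 1 \<otimes> x\<close> into the completed tensor square.  Under the
  identification of \<open>\<complex>[\<pi>] \<otimes> \<complex>[\<pi>]\<close> with \<open>\<complex>[\<pi> \<times> \<pi>]\<close>, the tensor product filtration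
  \<open>\<Sum>\<^sub>i\<^sub>+\<^sub>j\<^sub>=\<^sub>n I\<^sup>i \<otimes> I\<^sup>j\<close> is given by the powers of the augmentation ideal of \<open>\<complex>[\<pi> \<times> \<pi>]\<close>, so the
  completed tensor square is the completed group algebra of \<open>\<pi> \<times> \<pi>\<close>; the three maps are induced
  by the group homomorphisms \<open>g \<mapsto> (g, g)\<close>, \<open>g \<mapsto> (g, 1)\<close> and \<open>g \<mapsto> (1, g)\<close>.
\<close>

lemma completion_eq_push:
  assumes f: "\<And>a b. f (a + b) = f a + f b" and "completion_eq x y"
  shows "completion_eq (\<lambda>n. push f (x n)) (\<lambda>n. push f (y n))"
  using assms(2) push_aug_pow[of f, OF f]
  by (simp add: completion_eq_def compatible_def push_def lin_ext_diff[symmetric])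

lift_definition coproduct ::
    "'p::group_add completed_group_algebra \<Rightarrow> ('p \<times> 'p) completed_group_algebra"
  is "\<lambda>x n. push (\<lambda>g. (g, g)) (x n)"
  by (rule completion_eq_push) simp_all

lift_definition tensor_one ::
    "'p::group_add completed_group_algebra \<Rightarrow> ('p \<times> 'p) completed_group_algebra"
  is "\<lambda>x n. push (\<lambda>g. (g, 0)) (x n)"
  by (rule completion_eq_push) simp_all

lift_definition one_tensor ::
    "'p::group_add completed_group_algebra \<Rightarrow> ('p \<times> 'p) completed_group_algebra"
  is "\<lambda>x n. push (\<lambda>g. (0, g)) (x n)"
  by (rule completion_eq_push) simp_all

definition malcev_lie :: "'p::group_add completed_group_algebra lie"
  where "malcev_lie = \<lparr>lie_carrier = {x. coproduct x = tensor_one x + one_tensor x},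
                       lie_bracket = (\<lambda>x y. x * y - y * x)\<rparr>"

end

theory Submission
  imports Defs "Jordan_Normal_Form.Determinant"
begin

text \<open>
  The Malcev Lie algebra of a finitely generated nilpotent group is a finite-dimensional nilpotent
  Lie algebra \<open>N\<close>, and for every such \<open>N\<close> the statement follows from two facts about its cohomology.

  Tensors in \<open>C(N) \<otimes> V\<close> are the same as alternating forms on \<open>N\<close> with values in \<open>V\<close>.  Evaluated on two
  vectors, the equation of a flat connection says that it is a homomorphism from \<open>N\<close> to \<open>sl2\<close>.  Its
  image is a nilpotent subalgebra, and in \<open>sl2\<close> these have dimension at most one
  (\<open>nilpotent_commute\<close>, \<open>commuting_proportional\<close>).  So every flat connection is a single tensor \<open>\<eta> \<otimes> g\<close>
  with \<open>d\<eta> = 0\<close> (\<open>flat_pure\<close>), and \<open>d\<^sub>\<omega>\<close> is the Chevalley--Eilenberg differential of the module on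
  which \<open>x\<close> acts as \<open>\<eta>(x) T\<close>, where \<open>T = \<theta>(g)\<close> (\<open>twisted_diff_pure\<close>).

  If \<open>T\<close> is invertible and \<open>\<eta>(x) = 1\<close>, contraction with \<open>x\<close> is a homotopy between \<open>0\<close> and the operator
  \<open>T - L\<close>, where \<open>L\<close> is nilpotent and commutes with \<open>T\<close>.  This operator is invertible, so the
  cohomology vanishes (\<open>cocycle_exact\<close>).

  If \<open>T\<close> is singular or \<open>\<eta> = 0\<close>, the cohomology is non-zero in every degree up to \<open>dim N\<close>
  (\<open>coh_nonzero\<close>).  Choose a hyperplane \<open>H\<close> that contains \<open>[N, N]\<close> and a vector \<open>x\<close> outside it.  A form
  on \<open>N\<close> is a pair of forms on \<open>H\<close>, and the kernel and the cokernel of \<open>T - L\<close> on the cohomology of \<open>H\<close>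
  both contribute to the cohomology of \<open>N\<close>.  They are non-zero because \<open>L\<close> is nilpotent and \<open>T\<close> is
  singular.  Induction on the dimension does the rest; restriction to hyperplanes also
  shows that there are no forms above degree \<open>dim N\<close> (\<open>alt_above_dim\<close>).

  For the Malcev Lie algebra the hard point is that it is finite-dimensional.  It is filtered by the
  powers of the augmentation ideal \<open>I\<close>.  Convolution of the antipode with a degree operator, Dynkin's
  idempotent up to a factor, shows that a primitive element in \<open>I\<^sup>n\<close> is modulo \<open>I\<^sup>n\<^sup>+\<^sup>1\<close> a combination of
  \<open>n\<close>-fold brackets of elements \<open>g - 1\<close>, and such a bracket is up to sign the iterated group commutator
  minus \<open>1\<close>.  Beyond the nilpotency class of the group it vanishes (\<open>primitive_in_next_power\<close>).  So the
  filtration ends, primitive elements embed in some \<open>\<complex>[\<pi>]/I\<^sup>n\<close>, and that is finite-dimensional for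
  finitely generated \<open>\<pi>\<close>.  As brackets raise the filtration degree, nilpotency comes with it.
\<close>

section \<open>Linear algebra and tensor products\<close>

interpretation cvp: vector_space_pair
  "scaleC :: complex \<Rightarrow> 'a \<Rightarrow> 'a::complex_vector" "scaleC :: complex \<Rightarrow> 'b \<Rightarrow> 'b::complex_vector"
  by unfold_locales

lemma clinear_iff:
  "clinear f \<longleftrightarrow> (\<forall>x y. f (x + y) = f x + f y) \<and> (\<forall>c x. f (c *\<^sub>C x) = c *\<^sub>C f x)"
  unfolding Vector_Spaces.linear_iff by (auto intro: cvs.vector_space_axioms)

lemma clinear_0: "clinear f \<Longrightarrow> f 0 = 0"
  by (metis add_cancel_right_right clinear_iff)

lemma clinear_diff: "clinear f \<Longrightarrow> f (x - y) = f x - f y"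
  using clinear_iff[of f] by (metis diff_add_cancel eq_diff_eq)

lemma clinear_sum: "clinear f \<Longrightarrow> f (sum g A) = (\<Sum>a\<in>A. f (g a))"
  by (induction A rule: infinite_finite_induct) (simp_all add: clinear_iff clinear_0)

lemma clinear_sum_list: "clinear f \<Longrightarrow> f (\<Sum>a\<leftarrow>xs. g a) = (\<Sum>a\<leftarrow>xs. f (g a))"
  by (induction xs) (simp_all add: clinear_iff clinear_0)

lemma clinear_compose: "clinear f \<Longrightarrow> clinear g \<Longrightarrow> clinear (\<lambda>x. g (f x))"
  by (simp add: clinear_iff)

lemma subspace_preimage: "clinear f \<Longrightarrow> cvs.subspace S \<Longrightarrow> cvs.subspace {x. f x \<in> S}"
  unfolding cvs.subspace_def by (auto simp: clinear_0 clinear_iff)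

lemma clinear_eq_on_span:
  assumes "clinear f" "clinear g" "\<And>b. b \<in> B \<Longrightarrow> f b = g b" "x \<in> cvs.span B"
  shows "f x = g x"
  using cvp.linear_eq_on[of f g x B] assms by blast

lemma projection_exists:
  assumes "cvs.subspace S"
  obtains p :: "'a::complex_vector \<Rightarrow> 'a"
  where "clinear p" "\<And>x. p x \<in> S" "\<And>x. x \<in> S \<Longrightarrow> p x = x"
proof -
  have "clinear (\<lambda>x::'a. x)" by (simp add: clinear_iff)
  from cvp.linear_exists_left_inverse_on[OF this assms] obtain g where
    "range g \<subseteq> S" "clinear g" "\<forall>v\<in>S. g v = v" by (auto simp: inj_on_def)
  then show ?thesis using that by blast
qed

lemma separating_functional:
  assumes "cvs.subspace S" "x \<notin> S"
  obtains f :: "'a::complex_vector \<Rightarrow> complex"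
  where "clinear f" "\<And>y. y \<in> S \<Longrightarrow> f y = 0" "f x = 1"
proof -
  obtain p where p: "clinear p" "\<And>x. p x \<in> S" "\<And>x. x \<in> S \<Longrightarrow> p x = x"
    using projection_exists[OF assms(1)] by blast
  have "x - p x \<noteq> 0" using p(2)[of x] assms(2) by auto
  then have "cvs.independent {x - p x}" by simp
  then obtain g where g: "clinear g" "g (x - p x) = (1::complex)"
    using cvp.linear_independent_extend[of "{x - p x}" "\<lambda>_. 1"] by blast
  show ?thesis
  proof (rule that[of "\<lambda>y. g (y - p y)"])
    show "clinear (\<lambda>y. g (y - p y))"
      using g(1) p(1) by (simp add: clinear_iff add_diff_add flip: cvs.scale_right_diff_distrib)
    show "g (y - p y) = 0" if "y \<in> S" for y using p(3)[OF that] clinear_0[OF g(1)] by simp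
    show "g (x - p x) = 1" by (rule g)
  qed
qed

lemma subspace_range: "clinear f \<Longrightarrow> cvs.subspace (range f)"
proof -
  assume f: "clinear f"
  have "f x + f y \<in> range f" "c *\<^sub>C f x \<in> range f" for x y c
    using f by (metis clinear_iff rangeI)+
  moreover have "0 \<in> range f" using clinear_0[OF f] by (metis rangeI)
  ultimately show ?thesis by (auto simp: cvs.subspace_def)
qed

lemma finite_basis:
  assumes "finite_dim (UNIV :: 'a::complex_vector set)"
  obtains B :: "'a::complex_vector set" where "finite B" "cvs.independent B" "cvs.span B = UNIV"
proof -
  obtain B0 :: "'a set" where B0: "finite B0" "cvs.span B0 = UNIV"
    using assms by (auto simp: finite_dim_def)
  obtain B where "B \<subseteq> B0" "cvs.independent B" "B0 \<subseteq> cvs.span B"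
    using cvs.maximal_independent_subset[of B0] by metis
  then show ?thesis
    using that[of B] B0 by (metis cvs.span_mono cvs.span_span finite_subset top.extremum_uniqueI)
qed

lemma coordinates:
  assumes "finite_dim (UNIV :: 'a::complex_vector set)"
  obtains B :: "'a::complex_vector set" and c :: "'a \<Rightarrow> 'a \<Rightarrow> complex"
  where "finite B" "\<And>b. clinear (c b)" "\<And>x. x = (\<Sum>b\<in>B. c b x *\<^sub>C b)"
proof -
  obtain B :: "'a set" where B: "finite B" "cvs.independent B" "cvs.span B = UNIV"
    using finite_basis[OF assms] .
  show ?thesis
  proof (rule that[of B "\<lambda>b x. cvs.representation B x b"])
    show "clinear (\<lambda>x. cvs.representation B x b)" for b
      using B by (simp add: clinear_iff cvs.representation_add cvs.representation_scale
          scaleC_complex_def)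
    show "x = (\<Sum>b\<in>B. cvs.representation B x b *\<^sub>C b)" for x
      using B cvs.sum_representation_eq[of B x B] by simp
  qed (rule B)
qed

lemma inj_imp_surj:
  assumes "finite_dim (UNIV :: 'a::complex_vector set)" "clinear (f :: 'a \<Rightarrow> 'a)"
  shows "inj f \<Longrightarrow> surj f" "surj f \<Longrightarrow> inj f"
proof -
  obtain B :: "'a set" where B: "finite B" "cvs.independent B" "cvs.span B = UNIV"
    using finite_basis[OF assms(1)] .
  interpret F: finite_dimensional_vector_space "scaleC :: complex \<Rightarrow> 'a \<Rightarrow> 'a" B
    by unfold_locales (use B in auto)
  show "inj f \<Longrightarrow> surj f" "surj f \<Longrightarrow> inj f"
    using F.linear_inj_imp_surj[OF assms(2)] F.linear_surj_imp_inj[OF assms(2)] by auto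
qed

text \<open>
  A left inverse of \<open>Q\<close> on \<open>P\<close> carries a finite spanning set back.
\<close>

lemma finite_dim_inj:
  assumes "clinear Q" "cvs.subspace P" "\<And>X. X \<in> P \<Longrightarrow> Q X = 0 \<Longrightarrow> X = 0" "finite C" "\<And>X. Q X \<in> cvs.span C"
  shows "finite_dim P"
proof -
  have "inj_on Q P"
  proof (rule inj_onI)
    fix X Y assume XY: "X \<in> P" "Y \<in> P" "Q X = Q Y"
    then have "Q (X - Y) = 0" by (simp add: clinear_diff[OF assms(1)])
    then show "X = Y" using assms(3)[of "X - Y"] XY cvs.subspace_diff[OF assms(2)] by auto
  qed
  then obtain g where g: "clinear g" "\<And>X. X \<in> P \<Longrightarrow> g (Q X) = X"
    using cvp.linear_exists_left_inverse_on[OF assms(1,2)] by blast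
  have "X \<in> cvs.span (g ` C)" if "X \<in> P" for X
  proof -
    have "g (Q X) \<in> g ` cvs.span C" using assms(5) by blast
    also have "g ` cvs.span C = cvs.span (g ` C)"
      using cvp.linear_span_image[OF g(1), of C] by simp
    finally show ?thesis using g(2)[OF that] by simp
  qed
  then show ?thesis unfolding finite_dim_def using assms(4) by blast
qed

definition bilinear_on :: "'a::complex_vector set \<Rightarrow> 'b::complex_vector set
    \<Rightarrow> ('a \<Rightarrow> 'b \<Rightarrow> 'c::complex_vector) \<Rightarrow> bool"
  where "bilinear_on U W f \<longleftrightarrow>
    (\<forall>a\<in>U. \<forall>a'\<in>U. \<forall>b\<in>W. f (a + a') b = f a b + f a' b) \<and>
    (\<forall>a\<in>U. \<forall>b\<in>W. \<forall>b'\<in>W. f a (b + b') = f a b + f a b') \<and>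
    (\<forall>c. \<forall>a\<in>U. \<forall>b\<in>W. f (c *\<^sub>C a) b = c *\<^sub>C f a b \<and> f a (c *\<^sub>C b) = c *\<^sub>C f a b)"

lemma pure_tensor_add: "(a + a') \<otimes>\<^sub>C b = a \<otimes>\<^sub>C b + a' \<otimes>\<^sub>C b" "a \<otimes>\<^sub>C (b + b') = a \<otimes>\<^sub>C b + a \<otimes>\<^sub>C b'"
proof -
  have "Poly_Mapping.single (a + a', b) (1::complex)
      - (Poly_Mapping.single (a, b) 1 + Poly_Mapping.single (a', b) 1) \<in> tensor_relators"
    "Poly_Mapping.single (a, b + b') (1::complex)
      - (Poly_Mapping.single (a, b) 1 + Poly_Mapping.single (a, b') 1) \<in> tensor_relators"
    unfolding tensor_relators_def diff_diff_add[symmetric] by blast+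
  then show "(a + a') \<otimes>\<^sub>C b = a \<otimes>\<^sub>C b + a' \<otimes>\<^sub>C b" "a \<otimes>\<^sub>C (b + b') = a \<otimes>\<^sub>C b + a \<otimes>\<^sub>C b'"
    unfolding pure_tensor.abs_eq plus_tensor.abs_eq tensor.abs_eq_iff tensor_eq_def
    by (simp_all only: cvs.span_base)
qed

lemma pure_tensor_scale: "(c *\<^sub>C a) \<otimes>\<^sub>C b = c *\<^sub>C (a \<otimes>\<^sub>C b)" "a \<otimes>\<^sub>C (c *\<^sub>C b) = c *\<^sub>C (a \<otimes>\<^sub>C b)"
proof -
  have "Poly_Mapping.single (c *\<^sub>C a, b) 1 - c *\<^sub>C Poly_Mapping.single (a, b) 1 \<in> tensor_relators"
    "Poly_Mapping.single (a, c *\<^sub>C b) 1 - c *\<^sub>C Poly_Mapping.single (a, b) 1 \<in> tensor_relators"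
    unfolding tensor_relators_def by blast+
  then show "(c *\<^sub>C a) \<otimes>\<^sub>C b = c *\<^sub>C (a \<otimes>\<^sub>C b)" "a \<otimes>\<^sub>C (c *\<^sub>C b) = c *\<^sub>C (a \<otimes>\<^sub>C b)"
    unfolding pure_tensor.abs_eq scaleC_tensor.abs_eq tensor.abs_eq_iff tensor_eq_def
    by (simp_all only: cvs.span_base)
qed

lemma pure_tensor_0 [simp]: "0 \<otimes>\<^sub>C b = 0" "a \<otimes>\<^sub>C 0 = 0"
  using pure_tensor_scale(1)[of 0 0 b] pure_tensor_scale(2)[of a 0 0] by simp_all

text \<open>
  A bilinear map kills the relators, so its extension to the free space descends to the quotient.
\<close>

lemma tensor_lift:
  assumes f: "bilinear_on UNIV UNIV f"
  obtains g where "clinear g" "\<And>a b. g (a \<otimes>\<^sub>C b) = f a b"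
proof -
  let ?F = "lin_ext (\<lambda>(a, b). f a b)"
  have lin: "clinear ?F" by (simp add: clinear_iff lin_ext_add lin_ext_scaleC)
  have rel: "?F x = 0" if "x \<in> cvs.span tensor_relators" for x
  proof (rule clinear_eq_on_span[OF lin _ _ that])
    show "clinear (\<lambda>_. 0)" by (simp add: clinear_iff cvs.scale_zero_right)
    show "?F b = 0" if "b \<in> tensor_relators" for b
      using that f unfolding tensor_relators_def bilinear_on_def
      by (auto simp: lin_ext_diff lin_ext_single lin_ext_scaleC scaleC_one)
  qed
  have cong: "?F x = ?F y" if "tensor_eq x y" for x y
    using rel[of "x - y"] that by (simp add: tensor_eq_def lin_ext_diff)
  define g where "g t = ?F (rep_tensor t)" for t
  have g_abs: "g (abs_tensor x) = ?F x" for x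
    unfolding g_def
    by (rule cong) (rule Quotient_rep_abs[OF Quotient_tensor], rule tensor_eqI, rule refl)
  show ?thesis
  proof (rule that[of g])
    show "g (a \<otimes>\<^sub>C b) = f a b" for a b
      by (simp add: pure_tensor.abs_eq g_abs lin_ext_single scaleC_one)
    have "g (abs_tensor x + abs_tensor y) = g (abs_tensor x) + g (abs_tensor y)" for x y
      by (simp add: plus_tensor.abs_eq g_abs lin_ext_add)
    moreover have "g (c *\<^sub>C abs_tensor x) = c *\<^sub>C g (abs_tensor x)" for c x
      by (simp add: scaleC_tensor.abs_eq g_abs lin_ext_scaleC)
    ultimately have "g (s + t) = g s + g t" "g (c *\<^sub>C t) = c *\<^sub>C g t" for s t c
      by (induction s rule: tensor.abs_induct; induction t rule: tensor.abs_induct; blast)+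
    then show "clinear g" by (simp add: clinear_iff)
  qed
qed

lemma tensor_sub_list:
  assumes "cvs.subspace U" "t \<in> tensor_sub U W"
  obtains ps where "set ps \<subseteq> U \<times> W" "t = (\<Sum>(u, w)\<leftarrow>ps. u \<otimes>\<^sub>C w)"
proof -
  have "\<exists>ps. set ps \<subseteq> U \<times> W \<and> t = (\<Sum>(u, w)\<leftarrow>ps. u \<otimes>\<^sub>C w)"
    using assms(2) unfolding tensor_sub_def
  proof (induction t rule: cvs.span_induct_alt)
    case base
    show ?case by (rule exI[of _ "[]"]) simp
  next
    case (step c x y)
    then obtain u w ps where *: "x = u \<otimes>\<^sub>C w" "u \<in> U" "w \<in> W" "set ps \<subseteq> U \<times> W"
      "y = (\<Sum>(u, w)\<leftarrow>ps. u \<otimes>\<^sub>C w)" by auto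
    show ?case
      by (rule exI[of _ "(c *\<^sub>C u, w) # ps"])
        (use * assms(1) in \<open>auto simp: pure_tensor_scale cvs.subspace_scale\<close>)
  qed
  then show ?thesis using that by blast
qed

lemma tensor_subI: "u \<in> U \<Longrightarrow> w \<in> W \<Longrightarrow> u \<otimes>\<^sub>C w \<in> tensor_sub U W"
  unfolding tensor_sub_def by (blast intro: cvs.span_base)

lemma subspace_tensor_sub: "cvs.subspace (tensor_sub U W)"
  by (simp add: tensor_sub_def)

lemma tensor_sub_mono: "U \<subseteq> U' \<Longrightarrow> W \<subseteq> W' \<Longrightarrow> tensor_sub U W \<subseteq> tensor_sub U' W'"
  unfolding tensor_sub_def by (rule cvs.span_mono) blast

text \<open>
  Projecting onto \<open>U\<close> and \<open>W\<close> turns a map that is bilinear only on \<open>U \<times> W\<close> into one that is bilinear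
  everywhere; this is why the extension to \<open>U \<otimes> W\<close> does not depend on the way a tensor is written.
\<close>

lemma tensor_extend_linear:
  assumes U: "cvs.subspace U" and W: "cvs.subspace W" and f: "bilinear_on U W f"
  obtains g where "clinear g" "\<And>t. t \<in> tensor_sub U W \<Longrightarrow> tensor_extend U W f t = g t"
    "\<And>u w. u \<in> U \<Longrightarrow> w \<in> W \<Longrightarrow> g (u \<otimes>\<^sub>C w) = f u w"
proof -
  obtain p where p: "clinear p" "\<And>x. p x \<in> U" "\<And>x. x \<in> U \<Longrightarrow> p x = x"
    using projection_exists[OF U] by blast
  obtain q where q: "clinear q" "\<And>x. q x \<in> W" "\<And>x. x \<in> W \<Longrightarrow> q x = x"
    using projection_exists[OF W] by blast
  have "bilinear_on UNIV UNIV (\<lambda>a b. f (p a) (q b))"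
    using f p(1,2) q(1,2) by (simp add: bilinear_on_def clinear_iff)
  then obtain g where g: "clinear g" "\<And>a b. g (a \<otimes>\<^sub>C b) = f (p a) (q b)"
    using tensor_lift by blast
  have gl: "g (\<Sum>(u, w)\<leftarrow>ps. u \<otimes>\<^sub>C w) = (\<Sum>(u, w)\<leftarrow>ps. f u w)" if "set ps \<subseteq> U \<times> W" for ps
    using that by (induction ps) (auto simp: clinear_0[OF g(1)] g p q g(1)[unfolded clinear_iff])
  show ?thesis
  proof (rule that[OF g(1)])
    show "g (u \<otimes>\<^sub>C w) = f u w" if "u \<in> U" "w \<in> W" for u w using g(2) p(3) q(3) that by simp
    fix t assume "t \<in> tensor_sub U W"
    then obtain ps where ps: "set ps \<subseteq> U \<times> W" "t = (\<Sum>(u, w)\<leftarrow>ps. u \<otimes>\<^sub>C w)"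
      using tensor_sub_list[OF U] by blast
    show "tensor_extend U W f t = g t"
      unfolding tensor_extend_def
    proof (rule the_equality)
      show "\<exists>ps. set ps \<subseteq> U \<times> W \<and> t = (\<Sum>(u, w)\<leftarrow>ps. u \<otimes>\<^sub>C w) \<and> g t = (\<Sum>(u, w)\<leftarrow>ps. f u w)"
        using ps gl by blast
      show "z = g t" if "\<exists>ps. set ps \<subseteq> U \<times> W \<and> t = (\<Sum>(u, w)\<leftarrow>ps. u \<otimes>\<^sub>C w)
          \<and> z = (\<Sum>(u, w)\<leftarrow>ps. f u w)" for z
      proof -
        from that obtain qs where qs: "set qs \<subseteq> U \<times> W" "t = (\<Sum>(u, w)\<leftarrow>qs. u \<otimes>\<^sub>C w)"
          "z = (\<Sum>(u, w)\<leftarrow>qs. f u w)" by blast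
        show ?thesis using gl[OF qs(1)] by (simp only: qs(2,3))
      qed
    qed
  qed
qed

lemma tensor_extend_ex:
  assumes "cvs.subspace U" "cvs.subspace W" "bilinear_on U W f"
  shows "\<exists>e. clinear e \<and> (\<forall>t\<in>tensor_sub U W. tensor_extend U W f t = e t) \<and>
    (\<forall>u\<in>U. \<forall>w\<in>W. e (u \<otimes>\<^sub>C w) = f u w)"
  by (rule tensor_extend_linear[OF assms]) blast

lemma bilinear_pure:
  assumes "\<And>u u'. u \<in> U \<Longrightarrow> u' \<in> U \<Longrightarrow> P (u + u') = P u + P u'" "\<And>c u. u \<in> U \<Longrightarrow> P (c *\<^sub>C u) = c *\<^sub>C P u"
    "\<And>w w'. w \<in> W \<Longrightarrow> w' \<in> W \<Longrightarrow> Q (w + w') = Q w + Q w'" "\<And>c w. w \<in> W \<Longrightarrow> Q (c *\<^sub>C w) = c *\<^sub>C Q w"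
  shows "bilinear_on U W (\<lambda>u w. P u \<otimes>\<^sub>C Q w)"
  using assms by (simp add: bilinear_on_def pure_tensor_add pure_tensor_scale)

lemma tensor_extend_pure:
  assumes "cvs.subspace U" "cvs.subspace W" "bilinear_on U W f" "u \<in> U" "w \<in> W"
  shows "tensor_extend U W f (u \<otimes>\<^sub>C w) = f u w"
  by (rule tensor_extend_linear[OF assms(1-3)]) (use assms(4,5) in \<open>simp add: tensor_subI\<close>)

lemma tensor_extend_sum:
  assumes "cvs.subspace U" "cvs.subspace W" "bilinear_on U W f" "set ps \<subseteq> U \<times> W"
  shows "tensor_extend U W f (\<Sum>(u, w)\<leftarrow>ps. u \<otimes>\<^sub>C w) = (\<Sum>(u, w)\<leftarrow>ps. f u w)"
proof (rule tensor_extend_linear[OF assms(1-3)])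
  fix g assume g: "clinear g" "\<And>t. t \<in> tensor_sub U W \<Longrightarrow> tensor_extend U W f t = g t"
    "\<And>u w. u \<in> U \<Longrightarrow> w \<in> W \<Longrightarrow> g (u \<otimes>\<^sub>C w) = f u w"
  have "(\<Sum>(u, w)\<leftarrow>ps. u \<otimes>\<^sub>C w) \<in> tensor_sub U W
      \<and> g (\<Sum>(u, w)\<leftarrow>ps. u \<otimes>\<^sub>C w) = (\<Sum>(u, w)\<leftarrow>ps. f u w)"
    using assms(4)
  proof (induction ps)
    case Nil
    then show ?case by (simp add: clinear_0[OF g(1)] cvs.subspace_0[OF subspace_tensor_sub])
  next
    case (Cons p ps)
    obtain u w where p: "p = (u, w)" "u \<in> U" "w \<in> W" using Cons.prems by (cases p) auto
    let ?t = "\<Sum>(u, w)\<leftarrow>ps. u \<otimes>\<^sub>C w"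
    have IH: "?t \<in> tensor_sub U W" "g ?t = (\<Sum>(u, w)\<leftarrow>ps. f u w)" using Cons by auto
    have "g (u \<otimes>\<^sub>C w + ?t) = f u w + (\<Sum>(u, w)\<leftarrow>ps. f u w)"
      using g(1,3) p IH(2) by (metis clinear_iff)
    then show ?case
      using cvs.subspace_add[OF subspace_tensor_sub tensor_subI[OF p(2,3)] IH(1)] p(1) by simp
  qed
  then show ?thesis using g(2) by simp
qed

text \<open>
  Tensors with a space of functions in the first factor, read as vector-valued functions.  The
  definition names the map that the universal property provides.
\<close>

definition tensor_fun :: "('k \<Rightarrow> complex, 'v::complex_vector) tensor \<Rightarrow> 'k \<Rightarrow> 'v"
  where "tensor_fun = (SOME g. clinear g \<and> (\<forall>\<alpha> v. g (\<alpha> \<otimes>\<^sub>C v) = (\<lambda>x. \<alpha> x *\<^sub>C v)))"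

lemma tensor_fun:
  "clinear (tensor_fun :: ('k \<Rightarrow> complex, 'v::complex_vector) tensor \<Rightarrow> 'k \<Rightarrow> 'v)"
  "tensor_fun ((\<alpha> :: 'k \<Rightarrow> complex) \<otimes>\<^sub>C (v :: 'v)) = (\<lambda>x. \<alpha> x *\<^sub>C v)"
proof -
  have "bilinear_on UNIV UNIV (\<lambda>(\<alpha> :: 'k \<Rightarrow> complex) (v :: 'v) x. \<alpha> x *\<^sub>C v)"
    by (auto simp: bilinear_on_def fun_eq_iff scaleC_fun_def scaleC_complex_def scaleC_add_left
        scaleC_add_right scaleC_scaleC mult.commute)
  then have "\<exists>g. clinear g \<and> (\<forall>(\<alpha> :: 'k \<Rightarrow> complex) (v :: 'v). g (\<alpha> \<otimes>\<^sub>C v) = (\<lambda>x. \<alpha> x *\<^sub>C v))"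
    using tensor_lift by metis
  from someI_ex[OF this]
  show "clinear (tensor_fun :: ('k \<Rightarrow> complex, 'v) tensor \<Rightarrow> 'k \<Rightarrow> 'v)"
    "tensor_fun (\<alpha> \<otimes>\<^sub>C v) = (\<lambda>x. \<alpha> x *\<^sub>C v)" for \<alpha> :: "'k \<Rightarrow> complex" and v :: 'v
    unfolding tensor_fun_def[symmetric] by auto
qed

lemma tensor_fun_add: "tensor_fun (s + t) x = tensor_fun s x + tensor_fun t x"
  and tensor_fun_scale: "tensor_fun (c *\<^sub>C t) x = c *\<^sub>C tensor_fun t x"
  by (simp_all add: tensor_fun(1)[unfolded clinear_iff] scaleC_fun_def)

lemma tensor_sub_UNIV: "tensor_sub UNIV UNIV = UNIV"
proof -
  have "abs_tensor x \<in> tensor_sub UNIV UNIV" for x :: "('a::complex_vector \<times> 'b::complex_vector) \<Rightarrow>\<^sub>0 complex"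
  proof (induction x rule: group_algebra_induct)
    case zero
    then show ?case
      using cvs.subspace_0[OF subspace_tensor_sub] by (simp add: zero_tensor_def)
  next
    case (add x k c)
    have "Poly_Mapping.single k c = c *\<^sub>C Poly_Mapping.single k 1"
      by (rule poly_mapping_eqI) (simp add: lookup_single when_def scaleC_complex_def)
    then have "abs_tensor (x + Poly_Mapping.single k c) = abs_tensor x + c *\<^sub>C (fst k \<otimes>\<^sub>C snd k)"
      by (simp add: plus_tensor.abs_eq scaleC_tensor.abs_eq pure_tensor.abs_eq)
    then show ?case
      using add by (simp add: tensor_subI cvs.subspace_scale[OF subspace_tensor_sub]
          cvs.subspace_add[OF subspace_tensor_sub])
  qed
  then have "t \<in> tensor_sub UNIV UNIV" for t :: "('a, 'b) tensor"
    by (rule tensor.abs_induct)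
  then show ?thesis by blast
qed

lemma tensor_linear_eqI:
  assumes "clinear f" "clinear g" "\<And>a b. f (a \<otimes>\<^sub>C b) = g (a \<otimes>\<^sub>C b)"
  shows "f t = g t"
proof (rule clinear_eq_on_span[OF assms(1,2)])
  show "t \<in> cvs.span {u \<otimes>\<^sub>C w |u w. u \<in> UNIV \<and> w \<in> UNIV}"
    using tensor_sub_UNIV unfolding tensor_sub_def by blast
qed (use assms(3) in auto)

text \<open>
  Dual coordinates recover a tensor from its function \<open>f\<close>, as \<open>\<Sum>\<^sub>b (c\<^sub>b \<circ> f) \<otimes> b\<close>.
\<close>

lemma inj_tensor_fun:
  assumes "finite_dim (UNIV :: 'v::complex_vector set)"
    and "tensor_fun t = tensor_fun (t' :: ('k \<Rightarrow> complex, 'v) tensor)"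
  shows "t = t'"
proof -
  obtain B :: "'v set" and c where c: "finite B" "\<And>b. clinear (c b)" "\<And>x. x = (\<Sum>b\<in>B. c b x *\<^sub>C b)"
    using coordinates[OF assms(1)] by blast
  have "t = (\<Sum>b\<in>B. (\<lambda>x. c b (tensor_fun t x)) \<otimes>\<^sub>C b)" for t :: "('k \<Rightarrow> complex, 'v) tensor"
  proof (rule tensor_linear_eqI[of "\<lambda>t. t"])
    have "(\<lambda>x. c b (tensor_fun (s + t) x)) = (\<lambda>x. c b (tensor_fun s x)) + (\<lambda>x. c b (tensor_fun t x))"
      "(\<lambda>x. c b (tensor_fun (d *\<^sub>C t) x)) = d *\<^sub>C (\<lambda>x. c b (tensor_fun t x))"
      for s t :: "('k \<Rightarrow> complex, 'v) tensor" and d b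
      using c(2)[of b, unfolded clinear_iff]
      by (simp_all add: fun_eq_iff scaleC_fun_def tensor_fun_add tensor_fun_scale)
    then show "clinear (\<lambda>t :: ('k \<Rightarrow> complex, 'v) tensor. \<Sum>b\<in>B. (\<lambda>x. c b (tensor_fun t x)) \<otimes>\<^sub>C b)"
      by (simp add: clinear_iff pure_tensor_add pure_tensor_scale sum.distrib cvs.scale_sum_right)
    fix \<alpha> :: "'k \<Rightarrow> complex" and v :: 'v
    have "(\<lambda>x. c b (\<alpha> x *\<^sub>C v)) = c b v *\<^sub>C \<alpha>" for b
      using c(2) by (simp add: clinear_iff fun_eq_iff scaleC_fun_def scaleC_complex_def)
    then have "(\<Sum>b\<in>B. (\<lambda>x. c b (\<alpha> x *\<^sub>C v)) \<otimes>\<^sub>C b) = \<alpha> \<otimes>\<^sub>C (\<Sum>b\<in>B. c b v *\<^sub>C b)"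
      using clinear_sum[of "(\<otimes>\<^sub>C) \<alpha>" "\<lambda>b. c b v *\<^sub>C b" B]
      by (simp add: clinear_iff pure_tensor_add pure_tensor_scale)
    then show "\<alpha> \<otimes>\<^sub>C v = (\<Sum>b\<in>B. (\<lambda>x. c b (tensor_fun (\<alpha> \<otimes>\<^sub>C v) x)) \<otimes>\<^sub>C b)"
      using c(3)[of v] by (simp add: tensor_fun(2))
  qed (simp add: clinear_iff)
  then show ?thesis using assms(2) by metis
qed

text \<open>
  As \<open>B\<close> is closed under scaling, a single element outside \<open>B\<close> is independent modulo \<open>B\<close>.
\<close>

lemma quot_dim_ge_1:
  assumes "\<And>c x. x \<in> B \<Longrightarrow> c *\<^sub>C x \<in> B"
  shows "quot_dim Z B \<ge> enat 1 \<longleftrightarrow> (\<exists>z\<in>Z. z \<notin> B)"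
proof
  assume z: "\<exists>z\<in>Z. z \<notin> B"
  then obtain z where z: "z \<in> Z" "z \<notin> B" by blast
  have "c z = 0" if "c z *\<^sub>C z \<in> B" for c :: "'a \<Rightarrow> complex"
  proof (rule ccontr)
    assume "c z \<noteq> 0"
    moreover have "inverse (c z) *\<^sub>C c z *\<^sub>C z \<in> B" using assms that by blast
    ultimately show False using z by (simp add: scaleC_scaleC scaleC_one)
  qed
  then have "enat (card {z}) \<le> quot_dim Z B"
    unfolding quot_dim_def using z by (intro SUP_upper) simp
  then show "quot_dim Z B \<ge> enat 1" by simp
next
  assume "quot_dim Z B \<ge> enat 1"
  show "\<exists>z\<in>Z. z \<notin> B"
  proof (rule ccontr)
    assume no: "\<not> (\<exists>z\<in>Z. z \<notin> B)"
    have "S = {}" if S: "S \<subseteq> Z" "finite S"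
      "\<forall>c. (\<Sum>s\<in>S. c s *\<^sub>C s) \<in> B \<longrightarrow> (\<forall>s\<in>S. c s = 0)" for S
    proof (rule ccontr)
      assume "S \<noteq> {}"
      then obtain s where s: "s \<in> S" by blast
      have "(\<Sum>t\<in>S. (if t = s then 1 else 0) *\<^sub>C t) = (\<Sum>t\<in>S. if t = s then t else 0)"
        by (rule sum.cong) (simp_all add: scaleC_one cvs.scale_zero_left)
      also have "\<dots> = s" using S(2) s by simp
      finally have "(\<Sum>t\<in>S. (if t = s then 1 else 0) *\<^sub>C t) \<in> B" using no s S(1) by auto
      then show False using S(3)[rule_format, of "\<lambda>t. if t = s then 1 else 0" s] s by simp
    qed
    then have "quot_dim Z B \<le> 0"
      unfolding quot_dim_def by (intro SUP_least) (auto simp: zero_enat_def)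
    with \<open>quot_dim Z B \<ge> enat 1\<close> have "enat 1 \<le> 0" by (rule order_trans)
    then show False by (simp add: zero_enat_def)
  qed
qed

section \<open>Vector-valued alternating forms\<close>

text \<open>
  Forms are compared as functions; evaluating the pointwise operations would destroy the terms to which
  the rules for contractions apply.
\<close>

declare zero_fun_apply [simp del] plus_fun_apply [simp del] minus_apply [simp del]
  uminus_apply [simp del]

lemmas fun_apply = zero_fun_apply plus_fun_apply minus_apply uminus_apply

definition iota :: "'n \<Rightarrow> ('n list \<Rightarrow> 'v) \<Rightarrow> 'n list \<Rightarrow> 'v"
  where "iota x \<phi> = (\<lambda>xs. \<phi> (x # xs))"

lemma scaleC_apply: "(c *\<^sub>C \<phi>) x = c *\<^sub>C \<phi> x"
  by (simp add: scaleC_fun_def)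

lemma list_fun_eqI: "\<phi> [] = \<psi> [] \<Longrightarrow> (\<And>x. iota x \<phi> = iota x \<psi>) \<Longrightarrow> \<phi> = \<psi>"
proof (rule ext)
  fix xs assume "\<phi> [] = \<psi> []" "\<And>x. iota x \<phi> = iota x \<psi>"
  then show "\<phi> xs = \<psi> xs" by (cases xs) (auto simp: iota_def fun_eq_iff)
qed

lemma iota_simps [simp]:
  "iota x (\<phi> + \<psi>) = iota x \<phi> + iota x \<psi>" "iota x (\<phi> - \<psi>) = iota x \<phi> - iota x \<psi>"
  "iota x (- \<phi>) = - iota x \<phi>" "iota x 0 = 0" "iota x (c *\<^sub>C \<phi>) = c *\<^sub>C iota x \<phi>"
  by (simp_all add: iota_def fun_eq_iff fun_apply scaleC_apply)

lemma iota_comp [simp]: "iota x (T \<circ> \<phi>) = T \<circ> iota x \<phi>"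
  by (simp add: iota_def fun_eq_iff)

text \<open>
  Alternating \<open>k\<close>-forms on \<open>N\<close> by recursion on the degree.  All later arguments go through the
  contractions \<open>iota x\<close>, so it is enough to impose alternation on the two
  leading arguments.
\<close>

primrec alt :: "'n::complex_vector set \<Rightarrow> nat \<Rightarrow> ('n list \<Rightarrow> 'v::complex_vector) \<Rightarrow> bool"
  where "alt N 0 \<phi> \<longleftrightarrow> (\<forall>x. iota x \<phi> = 0)"
  | "alt N (Suc k) \<phi> \<longleftrightarrow> \<phi> [] = 0 \<and> (\<forall>x. x \<notin> N \<longrightarrow> iota x \<phi> = 0) \<and>
      (\<forall>x\<in>N. \<forall>y\<in>N. iota (x + y) \<phi> = iota x \<phi> + iota y \<phi>) \<and>
      (\<forall>c. \<forall>x\<in>N. iota (c *\<^sub>C x) \<phi> = c *\<^sub>C iota x \<phi>) \<and>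
      (\<forall>x\<in>N. alt N k (iota x \<phi>)) \<and> (\<forall>x\<in>N. iota x (iota x \<phi>) = 0)"

lemma alt_zero [simp]: "alt N k 0"
  by (induction k) (simp_all add: zero_fun_apply[of "[]"])

lemma alt_iota_outside: "alt N k \<phi> \<Longrightarrow> x \<notin> N \<Longrightarrow> iota x \<phi> = 0"
  by (cases k) auto

lemma alt_iota_add: "alt N k \<phi> \<Longrightarrow> x \<in> N \<Longrightarrow> y \<in> N \<Longrightarrow> iota (x + y) \<phi> = iota x \<phi> + iota y \<phi>"
  by (cases k) auto

lemma alt_iota_scale: "alt N k \<phi> \<Longrightarrow> x \<in> N \<Longrightarrow> iota (c *\<^sub>C x) \<phi> = c *\<^sub>C iota x \<phi>"
  by (cases k) auto

lemma alt_iota: "alt N k \<phi> \<Longrightarrow> x \<in> N \<Longrightarrow> alt N (k - 1) (iota x \<phi>)"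
  by (cases k) auto

lemma alt_iota_iota: "alt N k \<phi> \<Longrightarrow> x \<in> N \<Longrightarrow> iota x (iota x \<phi>) = 0"
  by (cases k) auto

lemma alt_iota_zero: "alt N k \<phi> \<Longrightarrow> 0 \<in> N \<Longrightarrow> iota 0 \<phi> = 0"
  using alt_iota_scale[of N k \<phi> 0 0] by simp

lemma alt_iota_diff:
  assumes "cvs.subspace N" "alt N k \<phi>" "x \<in> N" "y \<in> N"
  shows "iota (x - y) \<phi> = iota x \<phi> - iota y \<phi>"
  using alt_iota_add[OF assms(2), of "x - y" y] assms by (simp add: cvs.subspace_diff)

text \<open>Polarisation of the vanishing on equal arguments.\<close>

lemma alt_iota_swap:
  assumes "cvs.subspace N" "alt N k \<phi>" "x \<in> N" "y \<in> N"
  shows "iota x (iota y \<phi>) = - iota y (iota x \<phi>)"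
proof -
  have a: "alt N (k - 1) (iota x \<phi>)" "alt N (k - 1) (iota y \<phi>)" using assms alt_iota by blast+
  have "0 = iota (x + y) (iota (x + y) \<phi>)"
    using alt_iota_iota[OF assms(2) cvs.subspace_add[OF assms(1,3,4)]] by simp
  also have "\<dots> = iota (x + y) (iota x \<phi>) + iota (x + y) (iota y \<phi>)"
    using assms by (simp add: alt_iota_add)
  also have "\<dots> = iota x (iota y \<phi>) + iota y (iota x \<phi>)"
    using alt_iota_add[OF a(1) assms(3,4)] alt_iota_add[OF a(2) assms(3,4)]
      alt_iota_iota[OF assms(2,3)] alt_iota_iota[OF assms(2,4)] by simp
  finally have "iota x (iota y \<phi>) + iota y (iota x \<phi>) = 0" by simp
  then show ?thesis by (simp add: eq_neg_iff_add_eq_0)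
qed

lemma alt_add: "alt N k \<phi> \<Longrightarrow> alt N k \<psi> \<Longrightarrow> alt N k (\<phi> + \<psi>)"
  by (induction k arbitrary: \<phi> \<psi>) (simp_all add: scaleC_add_right add_ac plus_fun_apply[of _ _ "[]"])

lemma alt_scale: "alt N k \<phi> \<Longrightarrow> alt N k (c *\<^sub>C \<phi>)"
proof (induction k arbitrary: \<phi>)
  case (Suc k)
  have "(c *\<^sub>C \<phi>) [] = 0" using Suc.prems by (simp add: scaleC_apply)
  with Suc show ?case by (simp add: scaleC_add_right scaleC_scaleC mult.commute)
qed simp

lemma alt_minus: "alt N k \<phi> \<Longrightarrow> alt N k (- \<phi>)"
  using alt_scale[of N k \<phi> "-1"] by simp

lemma alt_diff: "alt N k \<phi> \<Longrightarrow> alt N k \<psi> \<Longrightarrow> alt N k (\<phi> - \<psi>)"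
  using alt_add[OF _ alt_minus, of N k \<phi> \<psi>] by simp

lemma comp_lin [simp]:
  assumes "clinear T"
  shows "T \<circ> 0 = 0" "T \<circ> (\<phi> + \<psi>) = (T \<circ> \<phi>) + (T \<circ> \<psi>)" "T \<circ> (c *\<^sub>C \<phi>) = c *\<^sub>C (T \<circ> \<phi>)"
    "T \<circ> (- \<phi>) = - (T \<circ> \<phi>)" "T \<circ> (\<phi> - \<psi>) = (T \<circ> \<phi>) - (T \<circ> \<psi>)"
  using assms clinear_0[OF assms] clinear_diff[OF assms] clinear_diff[OF assms, of 0]
  by (simp_all add: fun_eq_iff clinear_iff scaleC_apply fun_apply)

lemma alt_comp: "clinear T \<Longrightarrow> alt N k \<phi> \<Longrightarrow> alt N k (T \<circ> \<phi>)"
  by (induction k arbitrary: \<phi>) (auto simp: clinear_0)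

lemma alt_outside: "alt N k \<phi> \<Longrightarrow> \<not> (length xs = k \<and> set xs \<subseteq> N) \<Longrightarrow> \<phi> xs = 0"
proof (induction k arbitrary: \<phi> xs)
  case 0
  then show ?case by (cases xs) (auto simp: iota_def fun_eq_iff fun_apply)
next
  case (Suc k)
  show ?case
  proof (cases xs)
    case Nil
    then show ?thesis using Suc.prems by simp
  next
    case (Cons x ys)
    have "iota x \<phi> ys = 0"
    proof (cases "x \<in> N")
      case True
      then show ?thesis using Suc Cons by auto
    qed (use Suc.prems in \<open>simp add: fun_apply\<close>)
    then show ?thesis by (simp add: Cons iota_def)
  qed
qed

text \<open>Forms of degree \<open>k - 1\<close>; there are none but \<open>0\<close> when \<open>k = 0\<close>.\<close>

definition below :: "'n::complex_vector set \<Rightarrow> nat \<Rightarrow> ('n list \<Rightarrow> 'v::complex_vector) \<Rightarrow> bool"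
  where "below N k \<phi> \<longleftrightarrow> (case k of 0 \<Rightarrow> \<phi> = 0 | Suc j \<Rightarrow> alt N j \<phi>)"

lemma below_simps [simp]: "below N 0 \<phi> \<longleftrightarrow> \<phi> = 0" "below N (Suc k) \<phi> \<longleftrightarrow> alt N k \<phi>"
  by (simp_all add: below_def)

lemma below_alt: "below N k \<phi> \<Longrightarrow> alt N (k - 1) \<phi>"
  by (cases k) auto

lemma below_iota: "alt N k \<phi> \<Longrightarrow> x \<in> N \<Longrightarrow> below N k (iota x \<phi>)"
  by (cases k) auto

lemma below_lin:
  "below N k \<phi> \<Longrightarrow> below N k \<psi> \<Longrightarrow> below N k (\<phi> + \<psi>)"
  "below N k \<phi> \<Longrightarrow> below N k (c *\<^sub>C \<phi>)"
  "below N k \<phi> \<Longrightarrow> below N k (- \<phi>)"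
  "clinear T \<Longrightarrow> below N k \<phi> \<Longrightarrow> below N k (T \<circ> \<phi>)"
  "below N k 0"
  by (cases k; simp add: alt_add alt_scale alt_minus alt_comp)+

subsection \<open>The action of endomorphisms\<close>

definition linear_on :: "'n::complex_vector set \<Rightarrow> ('n \<Rightarrow> 'n) \<Rightarrow> bool"
  where "linear_on N b \<longleftrightarrow> (\<forall>x\<in>N. b x \<in> N) \<and> (\<forall>x\<in>N. \<forall>y\<in>N. b (x + y) = b x + b y) \<and>
    (\<forall>c. \<forall>x\<in>N. b (c *\<^sub>C x) = c *\<^sub>C b x)"

text \<open>
  \<open>(act N b \<phi>)(x\<^sub>1, \<dots>, x\<^sub>k) = \<Sum>\<^sub>j \<phi>(\<dots>, b x\<^sub>j, \<dots>)\<close>, so that \<open>act N (br x)\<close> is minus the Lie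
  derivative along \<open>x\<close>.
\<close>

fun act :: "'n set \<Rightarrow> ('n \<Rightarrow> 'n) \<Rightarrow> ('n list \<Rightarrow> 'v::complex_vector) \<Rightarrow> 'n list \<Rightarrow> 'v"
  where "act N b \<phi> [] = 0"
  | "act N b \<phi> (y # ys) = (if y \<in> N then iota (b y) \<phi> ys + act N b (iota y \<phi>) ys else 0)"

lemma iota_act: "iota y (act N b \<phi>) = (if y \<in> N then iota (b y) \<phi> + act N b (iota y \<phi>) else 0)"
  by (simp add: iota_def fun_eq_iff fun_apply)

lemma act_add_pt: "act N b (\<phi> + \<psi>) xs = act N b \<phi> xs + act N b \<psi> xs"
  by (induction xs arbitrary: \<phi> \<psi>) (simp_all add: fun_apply)

lemma act_comp_pt: "clinear T \<Longrightarrow> act N b (T \<circ> \<phi>) xs = T (act N b \<phi> xs)"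
  by (induction xs arbitrary: \<phi>) (auto simp: clinear_0 clinear_iff)

lemma act_comp: "clinear T \<Longrightarrow> act N b (T \<circ> \<phi>) = T \<circ> act N b \<phi>"
  by (simp add: fun_eq_iff act_comp_pt)

lemma clinear_scaleC: "clinear ((*\<^sub>C) c)"
  by (simp add: clinear_iff scaleC_add_right scaleC_scaleC mult.commute)

lemma scaleC_comp: "c *\<^sub>C \<phi> = (*\<^sub>C) c \<circ> \<phi>"
  by (simp add: fun_eq_iff scaleC_apply)

lemma act_lin [simp]:
  fixes \<phi> \<psi> :: "'n list \<Rightarrow> 'v::complex_vector"
  shows "act N b (\<phi> + \<psi>) = act N b \<phi> + act N b \<psi>" "act N b (c *\<^sub>C \<phi>) = c *\<^sub>C act N b \<phi>"
    "act N b (0 :: 'n list \<Rightarrow> 'v) = 0" "act N b (- \<phi>) = - act N b \<phi>"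
    "act N b (\<phi> - \<psi>) = act N b \<phi> - act N b \<psi>"
proof -
  have add: "act N b (\<phi> + \<psi>) = act N b \<phi> + act N b \<psi>" for \<phi> \<psi> :: "'n list \<Rightarrow> 'v"
    by (simp add: fun_eq_iff act_add_pt fun_apply)
  have z: "act N b (0 :: 'n list \<Rightarrow> 'v) = 0" using add[of 0 0] by simp
  have m: "act N b (- \<phi>) = - act N b \<phi>" for \<phi> :: "'n list \<Rightarrow> 'v"
    using add[of \<phi> "- \<phi>"] z by (simp add: eq_neg_iff_add_eq_0 add.commute)
  show "act N b (c *\<^sub>C \<phi>) = c *\<^sub>C act N b \<phi>"
    unfolding scaleC_comp by (rule act_comp[OF clinear_scaleC])
  show "act N b (\<phi> - \<psi>) = act N b \<phi> - act N b \<psi>" using add[of \<phi> "- \<psi>"] m by simp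
  show "act N b (\<phi> + \<psi>) = act N b \<phi> + act N b \<psi>" "act N b (0 :: 'n list \<Rightarrow> 'v) = 0"
    "act N b (- \<phi>) = - act N b \<phi>" by (fact add z m)+
qed

lemma act_cong_pt: "(\<And>y. y \<in> N \<Longrightarrow> a y = b y) \<Longrightarrow> act N a \<phi> xs = act N b \<phi> xs"
  by (induction xs arbitrary: \<phi>) auto

lemma act_cong: "(\<And>y. y \<in> N \<Longrightarrow> a y = b y) \<Longrightarrow> act N a \<phi> = act N b \<phi>"
  by (rule ext) (rule act_cong_pt)

lemma act_alt_0: "alt N 0 \<phi> \<Longrightarrow> act N b \<phi> = 0"
  by (rule list_fun_eqI) (simp_all add: iota_act fun_apply)

lemma act_alt:
  assumes N: "cvs.subspace N" and b: "linear_on N b"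
  shows "alt N k \<phi> \<Longrightarrow> alt N k (act N b \<phi>)"
proof (induction k arbitrary: \<phi>)
  case 0
  then show ?case by (simp add: act_alt_0)
next
  case (Suc k)
  note a = Suc.prems
  have bN: "b x \<in> N" if "x \<in> N" for x using b that by (simp add: linear_on_def)
  have "iota (x + y) (act N b \<phi>) = iota x (act N b \<phi>) + iota y (act N b \<phi>)"
    if "x \<in> N" "y \<in> N" for x y
    using b that bN a by (simp add: iota_act cvs.subspace_add[OF N] linear_on_def)
  moreover have "iota (c *\<^sub>C x) (act N b \<phi>) = c *\<^sub>C iota x (act N b \<phi>)" if "x \<in> N" for x c
    using b that bN a by (simp add: iota_act cvs.subspace_scale[OF N] linear_on_def scaleC_add_right)
  moreover have "alt N k (iota x (act N b \<phi>))" if "x \<in> N" for x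
    using a bN that by (simp add: iota_act alt_add Suc.IH)
  moreover have "iota x (iota x (act N b \<phi>)) = 0" if "x \<in> N" for x
  proof -
    have "iota (b x) (iota x \<phi>) = - iota x (iota (b x) \<phi>)"
      by (rule alt_iota_swap[OF N a]) (use bN that in auto)
    then show ?thesis using that a by (simp add: iota_act)
  qed
  ultimately show ?case by (simp add: iota_act)
qed

lemma below_act: "cvs.subspace N \<Longrightarrow> linear_on N b \<Longrightarrow> below N k \<phi> \<Longrightarrow> below N k (act N b \<phi>)"
  by (cases k) (auto simp: act_alt)

lemma act_add_endo:
  assumes N: "cvs.subspace N" and "linear_on N a" "linear_on N b"
  shows "alt N k \<phi> \<Longrightarrow> act N (\<lambda>y. a y + b y) \<phi> = act N a \<phi> + act N b \<phi>"
proof (induction k arbitrary: \<phi>)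
  case (Suc k)
  show ?case
  proof (rule list_fun_eqI)
    fix z
    show "iota z (act N (\<lambda>y. a y + b y) \<phi>) = iota z (act N a \<phi> + act N b \<phi>)"
    proof (cases "z \<in> N")
      case True
      then have "a z \<in> N" "b z \<in> N" "alt N k (iota z \<phi>)"
        using assms Suc.prems by (auto simp: linear_on_def)
      then show ?thesis
        using True Suc.IH alt_iota_add[OF Suc.prems] by (simp add: iota_act)
    qed (simp add: iota_act)
  qed (simp add: fun_apply)
qed (simp add: act_alt_0)

lemma act_scale_endo:
  assumes N: "cvs.subspace N" and "linear_on N a"
  shows "alt N k \<phi> \<Longrightarrow> act N (\<lambda>y. c *\<^sub>C a y) \<phi> = c *\<^sub>C act N a \<phi>"
proof (induction k arbitrary: \<phi>)
  case (Suc k)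
  show ?case
  proof (rule list_fun_eqI)
    fix z
    show "iota z (act N (\<lambda>y. c *\<^sub>C a y) \<phi>) = iota z (c *\<^sub>C act N a \<phi>)"
    proof (cases "z \<in> N")
      case True
      then have "a z \<in> N" "alt N k (iota z \<phi>)"
        using assms Suc.prems by (auto simp: linear_on_def)
      then show ?thesis
        using True Suc.IH alt_iota_scale[OF Suc.prems] by (simp add: iota_act scaleC_add_right)
    qed (simp add: iota_act)
  qed (simp add: scaleC_apply)
qed (simp add: act_alt_0)

text \<open>
  By induction on the degree: contraction with \<open>z\<close> commutes with each action up to the contraction
  with the image of \<open>z\<close>, and the mixed terms cancel.
\<close>

lemma act_commutator:
  assumes N: "cvs.subspace N" and a: "linear_on N a" and b: "linear_on N b"
  shows "alt N k \<phi> \<Longrightarrow>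
    act N a (act N b \<phi>) - act N b (act N a \<phi>) = - act N (\<lambda>z. a (b z) - b (a z)) \<phi>"
proof (induction k arbitrary: \<phi>)
  case 0
  then show ?case by (simp add: act_alt_0)
next
  case (Suc k)
  show ?case
  proof (rule list_fun_eqI)
    fix z
    show "iota z (act N a (act N b \<phi>) - act N b (act N a \<phi>))
        = iota z (- act N (\<lambda>z. a (b z) - b (a z)) \<phi>)"
    proof (cases "z \<in> N")
      case True
      have ab: "a z \<in> N" "b z \<in> N" "a (b z) \<in> N" "b (a z) \<in> N"
        using a b True by (auto simp: linear_on_def)
      have "act N a (act N b (iota z \<phi>)) - act N b (act N a (iota z \<phi>))
          = - act N (\<lambda>z. a (b z) - b (a z)) (iota z \<phi>)"
        by (rule Suc.IH) (use Suc.prems True in simp)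
      moreover have "iota (a (b z) - b (a z)) \<phi> = iota (a (b z)) \<phi> - iota (b (a z)) \<phi>"
        by (rule alt_iota_diff[OF N Suc.prems ab(3,4)])
      ultimately show ?thesis using True ab by (simp add: iota_act algebra_simps)
    qed (simp add: iota_act)
  qed (simp add: fun_apply)
qed

text \<open>
  Let \<open>m\<close> be an exponent that works one degree lower.  Induction on \<open>r\<close> shows that \<open>r * m\<close> applications
  of \<open>act N b\<close>, followed by contraction with a vector in the kernel of \<open>b ^^ r\<close>, give \<open>0\<close>.
\<close>

lemma act_nilpotent:
  assumes N: "cvs.subspace N" and b: "linear_on N b" and nil: "\<And>y. y \<in> N \<Longrightarrow> (b ^^ M) y = 0"
  obtains m where "\<And>\<phi> :: 'n::complex_vector list \<Rightarrow> 'v::complex_vector.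
    alt N k \<phi> \<Longrightarrow> (act N b ^^ m) \<phi> = 0"
proof -
  have "\<exists>m. \<forall>\<phi> :: 'n list \<Rightarrow> 'v. alt N k \<phi> \<longrightarrow> (act N b ^^ m) \<phi> = 0"
  proof (induction k)
    case 0
    show ?case by (rule exI[of _ 1]) (simp add: act_alt_0)
  next
    case (Suc k)
    then obtain m where m: "(act N b ^^ m) \<phi> = 0" if "alt N k \<phi>" for \<phi> :: "'n list \<Rightarrow> 'v" by blast
    have bN: "b x \<in> N" if "x \<in> N" for x using b that by (simp add: linear_on_def)
    have altp: "alt N (Suc k) ((act N b ^^ j) \<phi>)" if "alt N (Suc k) \<phi>" for j and \<phi> :: "'n list \<Rightarrow> 'v"
      by (induction j) (use that act_alt[OF N b, of "Suc k"] in auto)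
    have key: "iota z ((act N b ^^ (r * m)) \<phi>) = 0"
      if "z \<in> N" "(b ^^ r) z = 0" "alt N (Suc k) \<phi>" for r z and \<phi> :: "'n list \<Rightarrow> 'v"
      using that
    proof (induction r arbitrary: z \<phi>)
      case 0
      then show ?case using alt_iota_zero by force
    next
      case (Suc r)
      let ?\<psi> = "(act N b ^^ (r * m)) \<phi>"
      have 1: "iota (b z) ((act N b ^^ j) ?\<psi>) = 0" for j
      proof -
        have "(act N b ^^ j) ?\<psi> = (act N b ^^ (r * m)) ((act N b ^^ j) \<phi>)"
          by (metis add.commute comp_apply funpow_add)
        then show ?thesis
          using Suc.IH[of "b z" "(act N b ^^ j) \<phi>"] Suc.prems bN altp[of \<phi> j]
          by (simp add: funpow_swap1)
      qed
      have 2: "iota z ((act N b ^^ j) ?\<psi>) = (act N b ^^ j) (iota z ?\<psi>)" for j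
        by (induction j) (use Suc.prems(1) 1 in \<open>simp_all add: iota_act\<close>)
      have "(act N b ^^ m) (iota z ?\<psi>) = 0"
        by (rule m) (use altp[OF Suc.prems(3)] Suc.prems(1) in simp)
      then show ?case using 2[of m] by (simp add: funpow_add)
    qed
    have "(act N b ^^ (M * m)) \<phi> = 0" if \<phi>: "alt N (Suc k) \<phi>" for \<phi> :: "'n list \<Rightarrow> 'v"
    proof (rule list_fun_eqI)
      show "iota z ((act N b ^^ (M * m)) \<phi>) = iota z 0" for z
        using key[OF _ nil \<phi>] alt_iota_outside[OF altp[OF \<phi>]] by (cases "z \<in> N") auto
    qed (use altp[OF \<phi>] in \<open>simp add: fun_apply\<close>)
    then show ?case by blast
  qed
  then show ?thesis using that by blast
qed

lemma act_funpow_alt: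
  "cvs.subspace N \<Longrightarrow> linear_on N b \<Longrightarrow> alt N k \<phi> \<Longrightarrow> alt N k ((act N b ^^ j) \<phi>)"
  by (induction j) (auto simp: act_alt)

subsection \<open>The differential\<close>

definition lie_on :: "'n::complex_vector set \<Rightarrow> ('n \<Rightarrow> 'n \<Rightarrow> 'n) \<Rightarrow> bool"
  where "lie_on N br \<longleftrightarrow> cvs.subspace N \<and> bilinear_on N N br \<and> (\<forall>x\<in>N. \<forall>y\<in>N. br x y \<in> N) \<and>
    (\<forall>x\<in>N. br x x = 0) \<and>
    (\<forall>x\<in>N. \<forall>y\<in>N. \<forall>z\<in>N. br x (br y z) = br (br x y) z + br y (br x z))"

definition derivation_on :: "'n::complex_vector set \<Rightarrow> ('n \<Rightarrow> 'n \<Rightarrow> 'n) \<Rightarrow> ('n \<Rightarrow> 'n) \<Rightarrow> bool"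
  where "derivation_on N br b \<longleftrightarrow> linear_on N b \<and>
    (\<forall>y\<in>N. \<forall>z\<in>N. b (br y z) = br (b y) z + br y (b z))"

lemma lie_onD:
  assumes "lie_on N br"
  shows "cvs.subspace N" "\<And>x y. x \<in> N \<Longrightarrow> y \<in> N \<Longrightarrow> br x y \<in> N" "\<And>x. x \<in> N \<Longrightarrow> br x x = 0"
    "\<And>x. x \<in> N \<Longrightarrow> derivation_on N br (br x)" "\<And>x. x \<in> N \<Longrightarrow> linear_on N (br x)"
    "\<And>x y z. x \<in> N \<Longrightarrow> y \<in> N \<Longrightarrow> z \<in> N \<Longrightarrow> br (x + y) z = br x z + br y z"
    "\<And>c x z. x \<in> N \<Longrightarrow> z \<in> N \<Longrightarrow> br (c *\<^sub>C x) z = c *\<^sub>C br x z"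
    "\<And>x y z. x \<in> N \<Longrightarrow> y \<in> N \<Longrightarrow> z \<in> N \<Longrightarrow> br x (y + z) = br x y + br x z"
    "\<And>c x z. x \<in> N \<Longrightarrow> z \<in> N \<Longrightarrow> br x (c *\<^sub>C z) = c *\<^sub>C br x z"
proof -
  note L = assms[unfolded lie_on_def bilinear_on_def]
  show "cvs.subspace N" using L by blast
  show br: "br x y \<in> N" if "x \<in> N" "y \<in> N" for x y using L that by blast
  show "br x x = 0" if "x \<in> N" for x using L that by blast
  show "br (x + y) z = br x z + br y z" "br x (y + z) = br x y + br x z"
    if "x \<in> N" "y \<in> N" "z \<in> N" for x y z using L that by blast+
  show "br (c *\<^sub>C x) z = c *\<^sub>C br x z" "br x (c *\<^sub>C z) = c *\<^sub>C br x z"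
    if "x \<in> N" "z \<in> N" for c x z using L that by blast+
  show lin: "linear_on N (br x)" if "x \<in> N" for x
    unfolding linear_on_def using br L that by blast
  show "derivation_on N br (br x)" if "x \<in> N" for x
    unfolding derivation_on_def using lin L that by blast
qed

text \<open>
  The Chevalley--Eilenberg differential of the module on which \<open>x\<close> acts as \<open>\<eta> x\<close> times \<open>T\<close>.  The
  recursion is Cartan's formula \<open>\<iota>\<^sub>x d = \<L>\<^sub>x - d \<iota>\<^sub>x\<close>.
\<close>

fun diff :: "'n set \<Rightarrow> ('n \<Rightarrow> 'n \<Rightarrow> 'n) \<Rightarrow> ('n \<Rightarrow> complex) \<Rightarrow> ('v \<Rightarrow> 'v)
    \<Rightarrow> ('n list \<Rightarrow> 'v::complex_vector) \<Rightarrow> 'n list \<Rightarrow> 'v"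
  where "diff N br \<eta> T \<phi> [] = 0"
  | "diff N br \<eta> T \<phi> (x # xs) = (if x \<in> N
       then \<eta> x *\<^sub>C T (\<phi> xs) - act N (br x) \<phi> xs - diff N br \<eta> T (iota x \<phi>) xs else 0)"

lemma iota_diff: "iota x (diff N br \<eta> T \<phi>) = (if x \<in> N
    then \<eta> x *\<^sub>C (T \<circ> \<phi>) - act N (br x) \<phi> - diff N br \<eta> T (iota x \<phi>) else 0)"
  by (simp add: iota_def fun_eq_iff fun_apply scaleC_apply)

lemma diff_Nil: "diff N br \<eta> T \<phi> [] = 0"
  by simp

lemma diff_add_pt:
  "clinear T \<Longrightarrow> diff N br \<eta> T (\<phi> + \<psi>) xs = diff N br \<eta> T \<phi> xs + diff N br \<eta> T \<psi> xs"
  by (induction xs arbitrary: \<phi> \<psi>) (simp_all add: fun_apply clinear_iff scaleC_add_right)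

lemma diff_comp_pt:
  "clinear S \<Longrightarrow> (\<And>v. S (T v) = T' (S v)) \<Longrightarrow> diff N br \<eta> T' (S \<circ> \<phi>) xs = S (diff N br \<eta> T \<phi> xs)"
  by (induction xs arbitrary: \<phi>) (simp_all add: clinear_0 act_comp clinear_diff, simp add: clinear_iff)

lemma diff_comp:
  "clinear S \<Longrightarrow> (\<And>v. S (T v) = T' (S v)) \<Longrightarrow> diff N br \<eta> T' (S \<circ> \<phi>) = S \<circ> diff N br \<eta> T \<phi>"
  by (simp add: fun_eq_iff diff_comp_pt)

lemma diff_lin:
  fixes \<phi> \<psi> :: "'n list \<Rightarrow> 'v::complex_vector"
  assumes T: "clinear T"
  shows "diff N br \<eta> T (\<phi> + \<psi>) = diff N br \<eta> T \<phi> + diff N br \<eta> T \<psi>"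
    "diff N br \<eta> T (c *\<^sub>C \<phi>) = c *\<^sub>C diff N br \<eta> T \<phi>"
    "diff N br \<eta> T (0 :: 'n list \<Rightarrow> 'v) = 0" "diff N br \<eta> T (- \<phi>) = - diff N br \<eta> T \<phi>"
    "diff N br \<eta> T (\<phi> - \<psi>) = diff N br \<eta> T \<phi> - diff N br \<eta> T \<psi>"
proof -
  have add: "diff N br \<eta> T (\<phi> + \<psi>) = diff N br \<eta> T \<phi> + diff N br \<eta> T \<psi>"
    for \<phi> \<psi> :: "'n list \<Rightarrow> 'v"
    by (simp add: fun_eq_iff diff_add_pt[OF T] fun_apply)
  have z: "diff N br \<eta> T (0 :: 'n list \<Rightarrow> 'v) = 0" using add[of 0 0] by simp
  have m: "diff N br \<eta> T (- \<phi>) = - diff N br \<eta> T \<phi>" for \<phi> :: "'n list \<Rightarrow> 'v"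
    using add[of \<phi> "- \<phi>"] z by (simp add: eq_neg_iff_add_eq_0 add.commute)
  show "diff N br \<eta> T (c *\<^sub>C \<phi>) = c *\<^sub>C diff N br \<eta> T \<phi>"
    unfolding scaleC_comp by (rule diff_comp[OF clinear_scaleC]) (use T in \<open>simp add: clinear_iff\<close>)
  show "diff N br \<eta> T (\<phi> - \<psi>) = diff N br \<eta> T \<phi> - diff N br \<eta> T \<psi>"
    using add[of \<phi> "- \<psi>"] m by simp
  show "diff N br \<eta> T (\<phi> + \<psi>) = diff N br \<eta> T \<phi> + diff N br \<eta> T \<psi>"
    "diff N br \<eta> T (0 :: 'n list \<Rightarrow> 'v) = 0"
    "diff N br \<eta> T (- \<phi>) = - diff N br \<eta> T \<phi>" by (fact add z m)+
qed

lemma diff_funpow: "clinear T \<Longrightarrow> (\<And>v. S (T v) = T (S v)) \<Longrightarrow> clinear S \<Longrightarrow>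
    diff N br \<eta> T ((S ^^ j) \<circ> \<phi>) = (S ^^ j) \<circ> diff N br \<eta> T \<phi>"
proof (induction j)
  case (Suc j)
  then show ?case
    using diff_comp[of S T T N br \<eta> "(S ^^ j) \<circ> \<phi>"] by (simp only: funpow.simps comp_assoc)
qed (simp add: comp_def)

lemma diff_eq_pt: "(\<And>y v. y \<in> N \<Longrightarrow> \<eta> y *\<^sub>C T v = \<eta>' y *\<^sub>C T' v)
    \<Longrightarrow> diff N br \<eta> T \<phi> xs = diff N br \<eta>' T' \<phi> xs"
  by (induction xs arbitrary: \<phi>) auto

lemma diff_eq: "(\<And>y v. y \<in> N \<Longrightarrow> \<eta> y *\<^sub>C T v = \<eta>' y *\<^sub>C T' v)
    \<Longrightarrow> diff N br \<eta> T = diff N br \<eta>' T'"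
  by (intro ext) (rule diff_eq_pt)

text \<open>
  For equal arguments, Cartan's formula gives \<open>\<iota>\<^sub>x \<iota>\<^sub>x d = \<iota>\<^sub>x \<L>\<^sub>x - \<L>\<^sub>x \<iota>\<^sub>x + d \<iota>\<^sub>x \<iota>\<^sub>x\<close>, where the first two
  terms cancel because \<open>[x, x] = 0\<close> and the last one vanishes.
\<close>

lemma diff_alt:
  assumes L: "lie_on N br" and T: "clinear T" and \<eta>: "\<And>x y. x \<in> N \<Longrightarrow> y \<in> N \<Longrightarrow> \<eta> (x + y) = \<eta> x + \<eta> y"
    "\<And>c x. x \<in> N \<Longrightarrow> \<eta> (c *\<^sub>C x) = c * \<eta> x"
  shows "alt N k \<phi> \<Longrightarrow> alt N (Suc k) (diff N br \<eta> T \<phi>)"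
proof (induction k arbitrary: \<phi>)
  case 0
  note a = 0
  have [simp]: "iota x \<phi> = 0" for x using a by simp
  have i: "iota x (diff N br \<eta> T \<phi>) = (if x \<in> N then \<eta> x *\<^sub>C (T \<circ> \<phi>) else 0)" for x
    using a by (simp add: iota_diff act_alt_0 diff_lin[OF T])
  show ?case
    using lie_onD(1)[OF L] \<eta> T
    by (auto simp: i cvs.subspace_add cvs.subspace_scale scaleC_add_left scaleC_scaleC)
next
  case (Suc k)
  note N = lie_onD(1)[OF L] and a = Suc.prems
  note [simp] = iota_diff diff_lin[OF T] act_alt[OF N lie_onD(5)[OF L]]
  have add: "act N (br (x + y)) \<phi> = act N (br x) \<phi> + act N (br y) \<phi>" if "x \<in> N" "y \<in> N" for x y
    using act_add_endo[OF N lie_onD(5)[OF L] lie_onD(5)[OF L] a] that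
      act_cong[of N "br (x + y)" "\<lambda>z. br x z + br y z" \<phi>] lie_onD(6)[OF L] by simp
  have scale: "act N (br (c *\<^sub>C x)) \<phi> = c *\<^sub>C act N (br x) \<phi>" if "x \<in> N" for c x
    using act_scale_endo[OF N lie_onD(5)[OF L] a] that
      act_cong[of N "br (c *\<^sub>C x)" "\<lambda>z. c *\<^sub>C br x z" \<phi>] lie_onD(7)[OF L] by simp
  have "iota (x + y) (diff N br \<eta> T \<phi>) = iota x (diff N br \<eta> T \<phi>) + iota y (diff N br \<eta> T \<phi>)"
    if "x \<in> N" "y \<in> N" for x y
    using that add \<eta> alt_iota_add[OF a that] cvs.subspace_add[OF N that]
    by (simp add: scaleC_add_left algebra_simps)
  moreover have "iota (c *\<^sub>C x) (diff N br \<eta> T \<phi>) = c *\<^sub>C iota x (diff N br \<eta> T \<phi>)"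
    if "x \<in> N" for x c
    using that scale \<eta> alt_iota_scale[OF a that] cvs.subspace_scale[OF N that]
    by (simp add: cvs.scale_right_diff_distrib scaleC_scaleC)
  moreover have "alt N (Suc k) (iota x (diff N br \<eta> T \<phi>))" if "x \<in> N" for x
  proof -
    have "alt N (Suc k) (\<eta> x *\<^sub>C (T \<circ> \<phi>))" by (rule alt_scale[OF alt_comp[OF T a]])
    moreover have "alt N (Suc k) (act N (br x) \<phi>)" by (rule act_alt[OF N lie_onD(5)[OF L that] a])
    moreover have "alt N (Suc k) (diff N br \<eta> T (iota x \<phi>))"
      by (rule Suc.IH) (use a that in simp)
    ultimately show ?thesis using that by (simp only: iota_diff if_True alt_diff)
  qed
  moreover have "iota x (iota x (diff N br \<eta> T \<phi>)) = 0" if "x \<in> N" for x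
    using that alt_iota_zero[OF a cvs.subspace_0[OF N]] alt_iota_iota[OF a that] lie_onD(3)[OF L that]
    by (simp add: iota_act)
  moreover have "iota x (diff N br \<eta> T \<phi>) = 0" if "x \<notin> N" for x
    using that by simp
  ultimately show ?case unfolding alt.simps(2)[of N "Suc k"] by (blast intro: diff_Nil)
qed

text \<open>
  A derivation \<open>b\<close> with \<open>\<eta> \<circ> b = 0\<close> is an infinitesimal automorphism of all the data that define
  the differential.
\<close>

lemma diff_act:
  assumes L: "lie_on N br" and T: "clinear T" and b: "derivation_on N br b"
    and \<eta>: "\<And>y. y \<in> N \<Longrightarrow> \<eta> (b y) = 0"
  shows "alt N k \<phi> \<Longrightarrow> diff N br \<eta> T (act N b \<phi>) = act N b (diff N br \<eta> T \<phi>)"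
proof (induction k arbitrary: \<phi>)
  case 0
  note [simp] = iota_diff iota_act diff_lin[OF T]
  have i: "iota y (act N b (diff N br \<eta> T \<phi>)) = 0" for y
  proof (cases "y \<in> N")
    case True
    then have "b y \<in> N" using b by (simp add: derivation_on_def linear_on_def)
    moreover have "act N b (T \<circ> \<phi>) = 0" using act_comp[OF T, of N b \<phi>] T 0 by (simp add: act_alt_0)
    moreover have "iota z \<phi> = 0" for z using 0 by simp
    ultimately show ?thesis
      using True 0 \<eta>[OF True] by (simp add: act_alt_0)
  qed simp
  have "act N b (diff N br \<eta> T \<phi>) = 0"
    by (rule list_fun_eqI) (simp_all only: i iota_simps act.simps zero_fun_apply)
  then show ?case using 0 by (simp add: act_alt_0)
next
  case (Suc k)
  note N = lie_onD(1)[OF L] and a = Suc.prems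
  have bl: "linear_on N b" using b by (simp add: derivation_on_def)
  show ?case
  proof (rule list_fun_eqI)
    fix y
    show "iota y (diff N br \<eta> T (act N b \<phi>)) = iota y (act N b (diff N br \<eta> T \<phi>))"
    proof (cases "y \<in> N")
      case True
      have byN: "b y \<in> N" using bl True by (simp add: linear_on_def)
      have IH: "diff N br \<eta> T (act N b (iota y \<phi>)) = act N b (diff N br \<eta> T (iota y \<phi>))"
        by (rule Suc.IH) (use a True in simp)
      have "act N b (act N (br y) \<phi>) - act N (br y) (act N b \<phi>)
          = - act N (\<lambda>z. b (br y z) - br y (b z)) \<phi>"
        by (rule act_commutator[OF N bl lie_onD(5)[OF L True] a])
      also have "act N (\<lambda>z. b (br y z) - br y (b z)) \<phi> = act N (br (b y)) \<phi>"
        by (rule act_cong) (use b True in \<open>simp add: derivation_on_def\<close>)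
      finally have "act N (br y) (act N b \<phi>) = act N b (act N (br y) \<phi>) + act N (br (b y)) \<phi>"
        by (simp add: algebra_simps eq_neg_iff_add_eq_0)
      then show ?thesis
        using True byN \<eta>[OF True] IH
        by (simp add: iota_diff iota_act diff_lin[OF T] act_comp[OF T] algebra_simps)
    qed (simp add: iota_diff iota_act)
  qed (simp add: fun_apply)
qed

subsection \<open>Vanishing\<close>

text \<open>
  If \<open>T\<close> is invertible, Cartan's formula makes \<open>\<L>\<^sub>x = T - L\<close> homotopic to zero, for \<open>\<eta> x = 1\<close>; as \<open>L\<close>
  is nilpotent and commutes with \<open>T\<close>, the geometric series inverts this operator.
\<close>

lemma cocycle_exact:
  assumes L: "lie_on N br" and T: "clinear T" and T': "clinear T'" "\<And>v. T (T' v) = v" "\<And>v. T' (T v) = v"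
    and \<eta>: "\<And>y z. y \<in> N \<Longrightarrow> z \<in> N \<Longrightarrow> \<eta> (br y z) = 0"
    and x: "x \<in> N" "\<eta> x = 1" and nil: "\<And>y. y \<in> N \<Longrightarrow> (br x ^^ M) y = 0"
    and z: "alt N k z" "diff N br \<eta> T z = 0"
  shows "\<exists>w. below N k w \<and> diff N br \<eta> T w = z"
proof -
  note N = lie_onD(1)[OF L] and b = lie_onD(5)[OF L x(1)]
  let ?L = "act N (br x)" and ?d = "diff N br \<eta> T"
  let ?z = "iota x z"
  have L_d: "?d (?L \<phi>) = ?L (?d \<phi>)" if "alt N j \<phi>" for j \<phi>
    using diff_act[OF L T lie_onD(4)[OF L x(1)] _ that] \<eta> x(1) by simp
  have Lj_d: "?d ((?L ^^ i) \<phi>) = (?L ^^ i) (?d \<phi>)" if "alt N j \<phi>" for i j \<phi>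
    by (induction i) (use L_d[OF act_funpow_alt[OF N b that]] in simp_all)
  have cartan: "?d ?z = (T \<circ> z) - ?L z"
    using arg_cong[OF z(2), of "iota x"] x by (simp add: iota_diff scaleC_one)
  obtain m where m: "(?L ^^ m) z = 0"
    using act_nilpotent[OF N b nil, of k] z(1) by blast
  have Lfun: "(?L ^^ i) (T \<circ> \<phi>) = T \<circ> (?L ^^ i) \<phi>" for i \<phi>
  proof (induction i)
    case (Suc i)
    have "(?L ^^ Suc i) \<psi> = ?L ((?L ^^ i) \<psi>)" for \<psi> :: "'a list \<Rightarrow> 'b" by simp
    with Suc show ?case
      using act_comp[OF T, of N "br x" "(?L ^^ i) \<phi>"] by (simp only:)
  qed simp
  have Lfun_diff: "(?L ^^ i) (\<phi> - \<psi>) = (?L ^^ i) \<phi> - (?L ^^ i) \<psi>" for i and \<phi> \<psi> :: "'a list \<Rightarrow> 'b"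
    by (induction i) simp_all
  define u where "u i = (T' ^^ Suc i) \<circ> (?L ^^ i) ?z" for i
  define e where "e i = (T' ^^ i) \<circ> (?L ^^ i) z" for i
  define w where "w n = (\<Sum>i<n. u i)" for n
  have T'j: "clinear (T' ^^ i)" for i
    by (induction i) (use T'(1) in \<open>simp_all add: clinear_iff\<close>)
  have w: "below N k (w n) \<and> ?d (w n) = z - e n" for n
  proof (induction n)
    case 0
    show ?case by (simp add: w_def e_def below_lin(5) diff_lin(3)[OF T] comp_def)
  next
    case (Suc n)
    have zb: "below N k ((?L ^^ n) ?z)"
      using below_iota[OF z(1) x(1)] by (induction n) (simp_all add: below_act[OF N b])
    have "?d ((T' ^^ Suc n) \<circ> (?L ^^ n) ?z) = (T' ^^ Suc n) \<circ> ?d ((?L ^^ n) ?z)"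
      by (rule diff_funpow[OF T _ T'(1)]) (simp add: T')
    also have "?d ((?L ^^ n) ?z) = (?L ^^ n) ((T \<circ> z) - ?L z)"
      using Lj_d[OF alt_iota[OF z(1) x(1)]] cartan by simp
    also have "\<dots> = (T \<circ> (?L ^^ n) z) - (?L ^^ Suc n) z"
      by (simp add: Lfun Lfun_diff funpow_swap1)
    also have "(T' ^^ Suc n) \<circ> \<dots> = ((T' ^^ n) \<circ> (?L ^^ n) z) - ((T' ^^ Suc n) \<circ> (?L ^^ Suc n) z)"
    proof -
      have "(T' ^^ Suc n) \<circ> (T \<circ> \<phi>) = (T' ^^ n) \<circ> \<phi>" for \<phi> :: "'a list \<Rightarrow> 'b"
        by (simp only: funpow_Suc_right comp_assoc) (simp add: comp_def T' fun_eq_iff)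
      then show ?thesis using comp_lin(5)[OF T'j] by metis
    qed
    finally have "?d (u n) = e n - e (Suc n)" by (simp only: u_def e_def)
    moreover have "w (Suc n) = w n + u n" by (simp add: w_def)
    moreover have "below N k (u n)" unfolding u_def by (rule below_lin(4)[OF T'j zb])
    ultimately show ?case using Suc by (simp add: below_lin(1) diff_lin(1)[OF T])
  qed
  have "e m = 0" unfolding e_def m by (rule comp_lin(1)[OF T'j])
  then show ?thesis using w[of m] by auto
qed

subsection \<open>Restriction to a hyperplane\<close>

definition restr :: "'n set \<Rightarrow> ('n list \<Rightarrow> 'v::complex_vector) \<Rightarrow> 'n list \<Rightarrow> 'v"
  where "restr H \<phi> xs = (if set xs \<subseteq> H then \<phi> xs else 0)"

lemma iota_restr: "iota h (restr H \<phi>) = (if h \<in> H then restr H (iota h \<phi>) else 0)"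
  by (auto simp: iota_def restr_def fun_eq_iff fun_apply)

lemma restr_lin:
  "restr H (\<phi> + \<psi>) = restr H \<phi> + restr H \<psi>" "restr H (\<phi> - \<psi>) = restr H \<phi> - restr H \<psi>"
  "restr H (- \<phi>) = - restr H \<phi>" "restr H 0 = 0" "restr H (c *\<^sub>C \<phi>) = c *\<^sub>C restr H \<phi>"
  by (auto simp: restr_def fun_eq_iff fun_apply scaleC_apply)

lemma restr_comp: "clinear T \<Longrightarrow> restr H (T \<circ> \<phi>) = T \<circ> restr H \<phi>"
  by (auto simp: restr_def fun_eq_iff clinear_0)

lemma restr_alt:
  assumes "cvs.subspace H" "H \<subseteq> N"
  shows "alt N k \<phi> \<Longrightarrow> alt H k (restr H \<phi>)"
proof (induction k arbitrary: \<phi>)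
  case (Suc k)
  show ?case
    using Suc.prems Suc.IH assms cvs.subspace_add[OF assms(1)] cvs.subspace_scale[OF assms(1)]
    by (auto simp: iota_restr restr_lin subset_iff) (simp add: restr_def)
qed (simp add: iota_restr restr_lin)

lemma restr_below: "cvs.subspace H \<Longrightarrow> H \<subseteq> N \<Longrightarrow> below N k \<phi> \<Longrightarrow> below H k (restr H \<phi>)"
  by (cases k) (simp_all add: restr_alt restr_lin)

lemma restr_act_pt:
  assumes "H \<subseteq> N" "\<And>y. y \<in> H \<Longrightarrow> b y \<in> H"
  shows "set xs \<subseteq> H \<Longrightarrow> act N b \<phi> xs = act H b (restr H \<phi>) xs"
proof (induction xs arbitrary: \<phi>)
  case (Cons y ys)
  then have "y \<in> N" "iota (b y) \<phi> ys = iota (b y) (restr H \<phi>) ys"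
    using assms by (auto simp: iota_def restr_def)
  then show ?case using Cons by (simp add: iota_restr)
qed simp

lemma restr_act:
  assumes "cvs.subspace H" "H \<subseteq> N" "linear_on H b" "alt N k \<phi>"
  shows "restr H (act N b \<phi>) = act H b (restr H \<phi>)"
proof
  fix xs
  have "alt H k (act H b (restr H \<phi>))" by (intro act_alt restr_alt) (use assms in auto)
  then have "act H b (restr H \<phi>) xs = 0" if "\<not> set xs \<subseteq> H" using alt_outside that by blast
  then show "restr H (act N b \<phi>) xs = act H b (restr H \<phi>) xs"
    using restr_act_pt[OF assms(2), of b xs \<phi>] assms(3) by (auto simp: restr_def linear_on_def)
qed

lemma restr_diff_pt:
  assumes "H \<subseteq> N" "\<And>x y. x \<in> H \<Longrightarrow> y \<in> H \<Longrightarrow> br x y \<in> H"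
  shows "set xs \<subseteq> H \<Longrightarrow> diff N br \<eta> T \<phi> xs = diff H br \<eta> T (restr H \<phi>) xs"
proof (induction xs arbitrary: \<phi>)
  case (Cons y ys)
  then have "y \<in> N" "y \<in> H" "set ys \<subseteq> H" using assms(1) by auto
  moreover have "act N (br y) \<phi> ys = act H (br y) (restr H \<phi>) ys"
    by (rule restr_act_pt) (use assms calculation in auto)
  moreover have "restr H \<phi> ys = \<phi> ys" using calculation by (simp add: restr_def)
  ultimately show ?case using Cons.IH[of "iota y \<phi>"] by (simp add: iota_restr)
qed simp

lemma restr_diff:
  assumes L: "lie_on H br" and HN: "H \<subseteq> N" and T: "clinear T"
    and \<eta>: "\<And>x y. x \<in> H \<Longrightarrow> y \<in> H \<Longrightarrow> \<eta> (x + y) = \<eta> x + \<eta> y" "\<And>c x. x \<in> H \<Longrightarrow> \<eta> (c *\<^sub>C x) = c * \<eta> x"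
    and \<phi>: "alt N k \<phi>"
  shows "restr H (diff N br \<eta> T \<phi>) = diff H br \<eta> T (restr H \<phi>)"
proof
  fix xs
  have "alt H (Suc k) (diff H br \<eta> T (restr H \<phi>))"
    by (rule diff_alt[OF L T \<eta> restr_alt[OF lie_onD(1)[OF L] HN \<phi>]])
  then have "diff H br \<eta> T (restr H \<phi>) xs = 0" if "\<not> set xs \<subseteq> H" using alt_outside that by blast
  then show "restr H (diff N br \<eta> T \<phi>) xs = diff H br \<eta> T (restr H \<phi>) xs"
    using restr_diff_pt[OF HN, of br xs \<eta> T \<phi>] lie_onD(2)[OF L] by (auto simp: restr_def)
qed

locale hyperplane =
  fixes N :: "'n::complex_vector set" and \<xi> :: "'n \<Rightarrow> complex" and x :: 'n
  assumes N: "cvs.subspace N"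
    and \<xi>_add: "\<And>y z. y \<in> N \<Longrightarrow> z \<in> N \<Longrightarrow> \<xi> (y + z) = \<xi> y + \<xi> z"
    and \<xi>_scale: "\<And>c y. y \<in> N \<Longrightarrow> \<xi> (c *\<^sub>C y) = c * \<xi> y"
    and x: "x \<in> N" "\<xi> x = 1"
begin

definition H :: "'n set" where "H = {y \<in> N. \<xi> y = 0}"

definition hproj :: "'n \<Rightarrow> 'n" where "hproj y = y - \<xi> y *\<^sub>C x"

lemma H: "cvs.subspace H" "H \<subseteq> N"
proof -
  have "\<xi> 0 = 0" using \<xi>_scale[OF x(1), of 0] by simp
  then show "cvs.subspace H"
    using N by (auto simp: H_def cvs.subspace_def \<xi>_add \<xi>_scale)
  show "H \<subseteq> N" by (auto simp: H_def)
qed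

lemma hproj: "y \<in> N \<Longrightarrow> hproj y \<in> H" "y \<in> H \<Longrightarrow> hproj y = y" "hproj x = 0"
proof -
  assume y: "y \<in> N"
  have 1: "y = hproj y + \<xi> y *\<^sub>C x" by (simp add: hproj_def)
  have 2: "hproj y \<in> N"
    unfolding hproj_def by (intro cvs.subspace_diff[OF N] cvs.subspace_scale[OF N] y x)
  have "\<xi> y = \<xi> (hproj y) + \<xi> y * \<xi> x"
    by (subst 1) (simp only: \<xi>_add[OF 2 cvs.subspace_scale[OF N x(1)]] \<xi>_scale[OF x(1)])
  then show "hproj y \<in> H" using 2 x by (simp add: H_def)
qed (simp_all add: hproj_def H_def x scaleC_one)

lemma hproj_lin:
  "y \<in> N \<Longrightarrow> z \<in> N \<Longrightarrow> hproj (y + z) = hproj y + hproj z"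
  "y \<in> N \<Longrightarrow> hproj (c *\<^sub>C y) = c *\<^sub>C hproj y"
  by (simp_all add: hproj_def \<xi>_add \<xi>_scale scaleC_add_left cvs.scale_right_diff_distrib scaleC_scaleC)

lemma iota_split:
  assumes "alt N k \<phi>" "y \<in> N"
  shows "iota y \<phi> = iota (hproj y) \<phi> + \<xi> y *\<^sub>C iota x \<phi>"
proof -
  have "hproj y \<in> N" using hproj(1)[OF assms(2)] H(2) by blast
  then have "iota (hproj y + \<xi> y *\<^sub>C x) \<phi> = iota (hproj y) \<phi> + \<xi> y *\<^sub>C iota x \<phi>"
    using assms(1) x(1) cvs.subspace_scale[OF N x(1)] by (simp add: alt_iota_add alt_iota_scale)
  then show ?thesis by (simp add: hproj_def)
qed

text \<open>
  Contractions with \<open>H\<close> and with \<open>x\<close> suffice, because these span \<open>N\<close>; the hypotheses pass to them since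
  contractions anticommute.
\<close>

lemma form_zero:
  "alt N k \<phi> \<Longrightarrow> restr H \<phi> = 0 \<Longrightarrow> restr H (iota x \<phi>) = 0 \<Longrightarrow> \<phi> = 0"
proof (induction k arbitrary: \<phi>)
  case 0
  have "restr H \<phi> [] = 0" using 0 by (simp add: fun_apply)
  then have "\<phi> [] = 0" by (simp add: restr_def)
  with 0 show ?case by (intro list_fun_eqI[of \<phi> 0]) (simp_all add: zero_fun_apply)
next
  case (Suc k)
  have h: "iota h \<phi> = 0" if "h \<in> H" for h
  proof (rule Suc.IH)
    have hN: "h \<in> N" using that H by blast
    then show "alt N k (iota h \<phi>)" using Suc.prems(1) by simp
    show "restr H (iota h \<phi>) = 0"
      using arg_cong[OF Suc.prems(2), of "iota h"] that by (simp add: iota_restr)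
    have "restr H (iota h (iota x \<phi>)) = 0"
      using arg_cong[OF Suc.prems(3), of "iota h"] that by (simp add: iota_restr)
    then show "restr H (iota x (iota h \<phi>)) = 0"
      using alt_iota_swap[OF N Suc.prems(1) x(1) hN] by (simp add: restr_lin)
  qed
  have x0: "iota x \<phi> = 0"
    by (rule Suc.IH) (use Suc.prems x alt_iota_iota[OF Suc.prems(1) x(1)] in \<open>simp_all add: restr_lin\<close>)
  show ?case
  proof (rule list_fun_eqI)
    show "iota y \<phi> = iota y 0" for y
      using iota_split[OF Suc.prems(1), of y] h[OF hproj(1), of y] x0 alt_iota_outside[OF Suc.prems(1), of y]
      by (cases "y \<in> N") simp_all
  qed (use Suc.prems in \<open>simp add: fun_apply\<close>)
qed

text \<open>
  The form with prescribed restrictions: \<open>p\<^sup>*\<alpha> + \<xi> \<and> p\<^sup>*\<beta>\<close>, where \<open>p\<close> is the projection \<open>hproj\<close>.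
\<close>

fun glue :: "('n list \<Rightarrow> 'v::complex_vector) \<Rightarrow> ('n list \<Rightarrow> 'v) \<Rightarrow> 'n list \<Rightarrow> 'v"
  where "glue \<alpha> \<beta> [] = \<alpha> []"
  | "glue \<alpha> \<beta> (y # ys) = (if y \<in> N
       then glue (iota (hproj y) \<alpha> + \<xi> y *\<^sub>C \<beta>) (- iota (hproj y) \<beta>) ys else 0)"

lemma iota_glue: "iota y (glue \<alpha> \<beta>) = (if y \<in> N
    then glue (iota (hproj y) \<alpha> + \<xi> y *\<^sub>C \<beta>) (- iota (hproj y) \<beta>) else 0)"
  by (simp add: iota_def fun_eq_iff fun_apply)

lemma glue_add_pt: "glue (\<alpha> + \<alpha>') (\<beta> + \<beta>') xs = glue \<alpha> \<beta> xs + glue \<alpha>' \<beta>' xs"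
proof (induction xs arbitrary: \<alpha> \<beta> \<alpha>' \<beta>')
  case (Cons y ys)
  then show ?case
    using Cons.IH[of "iota (hproj y) \<alpha> + \<xi> y *\<^sub>C \<beta>" "iota (hproj y) \<alpha>' + \<xi> y *\<^sub>C \<beta>'"
        "- iota (hproj y) \<beta>" "- iota (hproj y) \<beta>'"]
    by (simp add: scaleC_add_right algebra_simps)
qed (simp add: fun_apply)

lemma glue_scale_pt: "glue (c *\<^sub>C \<alpha>) (c *\<^sub>C \<beta>) xs = c *\<^sub>C glue \<alpha> \<beta> xs"
proof (induction xs arbitrary: \<alpha> \<beta>)
  case (Cons y ys)
  then show ?case
    using Cons.IH[of "iota (hproj y) \<alpha> + \<xi> y *\<^sub>C \<beta>" "- iota (hproj y) \<beta>"]
    by (simp add: scaleC_add_right scaleC_scaleC mult.commute)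
qed (simp add: scaleC_apply)

lemma glue_lin: "glue (\<alpha> + \<alpha>') (\<beta> + \<beta>') = glue \<alpha> \<beta> + glue \<alpha>' \<beta>'"
  "glue (c *\<^sub>C \<alpha>) (c *\<^sub>C \<beta>) = c *\<^sub>C glue \<alpha> \<beta>"
  by (simp_all add: fun_eq_iff glue_add_pt glue_scale_pt fun_apply scaleC_apply)

lemma glue_zero: "glue 0 0 = 0"
  using glue_lin(2)[of 0 0 0] by simp

lemma glue_alt: "alt H k \<alpha> \<Longrightarrow> below H k \<beta> \<Longrightarrow> alt N k (glue \<alpha> \<beta>)"
proof (induction k arbitrary: \<alpha> \<beta>)
  case 0
  then show ?case using alt_iota_zero by (auto simp: iota_glue glue_zero)
next
  case (Suc k)
  have \<alpha>: "alt H (Suc k) \<alpha>" and \<beta>: "alt H k \<beta>" using Suc.prems by simp_all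
  have "iota (y + z) (glue \<alpha> \<beta>) = iota y (glue \<alpha> \<beta>) + iota z (glue \<alpha> \<beta>)"
    if "y \<in> N" "z \<in> N" for y z
  proof -
    have "iota (hproj y + hproj z) \<alpha> + (\<xi> y + \<xi> z) *\<^sub>C \<beta>
        = (iota (hproj y) \<alpha> + \<xi> y *\<^sub>C \<beta>) + (iota (hproj z) \<alpha> + \<xi> z *\<^sub>C \<beta>)"
      "- iota (hproj y + hproj z) \<beta> = - iota (hproj y) \<beta> + - iota (hproj z) \<beta>"
      using alt_iota_add[OF \<alpha>] alt_iota_add[OF \<beta>] hproj(1) that
      by (simp_all add: scaleC_add_left algebra_simps)
    then show ?thesis
      using that by (simp add: iota_glue cvs.subspace_add[OF N] hproj_lin \<xi>_add glue_lin(1)[symmetric])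
  qed
  moreover have "iota (c *\<^sub>C y) (glue \<alpha> \<beta>) = c *\<^sub>C iota y (glue \<alpha> \<beta>)" if "y \<in> N" for c y
  proof -
    have "iota (c *\<^sub>C hproj y) \<alpha> + (c * \<xi> y) *\<^sub>C \<beta> = c *\<^sub>C (iota (hproj y) \<alpha> + \<xi> y *\<^sub>C \<beta>)"
      "- iota (c *\<^sub>C hproj y) \<beta> = c *\<^sub>C (- iota (hproj y) \<beta>)"
      using alt_iota_scale[OF \<alpha>] alt_iota_scale[OF \<beta>] hproj(1) that
      by (simp_all add: scaleC_add_right scaleC_scaleC)
    then show ?thesis
      using that
      by (simp add: iota_glue cvs.subspace_scale[OF N] hproj_lin \<xi>_scale glue_lin(2)[symmetric]
          del: cvs.scale_minus_right)
  qed
  moreover have "alt N k (iota y (glue \<alpha> \<beta>))" if "y \<in> N" for y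
  proof -
    have "below H k (- iota (hproj y) \<beta>)"
      by (rule below_lin(3)[OF below_iota[OF \<beta> hproj(1)[OF that]]])
    moreover have "alt H k (iota (hproj y) \<alpha> + \<xi> y *\<^sub>C \<beta>)"
      using \<alpha> \<beta> hproj(1)[OF that] by (simp add: alt_add alt_scale)
    ultimately show ?thesis using Suc.IH that by (simp add: iota_glue)
  qed
  moreover have "iota y (iota y (glue \<alpha> \<beta>)) = 0" if "y \<in> N" for y
    using that alt_iota_iota[OF \<alpha> hproj(1)[OF that]] alt_iota_iota[OF \<beta> hproj(1)[OF that]]
    by (simp add: iota_glue glue_zero)
  ultimately show ?case using \<alpha> by (simp add: iota_glue)
qed

lemma glue_H_pt: "set xs \<subseteq> H \<Longrightarrow> glue \<alpha> \<beta> xs = \<alpha> xs"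
proof (induction xs arbitrary: \<alpha> \<beta>)
  case (Cons y ys)
  then have "y \<in> H" "y \<in> N" "\<xi> y = 0" by (auto simp: H_def)
  then show ?case using Cons by (simp add: hproj(2) iota_def)
qed simp

lemma restr_glue: "alt H k \<alpha> \<Longrightarrow> restr H (glue \<alpha> \<beta>) = \<alpha>"
  by (rule ext) (use alt_outside in \<open>fastforce simp: restr_def glue_H_pt\<close>)

lemma restr_iota_glue:
  assumes "alt H k \<alpha>" "below H k \<beta>"
  shows "restr H (iota x (glue \<alpha> \<beta>)) = \<beta>"
proof -
  have "iota 0 \<alpha> = 0" "iota 0 \<beta> = 0"
    using alt_iota_zero assms(1) below_alt[OF assms(2)] cvs.subspace_0[OF H(1)] by blast+
  then have "iota x (glue \<alpha> \<beta>) = glue \<beta> 0" using x by (simp add: iota_glue hproj scaleC_one)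
  then show ?thesis using restr_glue[OF below_alt[OF assms(2)]] by simp
qed

lemma dim_hyperplane:
  assumes "finite_dim N"
  shows "cvs.dim N = Suc (cvs.dim H)"
proof -
  obtain B where B: "B \<subseteq> H" "cvs.independent B" "H \<subseteq> cvs.span B" "card B = cvs.dim H"
    using cvs.basis_exists[of H] by metis
  have span_B: "cvs.span B = H" using B H(1) by (meson cvs.span_minimal subset_antisym)
  obtain S where "finite S" "N \<subseteq> cvs.span S" using assms by (auto simp: finite_dim_def)
  then have fin: "finite B"
    using cvs.independent_span_bound[of S B] B H(2) by blast
  have "x \<notin> H" using x by (simp add: H_def)
  then have x_B: "x \<notin> cvs.span B" "x \<notin> B" using span_B B(1) by auto
  have "cvs.span (insert x B) = cvs.span N"
  proof (rule subset_antisym)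
    show "cvs.span (insert x B) \<subseteq> cvs.span N" using B(1) H(2) x by (intro cvs.span_mono) auto
    have "y \<in> cvs.span (insert x B)" if "y \<in> N" for y
    proof -
      have "hproj y \<in> cvs.span B" using hproj(1)[OF that] span_B by simp
      then show ?thesis unfolding hproj_def cvs.span_breakdown_eq by blast
    qed
    then have "N \<subseteq> cvs.span (insert x B)" by blast
    then show "cvs.span N \<subseteq> cvs.span (insert x B)" by (simp add: cvs.span_minimal)
  qed
  then have "cvs.dim N = card (insert x B)"
    using cvs.independent_insertI[OF x_B(1) B(2)] cvs.dim_eq_card by metis
  then show ?thesis using fin x_B(2) B(4) by simp
qed

lemma finite_dim_H: "finite_dim N \<Longrightarrow> finite_dim H"
  using H(2) unfolding finite_dim_def by blast

end

lemma nonzero_hyperplane: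
  assumes "cvs.subspace N" "cvs.subspace S" "y \<in> N" "y \<notin> S"
  obtains \<xi> x where "hyperplane N \<xi> x" "clinear \<xi>" "\<And>z. z \<in> S \<Longrightarrow> \<xi> z = 0"
proof (rule separating_functional[OF assms(2,4)])
  fix \<xi> :: "'a \<Rightarrow> complex"
  assume \<xi>: "clinear \<xi>" "\<And>z. z \<in> S \<Longrightarrow> \<xi> z = 0" "\<xi> y = 1"
  have "hyperplane N \<xi> y"
    using assms \<xi> by unfold_locales (auto simp: clinear_iff scaleC_complex_def)
  then show ?thesis using that \<xi>(1,2) by blast
qed

text \<open>
  By induction on the dimension: the two restrictions that determine a form live on a hyperplane, in
  degrees \<open>k\<close> and \<open>k - 1\<close>.
\<close>

lemma alt_above_dim:
  "cvs.subspace N \<Longrightarrow> finite_dim N \<Longrightarrow> cvs.dim N < k \<Longrightarrow> alt N k \<phi> \<Longrightarrow> \<phi> = 0"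
proof (induction "cvs.dim N" arbitrary: N k \<phi> rule: less_induct)
  case less
  show ?case
  proof (cases "N = {0}")
    case True
    obtain j where k: "k = Suc j" using less.prems(3) by (cases k) auto
    show ?thesis
    proof (rule list_fun_eqI)
      show "iota y \<phi> = iota y 0" for y
        using alt_iota_zero[OF less.prems(4)] alt_iota_outside[OF less.prems(4), of y] True
        by (cases "y = 0") auto
    qed (use less.prems(4) k in \<open>simp add: fun_apply\<close>)
  next
    case False
    then obtain y where y: "y \<in> N" "y \<notin> {0}" using cvs.subspace_0[OF less.prems(1)] by blast
    obtain \<xi> x where "hyperplane N \<xi> x"
      using nonzero_hyperplane[OF less.prems(1) _ y] cvs.subspace_single_0 by blast
    then interpret hyperplane N \<xi> x .
    have d: "cvs.dim N = Suc (cvs.dim H)" using dim_hyperplane less.prems(2) by blast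
    note IH = less.hyps[OF _ H(1) finite_dim_H[OF less.prems(2)]]
    have "restr H \<phi> = 0"
      by (rule IH[OF _ _ restr_alt[OF H less.prems(4)]]) (use d less.prems(3) in auto)
    moreover have "restr H (iota x \<phi>) = 0"
      by (rule IH[OF _ _ restr_alt[OF H alt_iota[OF less.prems(4) x(1)]]]) (use d less.prems(3) in auto)
    ultimately show ?thesis by (rule form_zero[OF less.prems(4)])
  qed
qed

subsection \<open>Non-vanishing\<close>

definition nonzero_coh :: "'n::complex_vector set \<Rightarrow> ('n \<Rightarrow> 'n \<Rightarrow> 'n) \<Rightarrow> ('n \<Rightarrow> complex)
    \<Rightarrow> ('v::complex_vector \<Rightarrow> 'v) \<Rightarrow> nat \<Rightarrow> bool"
  where "nonzero_coh N br \<eta> T k \<longleftrightarrow>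
    (\<exists>z. alt N k z \<and> diff N br \<eta> T z = 0 \<and> \<not> (\<exists>w. below N k w \<and> diff N br \<eta> T w = z))"

lemma nonzero_coh_eq:
  assumes "\<And>y v. y \<in> N \<Longrightarrow> \<eta> y *\<^sub>C T v = \<eta>' y *\<^sub>C T' v"
  shows "nonzero_coh N br \<eta> T k \<longleftrightarrow> nonzero_coh N br \<eta>' T' k"
  unfolding nonzero_coh_def using diff_eq[of N \<eta> T \<eta>' T' br, OF assms] by simp

abbreviation diff0 :: "'n::complex_vector set \<Rightarrow> ('n \<Rightarrow> 'n \<Rightarrow> 'n)
    \<Rightarrow> ('n list \<Rightarrow> 'v::complex_vector) \<Rightarrow> 'n list \<Rightarrow> 'v"
  where "diff0 N br \<equiv> diff N br (\<lambda>_. 0) (\<lambda>_. 0)"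

abbreviation nonzero_coh0 :: "'n::complex_vector set \<Rightarrow> ('n \<Rightarrow> 'n \<Rightarrow> 'n) \<Rightarrow> nat \<Rightarrow> bool"
  where "nonzero_coh0 N br \<equiv> nonzero_coh N br (\<lambda>_. 0) (\<lambda>_. 0 :: complex)"

lemma clinear_zero: "clinear (\<lambda>_. 0)"
  by (simp add: clinear_iff)

lemma clinear_multiples: "clinear (\<lambda>c. c *\<^sub>C v)"
  by (simp add: clinear_iff scaleC_add_left scaleC_complex_def scaleC_scaleC)

lemma diff0_comp: "clinear S \<Longrightarrow> diff0 N br (S \<circ> \<phi>) = S \<circ> diff0 N br \<phi>"
  by (rule diff_comp) (simp_all add: clinear_0)

locale lie_hyperplane = hyperplane +
  fixes br :: "'a \<Rightarrow> 'a \<Rightarrow> 'a" and M :: nat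
  assumes L: "lie_on N br"
    and \<xi>_br: "\<And>y z. y \<in> N \<Longrightarrow> z \<in> N \<Longrightarrow> \<xi> (br y z) = 0"
    and ad_nil: "\<And>y. y \<in> N \<Longrightarrow> (br x ^^ M) y = 0"
begin

lemma br_H: "y \<in> N \<Longrightarrow> z \<in> N \<Longrightarrow> br y z \<in> H"
  using lie_onD(2)[OF L] \<xi>_br by (simp add: H_def)

lemma lie_on_H: "lie_on H br"
proof -
  have hN: "y \<in> N" if "y \<in> H" for y using that H(2) by blast
  have jacobi: "br y (br z w) = br (br y z) w + br z (br y w)"
    if "y \<in> N" "z \<in> N" "w \<in> N" for y z w
    using lie_onD(4)[OF L that(1)] that(2,3) by (simp add: derivation_on_def)
  show ?thesis
    unfolding lie_on_def bilinear_on_def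
    by (intro conjI ballI allI H(1) br_H jacobi lie_onD(3,6-9)[OF L] hN)
qed

lemma derivation_H: "derivation_on H br (br x)"
proof -
  have "y \<in> N" if "y \<in> H" for y using that H(2) by blast
  then show ?thesis
    using lie_onD(4)[OF L x(1)] br_H[OF x(1)] unfolding derivation_on_def linear_on_def by blast
qed

lemma linear_H: "linear_on H (br x)"
  using derivation_H by (simp add: derivation_on_def)

abbreviation "LH \<equiv> act H (br x)"
abbreviation "dH \<equiv> diff0 H br"

lemma LH_nil:
  obtains m where "\<And>\<phi> :: 'a list \<Rightarrow> 'v::complex_vector. alt H k \<phi> \<Longrightarrow> (LH ^^ m) \<phi> = 0"
proof (rule act_nilpotent[OF H(1) linear_H, where k = k])
  show "(br x ^^ M) y = 0" if "y \<in> H" for y using ad_nil that H(2) by blast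
qed (rule that)

lemma dH_LH: "alt H k \<phi> \<Longrightarrow> dH (LH \<phi>) = LH (dH \<phi>)"
  by (rule diff_act[OF lie_on_H clinear_zero derivation_H]) simp_all

lemma diff_H: "clinear T \<Longrightarrow> alt N k \<phi> \<Longrightarrow> restr H (diff N br \<xi> T \<phi>) = dH (restr H \<phi>)"
proof -
  assume T: "clinear T" "alt N k \<phi>"
  have "restr H (diff N br \<xi> T \<phi>) = diff H br \<xi> T (restr H \<phi>)"
    by (rule restr_diff[OF lie_on_H H(2) T(1) _ _ T(2)]) (use H(2) \<xi>_add \<xi>_scale in blast)+
  also have "\<dots> = dH (restr H \<phi>)"
    by (subst diff_eq[of H \<xi> T "\<lambda>_. 0" "\<lambda>_. 0"]) (simp_all add: H_def)
  finally show ?thesis .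
qed

lemma iota_x_diff:
  assumes "clinear T" "alt N k \<phi>"
  shows "restr H (iota x (diff N br \<xi> T \<phi>))
      = (T \<circ> restr H \<phi>) - LH (restr H \<phi>) - dH (restr H (iota x \<phi>))"
  using x diff_H[OF assms(1) alt_iota[OF assms(2) x(1)]] restr_act[OF H linear_H assms(2)]
  by (simp add: iota_diff restr_lin restr_comp[OF assms(1)] scaleC_one)

text \<open>
  On a non-zero space a nilpotent operator has non-zero kernel and non-zero cokernel.  This is
  applied to the operator that \<open>LH\<close> induces on the cohomology of \<open>H\<close>.
\<close>

lemma kernel_class:
  assumes "nonzero_coh0 H br k"
  obtains z w :: "'a list \<Rightarrow> complex" where "alt H k z" "dH z = 0"
    "\<not> (\<exists>w. below H k w \<and> dH w = z)" "below H k w" "dH w = LH z"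
proof -
  obtain z0 :: "'a list \<Rightarrow> complex" where z0: "alt H k z0" "dH z0 = 0"
    "\<not> (\<exists>w. below H k w \<and> dH w = z0)"
    using assms by (auto simp: nonzero_coh_def)
  let ?B = "\<lambda>z :: 'a list \<Rightarrow> complex. \<exists>w. below H k w \<and> dH w = z"
  obtain m where "(LH ^^ m) z0 = 0" using LH_nil[of k] z0(1) by metis
  then have "?B ((LH ^^ m) z0)" by (metis below_lin(5) diff_lin(3)[OF clinear_zero])
  define j where "j = (LEAST j. ?B ((LH ^^ j) z0))"
  have j: "?B ((LH ^^ j) z0)"
    unfolding j_def by (rule LeastI) fact
  have "j \<noteq> 0"
  proof
    assume "j = 0"
    with j z0(3) show False by simp
  qed
  then obtain i where i: "j = Suc i" by (cases j) auto
  then have ni: "\<not> ?B ((LH ^^ i) z0)" using not_less_Least[of i "\<lambda>j. ?B ((LH ^^ j) z0)"] by (simp add: j_def)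
  have a: "alt H k ((LH ^^ i) z0) \<and> dH ((LH ^^ i) z0) = 0" for i
    by (induction i) (use z0 in \<open>simp_all add: act_alt[OF H(1) linear_H] dH_LH[of k]\<close>)
  obtain w where "below H k w" "dH w = LH ((LH ^^ i) z0)" using j i by auto
  with a[of i] ni show ?thesis by (intro that[of "(LH ^^ i) z0" w]) auto
qed

lemma cokernel_class:
  assumes "nonzero_coh0 H br k"
  shows "\<exists>z :: 'a list \<Rightarrow> complex. alt H k z \<and> dH z = 0 \<and>
    \<not> (\<exists>u w. alt H k u \<and> dH u = 0 \<and> below H k w \<and> z = LH u + dH w)"
proof (rule ccontr)
  assume contra: "\<not> ?thesis"
  have no: "\<exists>u w. alt H k u \<and> dH u = 0 \<and> below H k w \<and> z = LH u + dH w"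
    if "alt H k z" "dH z = 0" for z :: "'a list \<Rightarrow> complex"
    using contra that by blast
  obtain z0 :: "'a list \<Rightarrow> complex" where z0: "alt H k z0" "dH z0 = 0"
    "\<not> (\<exists>w. below H k w \<and> dH w = z0)"
    using assms by (auto simp: nonzero_coh_def)
  have a: "alt H (k - 1) ((LH ^^ i) w) \<and> below H k ((LH ^^ i) w) \<and> dH ((LH ^^ i) w) = (LH ^^ i) (dH w)"
    if "below H k w" for i and w :: "'a list \<Rightarrow> complex"
    by (induction i) (use that in \<open>simp_all add: act_alt[OF H(1) linear_H] below_alt[simplified]
        below_act[OF H(1) linear_H] dH_LH[of "k - 1"]\<close>)
  have lin: "(LH ^^ i) (\<phi> + \<psi>) = (LH ^^ i) \<phi> + (LH ^^ i) \<psi>" for i and \<phi> \<psi> :: "'a list \<Rightarrow> complex"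
    by (induction i) simp_all
  have "\<exists>u w. alt H k u \<and> dH u = 0 \<and> below H k w \<and> z0 = (LH ^^ i) u + dH w" for i
  proof (induction i)
    case 0
    show ?case
      by (intro exI[of _ z0] exI[of _ 0]) (simp add: z0 below_lin(5) diff_lin(3)[OF clinear_zero])
  next
    case (Suc i)
    then obtain u w where u: "alt H k u" "dH u = 0" "below H k w" "z0 = (LH ^^ i) u + dH w" by blast
    obtain u' w' where u': "alt H k u'" "dH u' = 0" "below H k w'" "u = LH u' + dH w'"
      using no[OF u(1,2)] by blast
    have "z0 = (LH ^^ Suc i) u' + dH ((LH ^^ i) w' + w)"
      using u(4) u'(4) a[OF u'(3), of i] lin[of i]
      by (simp add: funpow_swap1 add.assoc diff_lin(1)[OF clinear_zero])
    moreover have "below H k ((LH ^^ i) w' + w)" using a[OF u'(3)] u(3) below_lin(1) by blast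
    ultimately show ?case using u'(1,2) by blast
  qed
  moreover obtain m where "\<And>\<phi> :: 'a list \<Rightarrow> complex. alt H k \<phi> \<Longrightarrow> (LH ^^ m) \<phi> = 0"
    using LH_nil[of k] by metis
  ultimately have "\<exists>w. below H k w \<and> z0 = dH w" by (metis add_0)
  then show False using z0(3) by metis
qed

text \<open>
  Write forms on \<open>N\<close> as pairs \<open>(\<alpha>, \<beta>)\<close> of forms on \<open>H\<close>, the restrictions of the form and of its
  contraction with \<open>x\<close>; the differential is \<open>(\<alpha>, \<beta>) \<mapsto> (d\<alpha>, (T - LH)\<alpha> - d\<beta>)\<close>.  A class on \<open>H\<close> killed
  by \<open>T - LH\<close> extends to \<open>N\<close>, and a class outside the image of \<open>T - LH\<close> gives the class of
  \<open>(0, \<beta>)\<close>.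
\<close>

lemma diff_eq_0:
  assumes "clinear T" "alt N k \<phi>" "dH (restr H \<phi>) = 0"
    "(T \<circ> restr H \<phi>) - LH (restr H \<phi>) - dH (restr H (iota x \<phi>)) = 0"
  shows "diff N br \<xi> T \<phi> = 0"
proof (rule form_zero)
  show "alt N (Suc k) (diff N br \<xi> T \<phi>)"
    by (rule diff_alt[OF L assms(1) \<xi>_add \<xi>_scale assms(2)])
qed (use assms diff_H iota_x_diff in metis)+

text \<open>
  The class is that of \<open>z \<otimes> v0\<close> for a class \<open>z\<close> killed by \<open>LH\<close>; as \<open>T v0 = 0\<close>, it is killed by
  \<open>T - LH\<close> too.  A functional with value \<open>1\<close> at \<open>v0\<close> reduces its non-vanishing to that of \<open>z\<close>.
\<close>

lemma coh_from_kernel: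
  assumes T: "clinear T" and v0: "v0 \<noteq> (0::'v::complex_vector)" "T v0 = 0"
    and coh: "nonzero_coh0 H br k"
  shows "nonzero_coh N br \<xi> T k"
proof -
  obtain z w :: "'a list \<Rightarrow> complex" where z: "alt H k z" "dH z = 0"
    "\<not> (\<exists>w. below H k w \<and> dH w = z)" and w: "below H k w" "dH w = LH z"
    using kernel_class[OF coh] by metis
  define s where "s c = c *\<^sub>C v0" for c
  have s: "clinear s" unfolding s_def[abs_def] by (rule clinear_multiples)
  obtain g :: "'v \<Rightarrow> complex" where g: "clinear g" "g v0 = 1"
    using separating_functional[OF cvs.subspace_single_0, of v0] v0(1) by auto
  define \<phi> where "\<phi> = glue (s \<circ> z) (- (s \<circ> w))"
  have \<alpha>: "alt H k (s \<circ> z)" and \<beta>: "below H k (- (s \<circ> w))"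
    using z(1) w(1) s by (simp_all add: alt_comp below_lin)
  have \<phi>: "alt N k \<phi>" "restr H \<phi> = s \<circ> z" "restr H (iota x \<phi>) = - (s \<circ> w)"
    unfolding \<phi>_def by (rule glue_alt[OF \<alpha> \<beta>] restr_glue[OF \<alpha>] restr_iota_glue[OF \<alpha> \<beta>])+
  have "T \<circ> (s \<circ> z) = 0"
    using T v0(2) by (simp add: fun_eq_iff s_def fun_apply clinear_iff)
  then have "diff N br \<xi> T \<phi> = 0"
    by (intro diff_eq_0[OF T \<phi>(1)])
      (simp_all add: \<phi> diff0_comp[OF s] z(2) w(2) act_comp[OF s] diff_lin(4)[OF clinear_zero] s)
  moreover have False if a: "below N k a" "diff N br \<xi> T a = \<phi>" for a
  proof -
    have "s \<circ> z = dH (restr H a)"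
      using diff_H[OF T below_alt[OF a(1)]] a(2) \<phi>(2) by simp
    then have "g \<circ> (s \<circ> z) = dH (g \<circ> restr H a)" using diff0_comp[OF g(1)] by metis
    moreover have "g \<circ> (s \<circ> z) = z"
      using g by (simp add: fun_eq_iff s_def clinear_iff scaleC_complex_def)
    moreover have "below H k (g \<circ> restr H a)" by (rule below_lin(4)[OF g(1) restr_below[OF H a(1)]])
    ultimately show False using z(3) by metis
  qed
  ultimately show ?thesis unfolding nonzero_coh_def using \<phi>(1) by blast
qed

text \<open>
  The class is that of the pair \<open>(0, z \<otimes> v1)\<close>.  The functional \<open>f\<close> kills the image of \<open>T\<close>, so that
  applying it to a primitive would put \<open>z\<close> into the image of \<open>LH\<close> up to a coboundary.
\<close>

lemma coh_from_cokernel: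
  assumes T: "clinear T" and f: "clinear f" "\<And>v. f (T v) = 0" "f v1 = (1::complex)"
    and coh: "nonzero_coh0 H br k"
  shows "nonzero_coh N br \<xi> T (Suc k)"
proof -
  obtain z :: "'a list \<Rightarrow> complex" where z: "alt H k z" "dH z = 0"
    "\<not> (\<exists>u w. alt H k u \<and> dH u = 0 \<and> below H k w \<and> z = LH u + dH w)"
    using cokernel_class[OF coh] by blast
  define s where "s c = c *\<^sub>C v1" for c
  have s: "clinear s" unfolding s_def[abs_def] by (rule clinear_multiples)
  define \<phi> where "\<phi> = glue 0 (s \<circ> z)"
  have \<beta>: "below H (Suc k) (s \<circ> z)" using z(1) s by (simp add: alt_comp)
  have \<phi>: "alt N (Suc k) \<phi>" "restr H \<phi> = 0" "restr H (iota x \<phi>) = s \<circ> z"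
    unfolding \<phi>_def by (rule glue_alt[OF alt_zero \<beta>] restr_glue[OF alt_zero] restr_iota_glue[OF alt_zero \<beta>])+
  have "diff N br \<xi> T \<phi> = 0"
    by (intro diff_eq_0[OF T \<phi>(1)])
      (simp_all add: \<phi> diff0_comp[OF s] z(2) diff_lin(3)[OF clinear_zero] s T)
  moreover have False if a: "alt N k a" "diff N br \<xi> T a = \<phi>" for a
  proof -
    let ?r = "restr H a" and ?i = "restr H (iota x a)"
    have r: "alt H k ?r" "below H k ?i" "dH ?r = 0"
      using restr_alt[OF H a(1)] restr_below[OF H below_iota[OF a(1) x(1)]] diff_H[OF T a(1)] a(2) \<phi>(2)
      by simp_all
    have "s \<circ> z = (T \<circ> ?r) - LH ?r - dH ?i"
      using iota_x_diff[OF T a(1)] a(2) \<phi>(3) by simp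
    then have "f \<circ> (s \<circ> z) = (f \<circ> (T \<circ> ?r)) - LH (f \<circ> ?r) - dH (f \<circ> ?i)"
      using comp_lin(5)[OF f(1)] act_comp[OF f(1)] diff0_comp[OF f(1)] by metis
    moreover have "f \<circ> (s \<circ> z) = z"
      using f by (simp add: fun_eq_iff s_def clinear_iff scaleC_complex_def)
    moreover have "f \<circ> (T \<circ> ?r) = 0" using f(2) by (simp add: fun_eq_iff fun_apply)
    ultimately have "z = LH (- (f \<circ> ?r)) + dH (- (f \<circ> ?i))"
      by (simp add: diff_lin(4)[OF clinear_zero])
    moreover have "alt H k (- (f \<circ> ?r))" "below H k (- (f \<circ> ?i))"
      using r f(1) by (simp_all add: alt_minus alt_comp below_lin)
    moreover have "dH (- (f \<circ> ?r)) = 0"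
      using r(3) f(1) by (simp add: diff_lin(4)[OF clinear_zero] diff0_comp)
    ultimately show False using z(3) by metis
  qed
  ultimately show ?thesis unfolding nonzero_coh_def using \<phi>(1) by auto
qed

lemma coh_hyperplane:
  assumes "finite_dim N" "clinear T" "v0 \<noteq> (0::'v::complex_vector)" "T v0 = 0"
    and "clinear f" "\<And>v. f (T v) = 0" "f v1 = (1::complex)"
    and coh: "\<And>k. k \<le> cvs.dim H \<Longrightarrow> nonzero_coh0 H br k" and "k \<le> cvs.dim N"
  shows "nonzero_coh N br \<xi> T k"
proof (cases "k \<le> cvs.dim H")
  case True
  then show ?thesis using coh_from_kernel assms by blast
next
  case False
  then have "k = Suc (cvs.dim H)" using dim_hyperplane assms(1,9) by simp
  then show ?thesis using coh_from_cokernel assms by blast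
qed

end

text \<open>Nilpotency in terms of a central filtration, which subalgebras inherit by intersection.\<close>

definition nilpotent_lie :: "'n::complex_vector set \<Rightarrow> ('n \<Rightarrow> 'n \<Rightarrow> 'n) \<Rightarrow> bool"
  where "nilpotent_lie N br \<longleftrightarrow> lie_on N br \<and> (\<exists>F c. F 0 = N \<and> F c = {0} \<and>
    (\<forall>i. cvs.subspace (F i) \<and> F (Suc i) \<subseteq> F i \<and> (\<forall>y\<in>N. \<forall>z\<in>F i. br y z \<in> F (Suc i))))"

lemma nilpotent_lie_ad:
  assumes "nilpotent_lie N br"
  obtains M where "\<And>x y. x \<in> N \<Longrightarrow> y \<in> N \<Longrightarrow> (br x ^^ M) y = 0"
proof -
  obtain F c where F: "F 0 = N" "F c = {0}" "\<And>i y z. y \<in> N \<Longrightarrow> z \<in> F i \<Longrightarrow> br y z \<in> F (Suc i)"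
    using assms by (auto simp: nilpotent_lie_def)
  have "(br x ^^ i) y \<in> F i" if "x \<in> N" "y \<in> N" for i x y
    by (induction i) (use F that in auto)
  then show ?thesis using that F(2) by blast
qed

text \<open>The last step of the filtration that is all of \<open>N\<close> shows that \<open>[N, N]\<close> is a proper subspace.\<close>

lemma nilpotent_lie_hyperplane:
  assumes nil: "nilpotent_lie N br" and "N \<noteq> {0}"
  obtains \<xi> x where "hyperplane N \<xi> x" "\<And>y z. y \<in> N \<Longrightarrow> z \<in> N \<Longrightarrow> \<xi> (br y z) = 0"
proof -
  obtain F c where F: "F 0 = N" "F c = {0}" "\<And>i. cvs.subspace (F i)" "\<And>i. F (Suc i) \<subseteq> F i"
    "\<And>i y z. y \<in> N \<Longrightarrow> z \<in> F i \<Longrightarrow> br y z \<in> F (Suc i)"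
    using nil by (auto simp: nilpotent_lie_def)
  define j where "j = (LEAST j. F j \<noteq> N)"
  have j: "F j \<noteq> N" unfolding j_def by (rule LeastI[of _ c]) (use F(2) assms(2) in simp)
  then obtain i where i: "j = Suc i" using F(1) by (cases j) auto
  then have Fi: "F i = N" using not_less_Least[of i "\<lambda>j. F j \<noteq> N"] by (auto simp: j_def)
  have "\<not> N \<subseteq> F j" using j F(4)[of i] i Fi by blast
  then obtain y where "y \<in> N" "y \<notin> F j" by blast
  then show ?thesis
    using nonzero_hyperplane[OF _ F(3)] F(5)[of _ _ i] Fi i that F(1,3) by metis
qed

lemma nilpotent_lie_H:
  assumes "nilpotent_lie N br" "lie_hyperplane N \<xi> x br M"
  shows "nilpotent_lie (hyperplane.H N \<xi>) br"
proof -
  interpret lie_hyperplane N \<xi> x br M by fact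
  obtain F c where F: "F 0 = N" "F c = {0}" "\<And>i. cvs.subspace (F i)" "\<And>i. F (Suc i) \<subseteq> F i"
    "\<And>i y z. y \<in> N \<Longrightarrow> z \<in> F i \<Longrightarrow> br y z \<in> F (Suc i)"
    using assms(1) by (auto simp: nilpotent_lie_def)
  have 1: "br y z \<in> F (Suc i) \<inter> H" if "y \<in> H" "z \<in> F i \<inter> H" for i y z
    using that F(5) br_H H(2) by blast
  have 2: "F 0 \<inter> H = H" "F c \<inter> H = {0}" "F (Suc i) \<inter> H \<subseteq> F i \<inter> H" for i
    using F(1,2) H(2) cvs.subspace_0[OF H(1)] Int_mono[OF F(4)[of i] order_refl[of H]]
    by (simp_all add: Int_absorb1)
  show ?thesis
    unfolding nilpotent_lie_def
  proof (rule conjI[OF lie_on_H], rule exI[of _ "\<lambda>i. F i \<inter> H"], rule exI[of _ c])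
    show "F 0 \<inter> H = H \<and> F c \<inter> H = {0} \<and> (\<forall>i. cvs.subspace (F i \<inter> H) \<and>
        F (Suc i) \<inter> H \<subseteq> F i \<inter> H \<and> (\<forall>y\<in>H. \<forall>z\<in>F i \<inter> H. br y z \<in> F (Suc i) \<inter> H))"
      by (intro conjI allI ballI 1 2 cvs.subspace_inter[OF F(3) H(1)])
  qed
qed

lemma dim_zero: "cvs.dim {0 :: 'a::complex_vector} = 0"
  using cvs.dim_eq_card[of "{}" "{0}"] cvs.independent_empty by simp

lemma coh_zero_algebra:
  assumes "N = {0}" "v0 \<noteq> (0::'v::complex_vector)" "br 0 0 = 0" "\<eta> 0 = 0"
  shows "nonzero_coh N br \<eta> (T :: 'v \<Rightarrow> 'v) 0"
proof -
  let ?z = "\<lambda>xs :: 'a list. if xs = [] then v0 else 0"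
  have i: "iota x ?z = 0" for x by (simp add: iota_def fun_eq_iff fun_apply)
  have d: "diff N br \<eta> T \<phi> = 0" if "alt N 0 \<phi>" for \<phi> :: "'a list \<Rightarrow> 'v"
  proof -
    have "diff N br \<eta> T \<phi> xs = 0" for xs
      using that
      by (induction xs arbitrary: \<phi>) (use assms in \<open>auto simp: act_alt_0 fun_apply\<close>)
    then show ?thesis by (simp add: fun_eq_iff fun_apply)
  qed
  have "?z \<noteq> 0" using assms(2) by (auto simp: fun_eq_iff fun_apply)
  then show ?thesis
    unfolding nonzero_coh_def using i d[of ?z] d[of 0] by (intro exI[of _ ?z]) auto
qed

text \<open>
  Non-vanishing for trivial coefficients follows by induction on the dimension, and one further
  step, with \<open>H\<close> the kernel of \<open>\<eta>\<close>, gives the general case.  If \<open>\<eta> = 0\<close>, the module is trivial and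
  any hyperplane that contains \<open>[N, N]\<close> will do.
\<close>

lemma coh0_nonzero:
  "nilpotent_lie N br \<Longrightarrow> finite_dim N \<Longrightarrow> k \<le> cvs.dim N \<Longrightarrow> nonzero_coh0 N br k"
proof (induction "cvs.dim N" arbitrary: N k rule: less_induct)
  case less
  have L: "lie_on N br" using less.prems(1) by (simp add: nilpotent_lie_def)
  show ?case
  proof (cases "N = {0}")
    case True
    then have "k = 0" using less.prems(3) by (simp add: dim_zero)
    then show ?thesis
      using coh_zero_algebra[OF True, of "1::complex" br] lie_onD(3)[OF L, of 0] True by simp
  next
    case False
    then obtain \<xi> x where \<xi>: "hyperplane N \<xi> x" "\<And>y z. y \<in> N \<Longrightarrow> z \<in> N \<Longrightarrow> \<xi> (br y z) = 0"
      using nilpotent_lie_hyperplane[OF less.prems(1)] by metis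
    have "x \<in> N" using hyperplane.x(1)[OF \<xi>(1)] .
    then obtain M where M: "\<And>y. y \<in> N \<Longrightarrow> (br x ^^ M) y = 0"
      using nilpotent_lie_ad[OF less.prems(1)] \<open>x \<in> N\<close> by metis
    have lh: "lie_hyperplane N \<xi> x br M"
      using \<xi> L M by (simp add: lie_hyperplane_def lie_hyperplane_axioms_def)
    then interpret lie_hyperplane N \<xi> x br M .
    have "nonzero_coh0 H br j" if "j \<le> cvs.dim H" for j
      using less.hyps[OF _ nilpotent_lie_H[OF less.prems(1) lh] finite_dim_H[OF less.prems(2)] that]
        dim_hyperplane[OF less.prems(2)] by simp
    then have "nonzero_coh N br \<xi> (\<lambda>_. 0 :: complex) k"
      by (intro coh_hyperplane[of "\<lambda>_. 0" 1 "\<lambda>v. v" 1])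
        (simp_all add: less.prems clinear_zero, simp add: clinear_iff)
    then show ?thesis
      using nonzero_coh_eq[of N \<xi> "\<lambda>_. 0 :: complex" "\<lambda>_. 0" "\<lambda>_. 0"] by simp
  qed
qed

lemma coh_nonzero:
  assumes nil: "nilpotent_lie N br" and fin: "finite_dim N"
    and \<eta>: "\<And>y z. y \<in> N \<Longrightarrow> z \<in> N \<Longrightarrow> \<eta> (y + z) = \<eta> y + \<eta> z"
      "\<And>c y. y \<in> N \<Longrightarrow> \<eta> (c *\<^sub>C y) = c * \<eta> y"
      "\<And>y z. y \<in> N \<Longrightarrow> z \<in> N \<Longrightarrow> \<eta> (br y z) = 0"
    and T: "clinear T" and v0: "v0 \<noteq> (0::'v::complex_vector)" "T v0 = 0"
    and f: "clinear f" "\<And>v. f (T v) = 0" "f v1 = (1::complex)"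
    and k: "k \<le> cvs.dim N"
  shows "nonzero_coh N br \<eta> T k"
proof -
  have L: "lie_on N br" using nil by (simp add: nilpotent_lie_def)
  note N = lie_onD(1)[OF L]
  have \<eta>0: "\<eta> 0 = 0" using \<eta>(2)[OF cvs.subspace_0[OF N], of 0] by simp
  have step: "nonzero_coh N br \<xi> T' k"
    if "hyperplane N \<xi> x" "\<And>y z. y \<in> N \<Longrightarrow> z \<in> N \<Longrightarrow> \<xi> (br y z) = 0"
      "clinear T'" "T' v0 = 0" "\<And>v. f (T' v) = 0" for \<xi> x T'
  proof -
    have x: "x \<in> N" by (rule hyperplane.x(1)[OF that(1)])
    obtain M where M: "\<And>y. y \<in> N \<Longrightarrow> (br x ^^ M) y = 0"
      using nilpotent_lie_ad[OF nil] x by metis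
    have lh: "lie_hyperplane N \<xi> x br M"
      using that L M by (simp add: lie_hyperplane_def lie_hyperplane_axioms_def)
    then interpret lie_hyperplane N \<xi> x br M .
    show ?thesis
      by (rule coh_hyperplane[OF fin that(3) v0(1) that(4) f(1) that(5) f(3) _ k])
        (rule coh0_nonzero[OF nilpotent_lie_H[OF nil lh] finite_dim_H[OF fin]])
  qed
  show ?thesis
  proof (cases "N = {0}")
    case True
    then have "k = 0" using k by (simp add: dim_zero)
    then show ?thesis
      using coh_zero_algebra[OF True v0(1)] lie_onD(3)[OF L, of 0] True \<eta>0 by simp
  next
    case False
    show ?thesis
    proof (cases "\<exists>y\<in>N. \<eta> y \<noteq> 0")
      case True
      then obtain y where y: "y \<in> N" "\<eta> y \<noteq> 0" by blast
      have "hyperplane N \<eta> (inverse (\<eta> y) *\<^sub>C y)"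
        using N \<eta> y by unfold_locales (simp_all add: cvs.subspace_scale)
      then show ?thesis by (rule step) (use \<eta> T v0 f in auto)
    next
      case False
      obtain \<xi> x where \<xi>: "hyperplane N \<xi> x" "\<And>y z. y \<in> N \<Longrightarrow> z \<in> N \<Longrightarrow> \<xi> (br y z) = 0"
        using nilpotent_lie_hyperplane[OF nil \<open>N \<noteq> {0}\<close>] by metis
      have "nonzero_coh N br \<xi> (\<lambda>_. 0 :: 'v) k"
        by (rule step[OF \<xi>]) (use clinear_zero clinear_0[OF f(1)] in auto)
      then show ?thesis
        using nonzero_coh_eq[of N \<eta> T \<xi> "\<lambda>_. 0"] False by simp
    qed
  qed
qed

section \<open>Forms in the Chevalley--Eilenberg algebra\<close>

lemma alt_1_eqI:
  assumes "alt N 1 \<phi>" "alt N 1 \<psi>" "\<And>x. x \<in> N \<Longrightarrow> \<phi> [x] = \<psi> [x]"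
  shows "\<phi> = \<psi>"
proof
  fix xs
  show "\<phi> xs = \<psi> xs"
  proof (cases "length xs = 1 \<and> set xs \<subseteq> N")
    case True
    then obtain x where "xs = [x]" "x \<in> N" by (cases xs) auto
    then show ?thesis using assms(3) by simp
  next
    case False
    then show ?thesis using alt_outside[OF assms(1)] alt_outside[OF assms(2)] by metis
  qed
qed

lemma alt_append_add:
  "alt N k \<phi> \<Longrightarrow> set xs \<subseteq> N \<Longrightarrow> x \<in> N \<Longrightarrow> y \<in> N \<Longrightarrow>
    \<phi> (xs @ (x + y) # ys) = \<phi> (xs @ x # ys) + \<phi> (xs @ y # ys)"
proof (induction xs arbitrary: k \<phi>)
  case Nil
  then show ?case
    using alt_iota_add[of N k \<phi> x y] by (simp add: iota_def fun_eq_iff fun_apply)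
next
  case (Cons z zs)
  then show ?case
    using Cons.IH[OF alt_iota[OF Cons.prems(1), of z]] by (simp add: iota_def)
qed

lemma alt_append_scale:
  "alt N k \<phi> \<Longrightarrow> set xs \<subseteq> N \<Longrightarrow> x \<in> N \<Longrightarrow> \<phi> (xs @ (c *\<^sub>C x) # ys) = c *\<^sub>C \<phi> (xs @ x # ys)"
proof (induction xs arbitrary: k \<phi>)
  case Nil
  then show ?case
    using alt_iota_scale[of N k \<phi> x c] by (simp add: iota_def fun_eq_iff scaleC_apply)
next
  case (Cons z zs)
  then show ?case
    using Cons.IH[OF alt_iota[OF Cons.prems(1), of z]] by (simp add: iota_def)
qed

text \<open>
  Alternation in adjacent arguments suffices: swapping neighbours brings equal arguments together.
\<close>

lemma alt_repeated_head:
  assumes N: "cvs.subspace N"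
  shows "alt N k \<phi> \<Longrightarrow> x \<in> N \<Longrightarrow> set xs \<subseteq> N \<Longrightarrow> \<phi> (x # xs @ x # ys) = 0"
proof (induction xs arbitrary: k \<phi>)
  case Nil
  then show ?case
    using alt_iota_iota[of N k \<phi> x] by (simp add: iota_def fun_eq_iff fun_apply)
next
  case (Cons z zs)
  have "\<phi> (z # x # zs @ x # ys) = 0"
    using Cons.IH[OF alt_iota[OF Cons.prems(1), of z]] Cons.prems by (simp add: iota_def)
  moreover have "\<phi> (x # z # zs @ x # ys) = - \<phi> (z # x # zs @ x # ys)"
    using alt_iota_swap[OF N Cons.prems(1), of z x] Cons.prems
    by (simp add: iota_def fun_eq_iff fun_apply)
  ultimately show ?case by simp
qed

lemma alt_not_distinct:
  assumes N: "cvs.subspace N"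
  shows "alt N k \<phi> \<Longrightarrow> \<not> distinct xs \<Longrightarrow> \<phi> xs = 0"
proof (induction xs arbitrary: k \<phi>)
  case (Cons x xs)
  show ?case
  proof (cases "set (x # xs) \<subseteq> N")
    case True
    show ?thesis
    proof (cases "distinct xs")
      case True
      then have "x \<in> set xs" using Cons.prems(2) by simp
      then obtain ys zs where "xs = ys @ x # zs" by (meson split_list)
      then show ?thesis
        using alt_repeated_head[OF N Cons.prems(1), of x ys zs] \<open>set (x # xs) \<subseteq> N\<close> by simp
    next
      case False
      then show ?thesis
        using Cons.IH[OF alt_iota[OF Cons.prems(1), of x]] True by (simp add: iota_def)
    qed
  qed (use alt_outside[OF Cons.prems(1), of "x # xs"] in blast)
qed simp

lemma alt_forms_iota: "\<alpha> \<in> alt_forms N (Suc k) \<Longrightarrow> x \<in> N \<Longrightarrow> iota x \<alpha> \<in> alt_forms N k"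
proof -
  assume a: "\<alpha> \<in> alt_forms N (Suc k)" and x: "x \<in> N"
  note A = a[unfolded alt_forms_def mem_Collect_eq]
  have 1: "\<alpha> (x # xs) = 0" if "\<not> (length xs = k \<and> set xs \<subseteq> N)" for xs
    by (rule alt_formsD[OF a]) (use that in auto)
  have 2: "\<alpha> (x # xs @ (y + z) # ys) = \<alpha> (x # xs @ y # ys) + \<alpha> (x # xs @ z # ys)"
    if "y \<in> N" "z \<in> N" "set xs \<subseteq> N" "set ys \<subseteq> N" for xs ys y z
    using A[THEN conjunct2, THEN conjunct1, rule_format, of y z "x # xs" ys] x that by simp
  have 3: "\<alpha> (x # xs @ (c *\<^sub>C y) # ys) = c * \<alpha> (x # xs @ y # ys)"
    if "y \<in> N" "set xs \<subseteq> N" "set ys \<subseteq> N" for xs ys y c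
    using A[THEN conjunct2, THEN conjunct2, THEN conjunct1, rule_format, of y "x # xs" ys c] x that
    by simp
  have 4: "\<alpha> (x # xs) = 0" if "\<not> distinct xs" for xs
    using A[THEN conjunct2, THEN conjunct2, THEN conjunct2, rule_format, of "x # xs"] that by simp
  show ?thesis
    unfolding alt_forms_def iota_def using 1 2 3 4 by simp
qed

lemma alt_forms_alt: "\<alpha> \<in> alt_forms N k \<Longrightarrow> alt N k \<alpha>"
proof (induction k arbitrary: \<alpha>)
  case 0
  then show ?case by (simp add: iota_def fun_eq_iff fun_apply alt_formsD[OF 0])
next
  case (Suc k)
  note A = Suc.prems[unfolded alt_forms_def mem_Collect_eq]
  have out: "\<alpha> xs = 0" if "\<not> (length xs = Suc k \<and> set xs \<subseteq> N)" for xs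
    by (rule alt_formsD[OF Suc.prems that])
  have "\<alpha> ((x + y) # ys) = \<alpha> (x # ys) + \<alpha> (y # ys)" if "x \<in> N" "y \<in> N" for x y ys
  proof (cases "set ys \<subseteq> N")
    case True
    then show ?thesis
      using A[THEN conjunct2, THEN conjunct1, rule_format, of x y "[]" ys] that by simp
  qed (simp add: out)
  moreover have "\<alpha> ((c *\<^sub>C x) # ys) = c * \<alpha> (x # ys)" if "x \<in> N" for c x ys
  proof (cases "set ys \<subseteq> N")
    case True
    then show ?thesis
      using A[THEN conjunct2, THEN conjunct2, THEN conjunct1, rule_format, of x "[]" ys c] that by simp
  qed (simp add: out)
  moreover have "\<alpha> (x # x # ys) = 0" for x ys
    using A[THEN conjunct2, THEN conjunct2, THEN conjunct2, rule_format, of "x # x # ys"] by simp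
  moreover have "alt N k (iota x \<alpha>)" if "x \<in> N" for x
    by (rule Suc.IH[OF alt_forms_iota[OF Suc.prems that]])
  ultimately show ?case
    using out by (simp add: iota_def fun_eq_iff fun_apply scaleC_apply scaleC_complex_def)
qed

lemma alt_forms_iff:
  assumes N: "cvs.subspace N"
  shows "\<alpha> \<in> alt_forms N k \<longleftrightarrow> alt N k \<alpha>"
proof
  assume a: "alt N k \<alpha>"
  show "\<alpha> \<in> alt_forms N k"
    unfolding alt_forms_def mem_Collect_eq
    using alt_outside[OF a] alt_append_add[OF a] alt_append_scale[OF a] alt_not_distinct[OF N a]
    by (simp add: scaleC_complex_def)
qed (rule alt_forms_alt)

lemma subspace_alt_forms:
  assumes "cvs.subspace N"
  shows "cvs.subspace (alt_forms N k)"
  unfolding cvs.subspace_def using alt_forms_iff[OF assms] alt_add alt_scale alt_zero by blast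

lemma wedge_degree_0:
  "(\<And>ys. ys \<noteq> [] \<Longrightarrow> \<beta> ys = 0) \<Longrightarrow> wedge \<beta> \<alpha> xs = \<beta> [] * \<alpha> xs"
proof (induction xs arbitrary: \<alpha>)
  case (Cons x xs)
  have "wedge (\<lambda>ys. \<beta> (x # ys)) \<alpha> xs = 0"
    using Cons.prems by (simp add: wedge_def)
  moreover have "(\<lambda>ys. (- 1) ^ length ys * \<beta> ys) = \<beta>"
    using Cons.prems by (auto simp: fun_eq_iff) (metis length_0_conv mult_zero_right power_0 mult_1)
  ultimately show ?case using Cons.IH[OF Cons.prems, of "\<lambda>ys. \<alpha> (x # ys)"]
    by (simp add: wedge_Cons)
qed (simp add: wedge_Nil)

lemma wedge_one_form:
  assumes "\<eta> \<in> alt_forms N 1"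
  shows "wedge \<eta> \<alpha> [] = 0" "wedge \<eta> \<alpha> (x # xs) = \<eta> [x] * \<alpha> xs - wedge \<eta> (iota x \<alpha>) xs"
proof -
  note out = alt_formsD[OF assms]
  show "wedge \<eta> \<alpha> [] = 0" by (simp add: wedge_Nil out)
  have "wedge (\<lambda>ys. \<eta> (x # ys)) \<alpha> xs = \<eta> [x] * \<alpha> xs"
    by (rule wedge_degree_0) (simp add: out)
  moreover have "(\<lambda>ys. (- 1) ^ length ys * \<eta> ys) = (\<lambda>ys. - \<eta> ys)"
  proof
    show "(- 1) ^ length ys * \<eta> ys = - \<eta> ys" for ys by (cases "length ys = 1") (simp_all add: out)
  qed
  ultimately show "wedge \<eta> \<alpha> (x # xs) = \<eta> [x] * \<alpha> xs - wedge \<eta> (iota x \<alpha>) xs"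
    by (simp add: wedge_Cons wedge_lin iota_def)
qed

lemma L0_act: "set xs \<subseteq> N \<Longrightarrow> L0 b \<alpha> xs = act N b \<alpha> xs"
proof (induction xs arbitrary: \<alpha>)
  case (Cons y ys)
  then show ?case by (simp add: L0_Cons iota_def)
qed (simp add: L0_def)

text \<open>
  Both sides satisfy the same recursion: \<open>d0\<close> obeys Cartan's formula, and contraction with \<open>x\<close> is an
  antiderivation of the product with the one-form \<open>\<eta>\<close>.
\<close>

lemma diff_tensor_pt:
  assumes "\<eta> \<in> alt_forms N 1" "clinear T"
  shows "set xs \<subseteq> N \<Longrightarrow> diff N br (\<lambda>x. \<eta> [x]) T (\<lambda>xs. \<alpha> xs *\<^sub>C v) xs
      = d0 br \<alpha> xs *\<^sub>C v + wedge \<eta> \<alpha> xs *\<^sub>C T v"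
proof (induction xs arbitrary: \<alpha>)
  case Nil
  then show ?case by (simp add: d0_def wedge_one_form[OF assms(1)])
next
  case (Cons x xs)
  have 1: "act N (br x) (\<lambda>xs. \<alpha> xs *\<^sub>C v) xs = act N (br x) \<alpha> xs *\<^sub>C v"
    using act_comp_pt[OF clinear_multiples[of v], of N "br x" \<alpha> xs] by (simp add: comp_def)
  have 2: "iota x (\<lambda>xs. \<alpha> xs *\<^sub>C v) = (\<lambda>xs. iota x \<alpha> xs *\<^sub>C v)"
    by (simp add: iota_def)
  have 3: "d0 br \<alpha> (x # xs) = - act N (br x) \<alpha> xs - d0 br (iota x \<alpha>) xs"
    using Cons.prems by (simp add: d0_Cons L0_act iota_def)
  have 4: "T (\<alpha> xs *\<^sub>C v) = \<alpha> xs *\<^sub>C T v" using assms(2) by (simp add: clinear_iff)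
  show ?case
    using Cons
    by (simp add: 1 2 3 4 wedge_one_form(2)[OF assms(1)] cvs.scale_left_diff_distrib scaleC_scaleC)
qed

lemma diff_tensor:
  assumes L: "lie_on (lie_carrier L) (lie_bracket L)" and \<eta>: "\<eta> \<in> alt_forms (lie_carrier L) 1"
    and T: "clinear T" and \<alpha>: "\<alpha> \<in> alt_forms (lie_carrier L) k"
  shows "diff (lie_carrier L) (lie_bracket L) (\<lambda>x. \<eta> [x]) T (\<lambda>xs. \<alpha> xs *\<^sub>C v)
      = (\<lambda>xs. ce_diff L \<alpha> xs *\<^sub>C v + wedge \<eta> \<alpha> xs *\<^sub>C T v)"
proof
  fix xs
  let ?N = "lie_carrier L"
  note N = lie_onD(1)[OF L]
  show "diff ?N (lie_bracket L) (\<lambda>x. \<eta> [x]) T (\<lambda>xs. \<alpha> xs *\<^sub>C v) xs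
      = ce_diff L \<alpha> xs *\<^sub>C v + wedge \<eta> \<alpha> xs *\<^sub>C T v"
  proof (cases "set xs \<subseteq> ?N")
    case True
    then show ?thesis using diff_tensor_pt[OF \<eta> T True] by (simp add: ce_diff_d0)
  next
    case False
    have "alt ?N k (\<lambda>xs. \<alpha> xs *\<^sub>C v)"
      using alt_comp[OF clinear_multiples[of v] alt_forms_alt[OF \<alpha>]] by (simp add: comp_def)
    then have "alt ?N (Suc k) (diff ?N (lie_bracket L) (\<lambda>x. \<eta> [x]) T (\<lambda>xs. \<alpha> xs *\<^sub>C v))"
    proof (rule diff_alt[OF L T, rotated -1])
      show "\<eta> [x + y] = \<eta> [x] + \<eta> [y]" if "x \<in> ?N" "y \<in> ?N" for x y
        using alt_append_add[OF alt_forms_alt[OF \<eta>], of "[]"] that by simp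
      show "\<eta> [c *\<^sub>C x] = c * \<eta> [x]" if "x \<in> ?N" for c x
        using alt_append_scale[OF alt_forms_alt[OF \<eta>], of "[]"] that by (simp add: scaleC_complex_def)
    qed
    then have "diff ?N (lie_bracket L) (\<lambda>x. \<eta> [x]) T (\<lambda>xs. \<alpha> xs *\<^sub>C v) xs = 0"
      using alt_outside False by blast
    moreover have "ce_diff L \<alpha> xs = 0" using False by (simp add: ce_diff_def)
    moreover have "wedge \<eta> \<alpha> xs = 0"
      by (rule wedge_outside[of ?N]) (use alt_formsD[OF \<eta>] alt_formsD[OF \<alpha>] False in auto)
    ultimately show ?thesis by simp
  qed
qed

lemma tensor_fun_image:
  assumes V: "finite_dim (UNIV :: 'v::complex_vector set)" and N: "cvs.subspace N"
  shows "tensor_fun ` tensor_sub (alt_forms N k) (UNIV :: 'v set) = {\<phi>. alt N k \<phi>}"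
proof (intro subset_antisym subsetI)
  fix \<phi> :: "'a list \<Rightarrow> 'v" assume "\<phi> \<in> tensor_fun ` tensor_sub (alt_forms N k) UNIV"
  then obtain t :: "('a list \<Rightarrow> complex, 'v) tensor"
    where t: "t \<in> tensor_sub (alt_forms N k) UNIV" "\<phi> = tensor_fun t" by blast
  have "alt N k (tensor_fun t)"
    using t(1) unfolding tensor_sub_def
  proof (induction t rule: cvs.span_induct_alt)
    case base
    show ?case by (simp add: clinear_0[OF tensor_fun(1)])
  next
    case (step c x y)
    then obtain \<alpha> v where x: "x = \<alpha> \<otimes>\<^sub>C v" "\<alpha> \<in> alt_forms N k" by blast
    have "alt N k (tensor_fun x)"
      using alt_comp[OF clinear_multiples[of v] alt_forms_alt[OF x(2)]]
      by (simp add: x(1) tensor_fun(2) comp_def)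
    moreover have "tensor_fun (c *\<^sub>C x + y) = c *\<^sub>C tensor_fun x + tensor_fun y"
      by (simp add: tensor_fun(1)[unfolded clinear_iff])
    ultimately show ?case using step by (simp add: alt_add alt_scale)
  qed
  then show "\<phi> \<in> {\<phi>. alt N k \<phi>}" using t(2) by simp
next
  fix \<phi> :: "'a list \<Rightarrow> 'v" assume \<phi>: "\<phi> \<in> {\<phi>. alt N k \<phi>}"
  obtain B :: "'v set" and c where c: "finite B" "\<And>b. clinear (c b)" "\<And>x. x = (\<Sum>b\<in>B. c b x *\<^sub>C b)"
    using coordinates[OF V] by blast
  let ?t = "\<Sum>b\<in>B. (c b \<circ> \<phi>) \<otimes>\<^sub>C b"
  have "c b \<circ> \<phi> \<in> alt_forms N k" for b
    using \<phi> c(2) by (simp add: alt_forms_iff[OF N] alt_comp)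
  then have "?t \<in> tensor_sub (alt_forms N k) UNIV"
    by (intro cvs.subspace_sum[OF subspace_tensor_sub] tensor_subI) auto
  moreover have "tensor_fun ?t = \<phi>"
  proof
    fix xs
    have "(\<Sum>b\<in>B. f b) xs = (\<Sum>b\<in>B. f b xs)" for f :: "'v \<Rightarrow> 'a list \<Rightarrow> 'v"
      by (induction B rule: infinite_finite_induct) (simp_all add: fun_apply)
    then have "tensor_fun ?t xs = (\<Sum>b\<in>B. c b (\<phi> xs) *\<^sub>C b)"
      by (simp add: clinear_sum[OF tensor_fun(1)] tensor_fun(2))
    then show "tensor_fun ?t xs = \<phi> xs" using c(3) by simp
  qed
  ultimately show "\<phi> \<in> tensor_fun ` tensor_sub (alt_forms N k) UNIV"
    by (intro image_eqI[of _ _ ?t]) simp_all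
qed

section \<open>The determinant detects singular endomorphisms\<close>

lemma matrix_sum_product:
  fixes A :: "nat \<Rightarrow> nat \<Rightarrow> complex"
  shows "Determinant.det (Matrix.mat n n (\<lambda>(i, j). A i j))
    = (\<Sum>p | p permutes {0..<n}. of_int (sign p) * (\<Prod>i = 0..<n. A i (p i)))"
proof -
  have "(\<Prod>i = 0..<n. Matrix.mat n n (\<lambda>(i, j). A i j) $$ (i, p i)) = (\<Prod>i = 0..<n. A i (p i))"
    if "p permutes {0..<n}" for p
    by (rule prod.cong) (use permutes_in_image[OF that] in auto)
  then show ?thesis
    unfolding Determinant.det_def by (auto intro!: sum.cong)
qed

text \<open>
  Numbering the basis turns the Leibniz sum over a basis set into the determinant of a matrix
  indexed by numbers.
\<close>

lemma leibniz_reindex: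
  fixes A :: "'b \<Rightarrow> 'b \<Rightarrow> complex" and n :: nat
  assumes h: "bij_betw h {0..<n} B"
  shows "(\<Sum>p | p permutes B. of_int (sign p) * (\<Prod>b\<in>B. A b (p b)))
    = (\<Sum>p | p permutes {0..<n}. of_int (sign p) * (\<Prod>i = 0..<n. A (h i) (h (p i))))"
proof -
  let ?A = "{0..<n}" and ?m = "map_permutation {0..<n} h"
  have inj: "inj_on h ?A" and img: "h ` ?A = B" using h by (auto simp: bij_betw_def)
  have "?m = (\<lambda>\<pi> x. if x \<in> B then h (\<pi> (inv_into ?A h x)) else x)"
    by (simp add: map_permutation_def restrict_id_def img fun_eq_iff)
  then have "bij_betw ?m {p. p permutes ?A} {p. p permutes B}"
    using bij_betw_permutations[OF h] by simp
  then have "(\<Sum>p | p permutes B. of_int (sign p) * (\<Prod>b\<in>B. A b (p b)))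
      = (\<Sum>p | p permutes ?A. of_int (sign (?m p)) * (\<Prod>b\<in>B. A b (?m p b)))"
    by (rule sum.reindex_bij_betw[symmetric])
  also have "\<dots> = (\<Sum>p | p permutes ?A. of_int (sign p) * (\<Prod>i = 0..<n. A (h i) (h (p i))))"
  proof (rule sum.cong[OF refl])
    fix p assume "p \<in> {p. p permutes ?A}"
    then have p: "p permutes ?A" by simp
    have "(\<Prod>b\<in>B. A b (?m p b)) = (\<Prod>i\<in>?A. A (h i) (?m p (h i)))"
      by (rule prod.reindex_bij_betw[OF h, symmetric])
    also have "\<dots> = (\<Prod>i\<in>?A. A (h i) (h (p i)))"
      by (rule prod.cong) (simp_all add: map_permutation_apply[OF inj])
    finally have "(\<Prod>b\<in>B. A b (?m p b)) = (\<Prod>i\<in>?A. A (h i) (h (p i)))" .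
    moreover have "sign (?m p) = sign p"
      by (rule sign_map_permutation[OF inj p]) simp
    ultimately show "of_int (sign (?m p)) * (\<Prod>b\<in>B. A b (?m p b))
        = of_int (sign p) * (\<Prod>i\<in>?A. A (h i) (h (p i)))"
      by simp
  qed
  finally show ?thesis .
qed

text \<open>
  In coordinates for the basis chosen in the definition, the determinant is that of a matrix, whose
  kernel corresponds to that of \<open>f\<close>.
\<close>

lemma endo_det_eq_0_iff:
  assumes V: "finite_dim (UNIV :: 'v::complex_vector set)" and f: "clinear (f :: 'v \<Rightarrow> 'v)"
  shows "endo_det f = 0 \<longleftrightarrow> (\<exists>v. v \<noteq> 0 \<and> f v = 0)"
proof -
  define B :: "'v set" where "B = (SOME B. cvs.independent B \<and> cvs.span B = UNIV)"
  obtain B0 :: "'v set" where B0: "finite B0" "cvs.independent B0" "cvs.span B0 = UNIV"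
    using finite_basis[OF V] .
  have B: "cvs.independent B" "cvs.span B = UNIV"
    using someI[of "\<lambda>B. cvs.independent B \<and> cvs.span B = UNIV", OF conjI, OF B0(2,3)]
    unfolding B_def by auto
  have fin: "finite B"
    using cvs.independent_span_bound[OF B0(1) B(1)] B0(3) by simp
  obtain h where h: "bij_betw h {0..<card B} B"
    using ex_bij_betw_nat_finite[OF fin] by blast
  let ?n = "card B"
  let ?r = "\<lambda>v b. cvs.representation B v b"
  define A where "A i j = ?r (f (h i)) (h j)" for i j
  let ?M = "Matrix.mat ?n ?n (\<lambda>(i, j). A j i)"
  have "endo_det f = (\<Sum>p | p permutes B. of_int (sign p) * (\<Prod>b\<in>B. ?r (f b) (p b)))"
    unfolding endo_det_def B_def[symmetric] by simp
  also have "\<dots> = (\<Sum>p | p permutes {0..<?n}. of_int (sign p) * (\<Prod>i = 0..<?n. A i (p i)))"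
    unfolding A_def by (rule leibniz_reindex[OF h])
  also have "\<dots> = Determinant.det (Matrix.mat ?n ?n (\<lambda>(i, j). A i j))"
    by (rule matrix_sum_product[symmetric])
  also have "\<dots> = Determinant.det ?M"
  proof -
    have "?M = Matrix.transpose_mat (Matrix.mat ?n ?n (\<lambda>(i, j). A i j))"
      by (rule eq_matI) auto
    then show ?thesis using Determinant.det_transpose[of "Matrix.mat ?n ?n (\<lambda>(i, j). A i j)" ?n] by simp
  qed
  finally have "endo_det f = 0 \<longleftrightarrow> (\<exists>u \<in> carrier_vec ?n. u \<noteq> 0\<^sub>v ?n \<and> ?M *\<^sub>v u = 0\<^sub>v ?n)"
    using det_0_iff_vec_prod_zero[of ?M ?n] by auto
  also have "\<dots> \<longleftrightarrow> (\<exists>v. v \<noteq> 0 \<and> f v = 0)"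
  proof -
    define V where "V u = (\<Sum>i = 0..<?n. vec_index u i *\<^sub>C h i)" for u
    have hB: "h i \<in> B" if "i < ?n" for i using h that by (auto simp: bij_betw_def)
    have rep_V: "?r (V u) (h i) = vec_index u i" if "i < ?n" for u i
    proof -
      have "?r (V u) (h i) = (\<Sum>j = 0..<?n. vec_index u j * ?r (h j) (h i))"
        unfolding V_def using B hB
        by (simp add: cvs.representation_sum cvs.representation_scale)
      also have "\<dots> = (\<Sum>j = 0..<?n. if j = i then vec_index u j else 0)"
        by (rule sum.cong) (use h that hB B in \<open>auto simp: cvs.representation_basis bij_betw_def inj_on_def\<close>)
      finally show ?thesis using that by simp
    qed
    have zero_iff: "v = 0 \<longleftrightarrow> (\<forall>i<?n. ?r v (h i) = 0)" for v
    proof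
      assume z: "\<forall>i<?n. ?r v (h i) = 0"
      have "?r v b = 0" if "b \<in> B" for b
        using z h that unfolding bij_betw_def by (metis atLeastLessThan_iff imageE)
      then show "v = 0" using cvs.sum_representation_eq[of B v B] B fin by simp
    qed (simp add: cvs.representation_zero)
    have f_V: "?r (f (V u)) (h i) = vec_index (?M *\<^sub>v u) i" if "i < ?n" "u \<in> carrier_vec ?n" for u i
    proof -
      have "f (V u) = (\<Sum>j = 0..<?n. vec_index u j *\<^sub>C f (h j))"
        unfolding V_def using f by (simp add: clinear_sum clinear_iff)
      then have "?r (f (V u)) (h i) = (\<Sum>j = 0..<?n. vec_index u j * A j i)"
        using B by (simp add: cvs.representation_sum cvs.representation_scale A_def)
      then show ?thesis using that by (simp add: scalar_prod_def mult.commute)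
    qed
    have ex: "v = V (Matrix.vec ?n (\<lambda>i. ?r v (h i)))" for v
    proof -
      have "V (Matrix.vec ?n (\<lambda>i. ?r v (h i))) = (\<Sum>i = 0..<?n. ?r v (h i) *\<^sub>C h i)"
        unfolding V_def by (rule sum.cong) simp_all
      also have "\<dots> = (\<Sum>b\<in>B. ?r v b *\<^sub>C b)"
        by (rule sum.reindex_bij_betw[OF h])
      finally show ?thesis using cvs.sum_representation_eq[of B v B] B fin by simp
    qed
    have vec0: "u = 0\<^sub>v ?n \<longleftrightarrow> (\<forall>i<?n. vec_index u i = 0)"
      if "u \<in> carrier_vec ?n" for u :: "complex Matrix.vec"
      using that by (auto intro!: eq_vecI)
    have V0: "V u \<noteq> 0 \<longleftrightarrow> u \<noteq> 0\<^sub>v ?n" if "u \<in> carrier_vec ?n" for u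
      using zero_iff[of "V u"] rep_V[of _ u] vec0[OF that] by auto
    have fV0: "f (V u) = 0 \<longleftrightarrow> ?M *\<^sub>v u = 0\<^sub>v ?n" if "u \<in> carrier_vec ?n" for u
      using zero_iff[of "f (V u)"] f_V[OF _ that] vec0[of "?M *\<^sub>v u"] mult_mat_vec_carrier[of ?M ?n ?n u] that
      by (simp del: index_mult_mat_vec)
    show ?thesis
      using V0 fV0 ex vec_carrier by metis
  qed
  finally show ?thesis .
qed

section \<open>Nilpotent subalgebras of traceless two-by-two matrices\<close>

definition commutator :: "complex^2^2 \<Rightarrow> complex^2^2 \<Rightarrow> complex^2^2"
  where "commutator X Y = X ** Y - Y ** X"

lemma matrix2_eq_iff:
  "X = Y \<longleftrightarrow> X $ 1 $ 1 = Y $ 1 $ 1 \<and> X $ 1 $ 2 = Y $ 1 $ 2 \<and> X $ 2 $ 1 = Y $ 2 $ 1 \<and> X $ 2 $ 2 = Y $ 2 $ 2"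
  for X Y :: "complex^2^2"
  by (auto simp: Finite_Cartesian_Product.vec_eq_iff forall_2)

lemma trace2: "trace X = 0 \<longleftrightarrow> X $ 2 $ 2 = - X $ 1 $ 1" for X :: "complex^2^2"
  by (auto simp: trace_def sum_2 eq_neg_iff_add_eq_0 add.commute)

lemma commutator_entries:
  fixes X Y :: "complex^2^2"
  assumes "trace X = 0" "trace Y = 0"
  shows "commutator X Y $ 1 $ 1 = X $ 1 $ 2 * Y $ 2 $ 1 - Y $ 1 $ 2 * X $ 2 $ 1"
    "commutator X Y $ 1 $ 2 = 2 * (X $ 1 $ 1 * Y $ 1 $ 2 - Y $ 1 $ 1 * X $ 1 $ 2)"
    "commutator X Y $ 2 $ 1 = 2 * (X $ 2 $ 1 * Y $ 1 $ 1 - Y $ 2 $ 1 * X $ 1 $ 1)"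
    "commutator X Y $ 2 $ 2 = - (X $ 1 $ 2 * Y $ 2 $ 1 - Y $ 1 $ 2 * X $ 2 $ 1)"
  using assms by (simp_all add: commutator_def trace2 matrix_matrix_mult_def sum_2 algebra_simps)

lemma trace_commutator: "trace (commutator X Y) = 0" for X Y :: "complex^2^2"
  by (simp add: commutator_def trace_def sum_2 matrix_matrix_mult_def algebra_simps)

lemma clinear_commutator:
  "clinear (commutator X)" "clinear (\<lambda>X. commutator X Y)"
  by (simp_all add: commutator_def clinear_iff matrix2_eq_iff matrix_matrix_mult_def sum_2 scaleC_vec_def
      scaleC_complex_def algebra_simps)

lemma commutator_self: "commutator X X = 0"
  by (simp add: commutator_def)

lemma commutator_swap: "commutator Y X = - commutator X Y"
  by (simp add: commutator_def)

text \<open>The form \<open>a\<^sup>2 + b c\<close>, minus the determinant; \<open>ad X\<close> satisfies \<open>t\<^sup>3 = 4 (a\<^sup>2 + b c) t\<close>.\<close>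

definition disc :: "complex^2^2 \<Rightarrow> complex"
  where "disc X = X $ 1 $ 1 * X $ 1 $ 1 + X $ 1 $ 2 * X $ 2 $ 1"

lemma ad_cubed:
  assumes "trace X = 0" "trace Y = 0"
  shows "commutator X (commutator X (commutator X Y)) = (4 * disc X) *\<^sub>C commutator X Y"
  using assms trace_commutator
  by (simp add: matrix2_eq_iff commutator_entries scaleC_vec_def disc_def scaleC_complex_def algebra_simps)

text \<open>
  The odd powers of \<open>ad X\<close> are multiples of \<open>ad X\<close> by powers of \<open>4 disc X\<close>.
\<close>

lemma ad_nilpotent_disc:
  assumes "trace X = 0" "trace Y = 0" "(commutator X ^^ M) Y = 0" "commutator X Y \<noteq> 0"
  shows "disc X = 0"
proof (rule ccontr)
  assume d: "disc X \<noteq> 0"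
  have odd: "(commutator X ^^ Suc (2 * j)) Y = (4 * disc X) ^ j *\<^sub>C commutator X Y" for j
  proof (induction j)
    case (Suc j)
    have c: "commutator X (c *\<^sub>C Z) = c *\<^sub>C commutator X Z" for c Z
      using clinear_commutator(1) by (simp add: clinear_iff)
    have "(commutator X ^^ Suc (2 * Suc j)) Y = commutator X (commutator X ((commutator X ^^ Suc (2 * j)) Y))"
      by simp
    also have "\<dots> = (4 * disc X) ^ j *\<^sub>C commutator X (commutator X (commutator X Y))"
      unfolding Suc.IH by (simp only: c)
    also have "\<dots> = (4 * disc X) ^ Suc j *\<^sub>C commutator X Y"
      unfolding ad_cubed[OF assms(1,2)] by (simp only: scaleC_scaleC power_Suc2)
    finally show ?case .
  qed (simp add: scaleC_one)
  have z: "(commutator X ^^ i) 0 = 0" for i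
    by (induction i) (simp_all add: clinear_0[OF clinear_commutator(1)])
  have "Suc (2 * M) = (M + 1) + M" by simp
  then have "(commutator X ^^ Suc (2 * M)) Y = (commutator X ^^ (M + 1)) ((commutator X ^^ M) Y)"
    by (metis comp_apply funpow_add)
  then have "(4 * disc X) ^ M *\<^sub>C commutator X Y = 0" unfolding odd assms(3) z .
  then show False using d assms(4) by (simp add: cvs.scale_eq_0_iff)
qed

text \<open>
  If \<open>X\<close> and \<open>Y\<close> do not commute, then \<open>disc\<close> vanishes at \<open>X\<close>, \<open>Y\<close> and \<open>X + Y\<close>, hence on their span.  But
  \<open>disc\<close> is a non-degenerate quadratic form in three variables, whose isotropic subspaces have
  dimension at most one.
\<close>

lemma nilpotent_commute:
  fixes S :: "(complex^2^2) set"
  assumes tr: "\<And>X. X \<in> S \<Longrightarrow> trace X = 0" and add: "\<And>X Y. X \<in> S \<Longrightarrow> Y \<in> S \<Longrightarrow> X + Y \<in> S"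
    and nil: "\<And>X Y. X \<in> S \<Longrightarrow> Y \<in> S \<Longrightarrow> (commutator X ^^ M) Y = 0"
    and X: "X \<in> S" and Y: "Y \<in> S"
  shows "commutator X Y = 0"
proof (rule ccontr)
  assume n: "commutator X Y \<noteq> 0"
  have n': "commutator Y X \<noteq> 0" "commutator (X + Y) Y \<noteq> 0"
    using n clinear_commutator(2)[of Y] by (simp_all add: commutator_swap[of Y X] clinear_iff commutator_self)
  have d: "disc X = 0" "disc Y = 0" "disc (X + Y) = 0"
    using ad_nilpotent_disc[OF tr tr nil n] ad_nilpotent_disc[OF tr tr nil n'(1)]
      ad_nilpotent_disc[OF tr tr nil n'(2)] X Y add by auto
  let ?a = "X $ 1 $ 1" and ?b = "X $ 1 $ 2" and ?c = "X $ 2 $ 1"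
  let ?a' = "Y $ 1 $ 1" and ?b' = "Y $ 1 $ 2" and ?c' = "Y $ 2 $ 1"
  have 1: "?a * ?a = - (?b * ?c)" "?a' * ?a' = - (?b' * ?c')"
    using d by (simp_all add: disc_def eq_neg_iff_add_eq_0)
  have "(?a + ?a') * (?a + ?a') + (?b + ?b') * (?c + ?c') = 0"
    using d(3) by (simp add: disc_def)
  with 1 have 2: "2 * (?a * ?a') + ?b * ?c' + ?b' * ?c = 0" by Groebner_Basis.algebra
  \<comment> \<open>The squares of the three entries lie in the ideal generated by the equations above.\<close>
  have "(?b * ?c' - ?b' * ?c)\<^sup>2 = 0" "(?a * ?b' - ?a' * ?b)\<^sup>2 = 0" "(?c * ?a' - ?c' * ?a)\<^sup>2 = 0"
    using 1 2 by Groebner_Basis.algebra+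
  then have "commutator X Y = 0"
    using commutator_entries[OF tr[OF X] tr[OF Y]] by (simp add: matrix2_eq_iff)
  then show False using n by simp
qed

text \<open>
  The entries of the commutator are, up to factors, those of the cross product of \<open>X\<close> and \<open>Y\<close> as vectors
  in dimension three.
\<close>

lemma commuting_proportional:
  assumes "trace X = 0" "trace Y = 0" "commutator X Y = 0" "X \<noteq> 0"
  shows "\<exists>c. Y = c *\<^sub>C X"
proof -
  let ?a = "X $ 1 $ 1" and ?b = "X $ 1 $ 2" and ?c = "X $ 2 $ 1"
  let ?a' = "Y $ 1 $ 1" and ?b' = "Y $ 1 $ 2" and ?c' = "Y $ 2 $ 1"
  have e: "?b * ?c' = ?b' * ?c" "?a * ?b' = ?a' * ?b" "?c * ?a' = ?c' * ?a"
    using commutator_entries[OF assms(1,2)] assms(3) by simp_all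
  have t: "X $ 2 $ 2 = - ?a" "Y $ 2 $ 2 = - ?a'" using assms(1,2) by (simp_all add: trace2)
  then consider "?a \<noteq> 0" | "?b \<noteq> 0" | "?c \<noteq> 0" using assms(4) by (auto simp: matrix2_eq_iff)
  then show ?thesis
  proof cases
    case 1
    show ?thesis
      by (rule exI[of _ "?a' / ?a"])
        (use 1 e t in \<open>simp add: matrix2_eq_iff scaleC_vec_def scaleC_complex_def field_simps\<close>)
  next
    case 2
    show ?thesis
      by (rule exI[of _ "?b' / ?b"])
        (use 2 e t in \<open>simp add: matrix2_eq_iff scaleC_vec_def scaleC_complex_def field_simps\<close>)
  next
    case 3
    show ?thesis
      by (rule exI[of _ "?c' / ?c"])
        (use 3 e t in \<open>simp add: matrix2_eq_iff scaleC_vec_def scaleC_complex_def field_simps\<close>)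
  qed
qed

lemma finite_dim_matrix: "finite_dim (UNIV :: (complex^2^2) set)"
proof -
  define E :: "2 \<Rightarrow> 2 \<Rightarrow> complex^2^2" where "E i j = (\<chi> k l. if k = i \<and> l = j then 1 else 0)" for i j
  have "X \<in> cvs.span {E 1 1, E 1 2, E 2 1, E 2 2}" for X :: "complex^2^2"
  proof -
    have "X = X $ 1 $ 1 *\<^sub>C E 1 1 + X $ 1 $ 2 *\<^sub>C E 1 2 + X $ 2 $ 1 *\<^sub>C E 2 1 + X $ 2 $ 2 *\<^sub>C E 2 2"
      by (simp add: matrix2_eq_iff E_def scaleC_vec_def scaleC_complex_def)
    then show ?thesis
      by (metis (no_types, lifting) cvs.span_add cvs.span_base cvs.span_scale insertCI)
  qed
  then show ?thesis unfolding finite_dim_def by (intro exI[of _ "{E 1 1, E 1 2, E 2 1, E 2 2}"]) auto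
qed

text \<open>
  The common features of \<open>sl2\<close> and \<open>sol2\<close> on which the argument rests.
\<close>

definition two_by_two :: "(complex^2^2) lie \<Rightarrow> bool"
  where "two_by_two L \<longleftrightarrow> cvs.subspace (lie_carrier L) \<and> (\<forall>X\<in>lie_carrier L. trace X = 0) \<and>
    lie_bracket L = commutator"

lemma two_by_two: "two_by_two sl2" "two_by_two sol2"
  by (auto simp: two_by_two_def commutator_def fun_eq_iff sl2_def sol2_def cvs.subspace_def trace2 scaleC_vec_def
      scaleC_complex_def algebra_simps)

section \<open>Flat connections and resonance\<close>

lemma CE_simps [simp]:
  "deg_part (CE L) = alt_forms (lie_carrier L)" "dg_mult (CE L) = wedge" "dg_diff (CE L) = ce_diff L"
  by (simp_all add: CE_def)

lemma subspace_dg_total: "cvs.subspace (dg_total A)"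
  by (simp add: dg_total_def)

lemma alt_forms_dg_total: "alt_forms (lie_carrier L) k \<subseteq> dg_total (CE L)"
  unfolding dg_total_def by (auto intro: cvs.span_base)

lemma ce_diff_lin:
  "ce_diff L (\<alpha> + \<beta>) = ce_diff L \<alpha> + ce_diff L \<beta>" "ce_diff L (c *\<^sub>C \<alpha>) = c *\<^sub>C ce_diff L \<alpha>"
  by (auto simp: ce_diff_def fun_eq_iff fun_apply scaleC_apply scaleC_complex_def sum.distrib
      sum_subtractf sum_negf algebra_simps sum_distrib_left)

lemma wedge_linear:
  "wedge (\<alpha> + \<alpha>') \<beta> = wedge \<alpha> \<beta> + wedge \<alpha>' \<beta>" "wedge \<alpha> (\<beta> + \<beta>') = wedge \<alpha> \<beta> + wedge \<alpha> \<beta>'"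
  "wedge (c *\<^sub>C \<alpha>) \<beta> = c *\<^sub>C wedge \<alpha> \<beta>" "wedge \<alpha> (c *\<^sub>C \<beta>) = c *\<^sub>C wedge \<alpha> \<beta>"
  by (auto simp: wedge_def fun_eq_iff fun_apply scaleC_apply scaleC_complex_def sum.distrib
      algebra_simps sum_distrib_left)

locale nilpotent_resonance =
  fixes L :: "'n::complex_vector lie" and G :: "(complex^2^2) lie"
    and \<theta> :: "complex^2^2 \<Rightarrow> 'v::complex_vector \<Rightarrow> 'v"
  assumes nil: "nilpotent_lie (lie_carrier L) (lie_bracket L)"
    and fin: "finite_dim (lie_carrier L)"
    and G: "two_by_two G"
    and mod: "lie_module G \<theta>"
    and V: "finite_dim (UNIV :: 'v set)" "\<exists>v :: 'v. v \<noteq> 0"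
begin

abbreviation "N \<equiv> lie_carrier L"
abbreviation "br \<equiv> lie_bracket L"

lemma L: "lie_on N br"
  using nil by (simp add: nilpotent_lie_def)

lemmas N = lie_onD(1)[OF L]

lemma G_simps: "cvs.subspace (lie_carrier G)" "X \<in> lie_carrier G \<Longrightarrow> trace X = 0"
  "lie_bracket G = commutator"
  using G by (simp_all add: two_by_two_def)

lemma \<theta>: "g \<in> lie_carrier G \<Longrightarrow> clinear (\<theta> g)"
  "g \<in> lie_carrier G \<Longrightarrow> h \<in> lie_carrier G \<Longrightarrow> \<theta> (g + h) v = \<theta> g v + \<theta> h v"
  "g \<in> lie_carrier G \<Longrightarrow> \<theta> (c *\<^sub>C g) v = c *\<^sub>C \<theta> g v"
  using mod by (auto simp: lie_module_def)

lemma one_form: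
  assumes "\<eta> \<in> alt_forms N 1"
  shows "x \<in> N \<Longrightarrow> y \<in> N \<Longrightarrow> \<eta> [x + y] = \<eta> [x] + \<eta> [y]" "x \<in> N \<Longrightarrow> \<eta> [c *\<^sub>C x] = c * \<eta> [x]"
  using alt_append_add[OF alt_forms_alt[OF assms], of "[]" x y "[]"]
    alt_append_scale[OF alt_forms_alt[OF assms], of "[]" x c "[]"] by (simp_all add: scaleC_complex_def)

lemma closed_one_form:
  assumes "\<eta> \<in> alt_forms N 1" "ce_diff L \<eta> = 0" "x \<in> N" "y \<in> N"
  shows "\<eta> [br x y] = 0"
  using ce_diff_one_form[OF assms(1), of "[x, y]"] assms(2-4) by (simp add: fun_apply)

text \<open>Both sides are linear in \<open>t\<close>, and on pure tensors they agree by \<open>diff_tensor\<close>.\<close>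

lemma twisted_diff_pure:
  assumes \<eta>: "\<eta> \<in> alt_forms N 1" and g: "g \<in> lie_carrier G"
    and t: "t \<in> tensor_sub (alt_forms N k) UNIV"
  shows "tensor_fun (twisted_diff (CE L) G \<theta> (\<eta> \<otimes>\<^sub>C g) t)
    = diff N br (\<lambda>x. \<eta> [x]) (\<theta> g) (tensor_fun t)"
proof -
  let ?F = "\<lambda>\<alpha> v. ce_diff L \<alpha> \<otimes>\<^sub>C v + wedge \<eta> \<alpha> \<otimes>\<^sub>C \<theta> g v"
  have "tensor_extend (alt_forms N 1) (lie_carrier G) (\<lambda>\<eta> x. wedge \<eta> \<alpha> \<otimes>\<^sub>C \<theta> x v) (\<eta> \<otimes>\<^sub>C g)
      = wedge \<eta> \<alpha> \<otimes>\<^sub>C \<theta> g v" for \<alpha> v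
    by (rule tensor_extend_pure[OF subspace_alt_forms[OF N] G_simps(1) _ \<eta> g], rule bilinear_pure)
      (simp_all add: wedge_linear \<theta>)
  then have tw: "twisted_diff (CE L) G \<theta> (\<eta> \<otimes>\<^sub>C g) = tensor_extend (dg_total (CE L)) UNIV ?F"
    by (simp add: twisted_diff_def)
  have "bilinear_on (dg_total (CE L)) UNIV ?F"
    using \<theta>(1)[OF g]
    by (simp add: bilinear_on_def clinear_iff ce_diff_lin wedge_linear pure_tensor_add
        pure_tensor_scale scaleC_add_right algebra_simps)
  then obtain e where e: "clinear e"
    "\<And>t. t \<in> tensor_sub (dg_total (CE L)) UNIV \<Longrightarrow> tensor_extend (dg_total (CE L)) UNIV ?F t = e t"
    "\<And>\<alpha> v. \<alpha> \<in> dg_total (CE L) \<Longrightarrow> v \<in> UNIV \<Longrightarrow> e (\<alpha> \<otimes>\<^sub>C v) = ?F \<alpha> v"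
    using tensor_extend_ex[OF subspace_dg_total cvs.subspace_UNIV] by blast
  have "tensor_fun (e t) = diff N br (\<lambda>x. \<eta> [x]) (\<theta> g) (tensor_fun t)"
  proof (rule clinear_eq_on_span[OF _ _ _ t[unfolded tensor_sub_def]])
    show "clinear (\<lambda>t. tensor_fun (e t))"
      by (simp add: clinear_iff e(1)[unfolded clinear_iff] tensor_fun(1)[unfolded clinear_iff])
    show "clinear (\<lambda>t. diff N br (\<lambda>x. \<eta> [x]) (\<theta> g) (tensor_fun t))"
      by (simp add: clinear_iff tensor_fun(1)[unfolded clinear_iff] diff_lin[OF \<theta>(1)[OF g]])
    fix b :: "('n list \<Rightarrow> complex, 'v) tensor"
    assume "b \<in> {u \<otimes>\<^sub>C w |u w. u \<in> alt_forms N k \<and> w \<in> UNIV}"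
    then obtain \<alpha> v where b: "b = \<alpha> \<otimes>\<^sub>C v" "\<alpha> \<in> alt_forms N k" by blast
    have "\<alpha> \<in> dg_total (CE L)" using b(2) alt_forms_dg_total by blast
    then have "tensor_fun (e b) = (\<lambda>xs. ce_diff L \<alpha> xs *\<^sub>C v + wedge \<eta> \<alpha> xs *\<^sub>C \<theta> g v)"
      by (simp add: b(1) e(3) fun_eq_iff tensor_fun_add tensor_fun(2))
    then show "tensor_fun (e b) = diff N br (\<lambda>x. \<eta> [x]) (\<theta> g) (tensor_fun b)"
      using diff_tensor[OF L \<eta> \<theta>(1)[OF g] b(2)] by (simp add: b(1) tensor_fun(2))
  qed
  moreover have "t \<in> tensor_sub (dg_total (CE L)) UNIV"
    using t tensor_sub_mono[OF alt_forms_dg_total order_refl] by blast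
  ultimately show ?thesis using tw e(2) by metis
qed

lemma quot_dim_pure:
  assumes \<eta>: "\<eta> \<in> alt_forms N 1" and g: "g \<in> lie_carrier G"
  shows "quot_dim (twisted_cocycles (CE L) G \<theta> (\<eta> \<otimes>\<^sub>C g) k)
      (twisted_coboundaries (CE L) G \<theta> (\<eta> \<otimes>\<^sub>C g) k) \<ge> enat 1
    \<longleftrightarrow> nonzero_coh N br (\<lambda>x. \<eta> [x]) (\<theta> g) k"
proof -
  let ?d = "diff N br (\<lambda>x. \<eta> [x]) (\<theta> g)" and ?tw = "twisted_diff (CE L) G \<theta> (\<eta> \<otimes>\<^sub>C g)"
  let ?S = "\<lambda>k. tensor_sub (alt_forms N k) (UNIV :: 'v set)"
  let ?Z = "twisted_cocycles (CE L) G \<theta> (\<eta> \<otimes>\<^sub>C g) k" and ?B = "twisted_coboundaries (CE L) G \<theta> (\<eta> \<otimes>\<^sub>C g) k"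
  note img = tensor_fun_image[OF V(1) N]
  have inj: "s = t \<longleftrightarrow> tensor_fun s = tensor_fun t" for s t :: "('n list \<Rightarrow> complex, 'v) tensor"
    using inj_tensor_fun[OF V(1)] by blast
  have zero: "tensor_fun (0 :: ('n list \<Rightarrow> complex, 'v) tensor) = 0" by (rule clinear_0[OF tensor_fun(1)])
  have Z: "t \<in> ?Z \<longleftrightarrow> t \<in> ?S k \<and> ?d (tensor_fun t) = 0" for t
  proof -
    have "?tw t = 0 \<longleftrightarrow> ?d (tensor_fun t) = 0" if "t \<in> ?S k"
      unfolding inj[of "?tw t" 0] zero twisted_diff_pure[OF \<eta> g that] ..
    then show ?thesis by (auto simp: twisted_cocycles_def)
  qed
  have B: "t \<in> ?B \<longleftrightarrow> (\<exists>w. below N k w \<and> ?d w = tensor_fun t)" for t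
  proof (cases k)
    case 0
    then show ?thesis
      using inj[of t 0] zero diff_lin(3)[OF \<theta>(1)[OF g], of N br "\<lambda>x. \<eta> [x]"]
      by (auto simp: twisted_coboundaries_def)
  next
    case (Suc j)
    have "t \<in> ?B \<longleftrightarrow> (\<exists>s\<in>?S j. tensor_fun t = tensor_fun (?tw s))"
      using Suc inj by (auto simp: twisted_coboundaries_def)
    also have "\<dots> \<longleftrightarrow> (\<exists>s\<in>?S j. ?d (tensor_fun s) = tensor_fun t)"
      by (rule bex_cong[OF refl], subst twisted_diff_pure[OF \<eta> g]) auto
    also have "\<dots> \<longleftrightarrow> (\<exists>w\<in>tensor_fun ` ?S j. ?d w = tensor_fun t)" by simp
    finally show ?thesis using Suc img[of j] by simp
  qed
  have "c *\<^sub>C t \<in> ?B" if tB: "t \<in> ?B" for c t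
  proof -
    obtain w where w: "below N k w" "?d w = tensor_fun t" using tB[unfolded B] by blast
    have "?d (c *\<^sub>C w) = tensor_fun (c *\<^sub>C t)"
      using w(2) by (simp add: diff_lin[OF \<theta>(1)[OF g]] tensor_fun(1)[unfolded clinear_iff])
    then show ?thesis unfolding B using below_lin(2)[OF w(1)] by (intro exI[of _ "c *\<^sub>C w"]) simp
  qed
  then have "quot_dim ?Z ?B \<ge> enat 1 \<longleftrightarrow> (\<exists>t\<in>?Z. t \<notin> ?B)" by (rule quot_dim_ge_1)
  also have "\<dots> \<longleftrightarrow> (\<exists>t\<in>?S k. ?d (tensor_fun t) = 0 \<and> \<not> (\<exists>w. below N k w \<and> ?d w = tensor_fun t))"
    unfolding B Bex_def Z by (simp only: conj_assoc)
  also have "\<dots> \<longleftrightarrow> (\<exists>z\<in>tensor_fun ` ?S k. ?d z = 0 \<and> \<not> (\<exists>w. below N k w \<and> ?d w = z))"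
    by simp
  finally show ?thesis unfolding img nonzero_coh_def by simp
qed

text \<open>The value at \<open>x\<close> of a connection, read as a linear map from \<open>N\<close> to matrices.\<close>

definition ev :: "'n \<Rightarrow> ('n list \<Rightarrow> complex, complex^2^2) tensor \<Rightarrow> complex^2^2"
  where "ev x t = tensor_fun t [x]"

lemma ev_lin: "clinear (ev x)" "ev x (\<alpha> \<otimes>\<^sub>C g) = \<alpha> [x] *\<^sub>C g"
  by (simp_all add: ev_def clinear_iff tensor_fun_add tensor_fun_scale tensor_fun(2))

lemma ev_carrier:
  assumes "t \<in> tensor_sub (alt_forms N 1) (lie_carrier G)"
  shows "ev x t \<in> lie_carrier G"
proof -
  have "tensor_sub (alt_forms N 1) (lie_carrier G) \<subseteq> {t. ev x t \<in> lie_carrier G}"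
    unfolding tensor_sub_def
  proof (rule cvs.span_minimal)
    show "cvs.subspace {t. ev x t \<in> lie_carrier G}"
      using ev_lin(1)[of x] G_simps(1) clinear_0[OF ev_lin(1)] unfolding cvs.subspace_def
      by (simp add: clinear_iff)
  qed (auto simp: ev_lin(2) cvs.subspace_scale[OF G_simps(1)])
  then show ?thesis using assms by blast
qed

lemma conn_diff_ev:
  assumes t: "t \<in> tensor_sub (alt_forms N 1) (lie_carrier G)" and x: "x \<in> N" "y \<in> N"
  shows "tensor_fun (conn_diff (CE L) G t) [x, y] = - ev (br x y) t"
proof -
  let ?F = "\<lambda>\<alpha> (g :: complex^2^2). ce_diff L \<alpha> \<otimes>\<^sub>C g"
  have "bilinear_on (dg_total (CE L)) (lie_carrier G) ?F"
    by (rule bilinear_pure) (simp_all add: ce_diff_lin)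
  then obtain e where e: "clinear e"
    "\<And>t. t \<in> tensor_sub (dg_total (CE L)) (lie_carrier G) \<Longrightarrow>
      tensor_extend (dg_total (CE L)) (lie_carrier G) ?F t = e t"
    "\<And>\<alpha> g. \<alpha> \<in> dg_total (CE L) \<Longrightarrow> g \<in> lie_carrier G \<Longrightarrow> e (\<alpha> \<otimes>\<^sub>C g) = ?F \<alpha> g"
    using tensor_extend_ex[OF subspace_dg_total G_simps(1)] by blast
  have "tensor_fun (e t) [x, y] = - ev (br x y) t"
  proof (rule clinear_eq_on_span[OF _ _ _ t[unfolded tensor_sub_def]])
    show "clinear (\<lambda>t. tensor_fun (e t) [x, y])"
      using e(1) by (simp add: clinear_iff tensor_fun_add tensor_fun_scale)
    show "clinear (\<lambda>t. - ev (br x y) t)"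
      using ev_lin(1)[of "br x y"] by (simp add: clinear_iff)
    fix b :: "('n list \<Rightarrow> complex, complex^2^2) tensor"
    assume "b \<in> {u \<otimes>\<^sub>C w |u w. u \<in> alt_forms N 1 \<and> w \<in> lie_carrier G}"
    then obtain \<alpha> g where b: "b = \<alpha> \<otimes>\<^sub>C g" "\<alpha> \<in> alt_forms N 1" "g \<in> lie_carrier G" by blast
    have "\<alpha> \<in> dg_total (CE L)" using b(2) alt_forms_dg_total by blast
    then show "tensor_fun (e b) [x, y] = - ev (br x y) b"
      using x by (simp add: b(1,3) e(3) tensor_fun(2) ev_lin(2) ce_diff_one_form[OF b(2)])
  qed
  moreover have "t \<in> tensor_sub (dg_total (CE L)) (lie_carrier G)"
    using t tensor_sub_mono[OF alt_forms_dg_total order_refl] by blast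
  ultimately show ?thesis using e(2) by (simp add: conn_diff_def)
qed

lemma wedge_one_one:
  assumes "\<alpha> \<in> alt_forms N 1" "\<beta> \<in> alt_forms N 1"
  shows "wedge \<alpha> \<beta> [x, y] = \<alpha> [x] * \<beta> [y] - \<alpha> [y] * \<beta> [x]"
  by (simp add: wedge_one_form[OF assms(1)] iota_def)

lemma conn_bracket_ev:
  assumes s: "s \<in> tensor_sub (alt_forms N 1) (lie_carrier G)"
    and t: "t \<in> tensor_sub (alt_forms N 1) (lie_carrier G)"
  shows "tensor_fun (conn_bracket (CE L) G s t) [x, y]
    = commutator (ev x s) (ev y t) - commutator (ev y s) (ev x t)"
proof -
  let ?U = "dg_total (CE L)" and ?W = "lie_carrier G"
  obtain ps where ps: "set ps \<subseteq> alt_forms N 1 \<times> ?W" "t = (\<Sum>(\<beta>, h)\<leftarrow>ps. \<beta> \<otimes>\<^sub>C h)"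
    using tensor_sub_list[OF subspace_alt_forms[OF N] t] by blast
  have ps': "set ps \<subseteq> ?U \<times> ?W" using ps(1) alt_forms_dg_total by blast
  let ?F = "\<lambda>\<alpha> g. tensor_extend ?U ?W (\<lambda>\<beta> h. wedge \<alpha> \<beta> \<otimes>\<^sub>C commutator g h) t"
  have F: "?F \<alpha> g = (\<Sum>(\<beta>, h)\<leftarrow>ps. wedge \<alpha> \<beta> \<otimes>\<^sub>C commutator g h)" for \<alpha> g
    unfolding ps(2)
    by (rule tensor_extend_sum[OF subspace_dg_total G_simps(1) _ ps'], rule bilinear_pure)
      (simp_all add: wedge_linear clinear_commutator[unfolded clinear_iff])
  have "bilinear_on ?U ?W ?F"
    unfolding F bilinear_on_def
    by (induction ps) (auto simp: wedge_linear clinear_commutator(2)[unfolded clinear_iff]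
        pure_tensor_add pure_tensor_scale scaleC_add_right algebra_simps)
  then obtain e where e: "clinear e"
    "\<And>t. t \<in> tensor_sub ?U ?W \<Longrightarrow> tensor_extend ?U ?W ?F t = e t"
    "\<And>\<alpha> g. \<alpha> \<in> ?U \<Longrightarrow> g \<in> ?W \<Longrightarrow> e (\<alpha> \<otimes>\<^sub>C g) = ?F \<alpha> g"
    using tensor_extend_ex[OF subspace_dg_total G_simps(1)] by blast
  have ev_t: "ev z t = (\<Sum>(\<beta>, h)\<leftarrow>ps. \<beta> [z] *\<^sub>C h)" for z
    unfolding ps(2) clinear_sum_list[OF ev_lin(1)]
    by (simp add: case_prod_unfold ev_lin(2))
  have "tensor_fun (e s) [x, y] = commutator (ev x s) (ev y t) - commutator (ev y s) (ev x t)"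
  proof (rule clinear_eq_on_span[OF _ _ _ s[unfolded tensor_sub_def]])
    show "clinear (\<lambda>s. tensor_fun (e s) [x, y])"
      using e(1) by (simp add: clinear_iff tensor_fun_add tensor_fun_scale)
    show "clinear (\<lambda>s. commutator (ev x s) (ev y t) - commutator (ev y s) (ev x t))"
      using ev_lin(1)[of x] ev_lin(1)[of y] clinear_commutator(2)
      by (simp add: clinear_iff cvs.scale_right_diff_distrib)
    fix b :: "('n list \<Rightarrow> complex, complex^2^2) tensor"
    assume "b \<in> {u \<otimes>\<^sub>C w |u w. u \<in> alt_forms N 1 \<and> w \<in> ?W}"
    then obtain \<alpha> g where b: "b = \<alpha> \<otimes>\<^sub>C g" "\<alpha> \<in> alt_forms N 1" "g \<in> ?W" by blast
    have "\<alpha> \<in> ?U" using b(2) alt_forms_dg_total by blast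
    then have eb: "e b = (\<Sum>(\<beta>, h)\<leftarrow>ps. wedge \<alpha> \<beta> \<otimes>\<^sub>C commutator g h)" using e(3) b(1,3) F by simp
    have lin: "clinear (\<lambda>t :: ('n list \<Rightarrow> complex, complex^2^2) tensor. tensor_fun t [x, y])"
      by (simp add: clinear_iff tensor_fun_add tensor_fun_scale)
    have "tensor_fun (e b) [x, y] = (\<Sum>(\<beta>, h)\<leftarrow>ps. wedge \<alpha> \<beta> [x, y] *\<^sub>C commutator g h)"
      unfolding eb clinear_sum_list[OF lin] by (simp add: tensor_fun(2) case_prod_unfold)
    also have "\<dots> = (\<Sum>(\<beta>, h)\<leftarrow>ps. (\<alpha> [x] * \<beta> [y] - \<alpha> [y] * \<beta> [x]) *\<^sub>C commutator g h)"
      by (rule arg_cong[where f = sum_list], rule map_cong) (use ps(1) in \<open>auto simp: wedge_one_one[OF b(2)]\<close>)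
    also have "\<dots> = commutator (ev x b) (\<Sum>(\<beta>, h)\<leftarrow>ps. \<beta> [y] *\<^sub>C h) - commutator (ev y b) (\<Sum>(\<beta>, h)\<leftarrow>ps. \<beta> [x] *\<^sub>C h)"
      unfolding b(1) ev_lin(2)
      by (induction ps) (auto simp: clinear_commutator[unfolded clinear_iff] clinear_0[OF clinear_commutator(1)]
          cvs.scale_left_diff_distrib scaleC_scaleC scaleC_add_right algebra_simps)
    finally show "tensor_fun (e b) [x, y] = commutator (ev x b) (ev y t) - commutator (ev y b) (ev x t)"
      unfolding ev_t .
  qed
  moreover have "s \<in> tensor_sub ?U ?W"
    using s tensor_sub_mono[OF alt_forms_dg_total order_refl] by blast
  ultimately show ?thesis using e(2) by (simp add: conn_bracket_def G_simps(3))
qed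

text \<open>
  On two vectors the term \<open>[\<omega>, \<omega>]\<close> counts \<open>[\<omega> x, \<omega> y]\<close> twice, which the factor \<open>1/2\<close> undoes.
\<close>

lemma flat_hom:
  assumes \<omega>: "\<omega> \<in> flat_connections (CE L) G" and x: "x \<in> N" "y \<in> N"
  shows "ev (br x y) \<omega> = commutator (ev x \<omega>) (ev y \<omega>)"
proof -
  have t: "\<omega> \<in> tensor_sub (alt_forms N 1) (lie_carrier G)"
    and z: "conn_diff (CE L) G \<omega> + (1/2) *\<^sub>C conn_bracket (CE L) G \<omega> \<omega> = 0"
    using \<omega> by (simp_all add: flat_connections_def)
  have "tensor_fun (conn_diff (CE L) G \<omega> + (1/2) *\<^sub>C conn_bracket (CE L) G \<omega> \<omega>) [x, y] = 0"
    unfolding z by (simp add: clinear_0[OF tensor_fun(1)] fun_apply)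
  then have "- ev (br x y) \<omega> + (1/2) *\<^sub>C (commutator (ev x \<omega>) (ev y \<omega>) - commutator (ev y \<omega>) (ev x \<omega>)) = 0"
    by (simp only: tensor_fun_add tensor_fun_scale conn_diff_ev[OF t x] conn_bracket_ev[OF t t])
  moreover have "(1/2) *\<^sub>C (X - (- X)) = X" for X :: "complex^2^2"
  proof -
    have "(1/2) *\<^sub>C (X - (- X)) = (1/2 + 1/2) *\<^sub>C X"
      by (simp only: diff_minus_eq_add scaleC_add_right scaleC_add_left)
    then show ?thesis by (simp add: scaleC_one)
  qed
  ultimately show ?thesis
    by (simp only: commutator_swap[of "ev y \<omega>" "ev x \<omega>"]) simp
qed

text \<open>
  The image of a flat connection is a nilpotent subalgebra of \<open>sl2\<close>, hence spanned by one element.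
\<close>

lemma flat_pure:
  assumes \<omega>: "\<omega> \<in> flat_connections (CE L) G"
  shows "\<exists>\<eta> g. \<omega> = \<eta> \<otimes>\<^sub>C g \<and> \<eta> \<in> alt_forms N 1 \<and> ce_diff L \<eta> = 0 \<and> g \<in> lie_carrier G"
proof -
  have t: "\<omega> \<in> tensor_sub (alt_forms N 1) (lie_carrier G)"
    using \<omega> by (simp add: flat_connections_def)
  let ?W = "\<lambda>x. ev x \<omega>" and ?\<phi> = "tensor_fun \<omega>"
  have alt\<phi>: "alt N 1 ?\<phi>"
    using tensor_fun_image[OF finite_dim_matrix N, of 1]
      tensor_sub_mono[of "alt_forms N 1" "alt_forms N 1" "lie_carrier G" UNIV] t by blast
  have add: "?W (x + y) = ?W x + ?W y" if "x \<in> N" "y \<in> N" for x y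
    using alt_append_add[OF alt\<phi>, of "[]" x y "[]"] that by (simp add: ev_def)
  obtain M where M: "\<And>x y. x \<in> N \<Longrightarrow> y \<in> N \<Longrightarrow> (br x ^^ M) y = 0"
    using nilpotent_lie_ad[OF nil] by metis
  have "(br x ^^ i) y \<in> N \<and> ?W ((br x ^^ i) y) = (commutator (?W x) ^^ i) (?W y)"
    if "x \<in> N" "y \<in> N" for x y i
    by (induction i) (use that lie_onD(2)[OF L] flat_hom[OF \<omega>] in auto)
  moreover have W0: "?W 0 = 0"
    using alt_append_scale[OF alt\<phi>, of "[]" 0 0 "[]"] cvs.subspace_0[OF N] by (simp add: ev_def)
  ultimately have nilW: "(commutator (?W x) ^^ M) (?W y) = 0" if "x \<in> N" "y \<in> N" for x y
    using M that by metis
  have tr: "trace (?W x) = 0" for x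
    using ev_carrier[OF t] G_simps(2) by blast
  have comm: "commutator (?W x) (?W y) = 0" if "x \<in> N" "y \<in> N" for x y
  proof (rule nilpotent_commute[of "?W ` N" M])
    show "X + Y \<in> ?W ` N" if XY: "X \<in> ?W ` N" "Y \<in> ?W ` N" for X Y
    proof -
      obtain a b where ab: "a \<in> N" "b \<in> N" "X = ?W a" "Y = ?W b" using XY by blast
      then have "X + Y = ?W (a + b)" using add by simp
      then show ?thesis using cvs.subspace_add[OF N ab(1,2)] by blast
    qed
  qed (use that tr nilW in auto)
  show ?thesis
  proof (cases "\<forall>x\<in>N. ?W x = 0")
    case True
    have "?\<phi> = 0" by (rule alt_1_eqI[OF alt\<phi>]) (use True in \<open>simp_all add: ev_def fun_apply\<close>)
    then have "\<omega> = 0 \<otimes>\<^sub>C 0"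
      using inj_tensor_fun[OF finite_dim_matrix, of \<omega> 0] by (simp add: clinear_0[OF tensor_fun(1)])
    moreover have "(0 :: 'n list \<Rightarrow> complex) \<in> alt_forms N 1" by (simp add: alt_forms_iff[OF N])
    moreover have "ce_diff L 0 = 0" using ce_diff_lin(2)[of L 0 0] by simp
    ultimately show ?thesis using cvs.subspace_0[OF G_simps(1)] by blast
  next
    case False
    then obtain x0 where x0: "x0 \<in> N" "?W x0 \<noteq> 0" by blast
    define g where "g = ?W x0"
    have "\<exists>h. clinear h \<and> h g = (1::complex)"
      by (rule separating_functional[OF cvs.subspace_single_0, of g]) (use x0 g_def in auto)
    then obtain h where h: "clinear h" "h g = (1::complex)" by blast
    define \<eta> where "\<eta> = h \<circ> ?\<phi>"
    have alt\<eta>: "alt N 1 \<eta>" unfolding \<eta>_def by (rule alt_comp[OF h(1) alt\<phi>])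
    then have \<eta>: "\<eta> \<in> alt_forms N 1" by (simp add: alt_forms_iff[OF N])
    have multiple: "\<exists>c. ?W x = c *\<^sub>C g" if "x \<in> N" for x
      unfolding g_def
      by (rule commuting_proportional[OF tr tr comm[OF x0(1) that] x0(2)])
    have W: "?W x = \<eta> [x] *\<^sub>C g" if xN: "x \<in> N" for x
    proof -
      obtain c where "?W x = c *\<^sub>C g" using multiple[OF xN] by blast
      then show ?thesis using h by (simp add: \<eta>_def ev_def clinear_iff scaleC_complex_def)
    qed
    have "?\<phi> = tensor_fun (\<eta> \<otimes>\<^sub>C g)"
    proof (rule alt_1_eqI[OF alt\<phi>])
      show "alt N 1 (tensor_fun (\<eta> \<otimes>\<^sub>C g))"
        using alt_comp[OF clinear_multiples[of g] alt\<eta>] by (simp add: tensor_fun(2) comp_def)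
      show "?\<phi> [x] = tensor_fun (\<eta> \<otimes>\<^sub>C g) [x]" if "x \<in> N" for x
        using W[OF that] by (simp add: ev_def tensor_fun(2))
    qed
    then have "\<omega> = \<eta> \<otimes>\<^sub>C g" by (rule inj_tensor_fun[OF finite_dim_matrix])
    moreover have "ce_diff L \<eta> = 0"
    proof
      fix xs
      have "\<eta> [br x y] = 0" if "x \<in> N" "y \<in> N" for x y
      proof -
        have "\<eta> [br x y] *\<^sub>C g = 0"
          using W[OF lie_onD(2)[OF L that]] flat_hom[OF \<omega> that] comm[OF that] by simp
        then show ?thesis using x0(2) by (simp add: g_def)
      qed
      moreover have "xs ! 0 \<in> N" "xs ! 1 \<in> N" if "length xs = 2" "set xs \<subseteq> N"
        using that nth_mem[of 0 xs] nth_mem[of 1 xs] by auto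
      ultimately show "ce_diff L \<eta> xs = 0 xs"
        by (simp add: ce_diff_one_form[OF \<eta>] fun_apply)
    qed
    moreover have "g \<in> lie_carrier G" unfolding g_def by (rule ev_carrier[OF t])
    ultimately show ?thesis using \<eta> by blast
  qed
qed

lemma pure_flat:
  assumes \<eta>: "\<eta> \<in> alt_forms N 1" "ce_diff L \<eta> = 0" and g: "g \<in> lie_carrier G"
  shows "\<eta> \<otimes>\<^sub>C g \<in> flat_connections (CE L) G"
proof -
  let ?U = "dg_total (CE L)" and ?W = "lie_carrier G"
  have \<eta>U: "\<eta> \<in> ?U" using \<eta>(1) alt_forms_dg_total by blast
  have "tensor_extend ?U ?W (\<lambda>\<alpha> x. ce_diff L \<alpha> \<otimes>\<^sub>C x) (\<eta> \<otimes>\<^sub>C g) = ce_diff L \<eta> \<otimes>\<^sub>C g"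
    by (rule tensor_extend_pure[OF subspace_dg_total G_simps(1) _ \<eta>U g], rule bilinear_pure)
      (simp_all add: ce_diff_lin)
  then have 1: "conn_diff (CE L) G (\<eta> \<otimes>\<^sub>C g) = 0" using \<eta>(2) by (simp add: conn_diff_def)
  have inner: "tensor_extend ?U ?W (\<lambda>\<beta> y. wedge \<alpha> \<beta> \<otimes>\<^sub>C commutator x y) (\<eta> \<otimes>\<^sub>C g)
      = wedge \<alpha> \<eta> \<otimes>\<^sub>C commutator x g" for \<alpha> x
    by (rule tensor_extend_pure[OF subspace_dg_total G_simps(1) _ \<eta>U g], rule bilinear_pure)
      (simp_all add: wedge_linear clinear_commutator[unfolded clinear_iff])
  have "tensor_extend ?U ?W (\<lambda>\<alpha> x. wedge \<alpha> \<eta> \<otimes>\<^sub>C commutator x g) (\<eta> \<otimes>\<^sub>C g)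
      = wedge \<eta> \<eta> \<otimes>\<^sub>C commutator g g"
    by (rule tensor_extend_pure[OF subspace_dg_total G_simps(1) _ \<eta>U g], rule bilinear_pure)
      (simp_all add: wedge_linear clinear_commutator[unfolded clinear_iff])
  then have "conn_bracket (CE L) G (\<eta> \<otimes>\<^sub>C g) (\<eta> \<otimes>\<^sub>C g) = 0"
    by (simp add: conn_bracket_def G_simps(3) inner commutator_self)
  then show ?thesis using 1 \<eta>(1) g by (simp add: flat_connections_def tensor_subI)
qed

lemma resonance_iff:
  "\<omega> \<in> resonance (CE L) G \<theta> k 1 \<longleftrightarrow> (\<exists>\<eta> g. \<omega> = \<eta> \<otimes>\<^sub>C g \<and> \<eta> \<in> alt_forms N 1 \<and>
    ce_diff L \<eta> = 0 \<and> g \<in> lie_carrier G \<and> nonzero_coh N br (\<lambda>x. \<eta> [x]) (\<theta> g) k)"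
  using flat_pure pure_flat quot_dim_pure unfolding resonance_def by (auto; metis)

lemma resonance_above_dim:
  assumes "k > cvs.dim N"
  shows "resonance (CE L) G \<theta> k 1 = {}"
proof -
  have "\<not> nonzero_coh N br \<eta> (\<theta> g) k" if "g \<in> lie_carrier G" for \<eta> g
  proof -
    have "diff N br \<eta> (\<theta> g) 0 = 0" by (rule diff_lin(3)[OF \<theta>(1)[OF that]])
    then show ?thesis
      unfolding nonzero_coh_def using alt_above_dim[OF N fin assms] below_lin(5) by metis
  qed
  then show ?thesis using resonance_iff by blast
qed

lemma zero_in_Pi: "0 \<in> Pi_set (CE L) G \<theta>"
proof -
  have 0: "0 \<in> lie_carrier G" by (rule cvs.subspace_0[OF G_simps(1)])
  have "\<theta> 0 v = 0" for v using \<theta>(3)[OF 0, of 0] by simp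
  then have "endo_det (\<theta> 0) = 0" using endo_det_eq_0_iff[OF V(1) \<theta>(1)[OF 0]] V(2) by simp
  moreover have "(0 :: 'n list \<Rightarrow> complex) \<in> alt_forms N 1" by (simp add: alt_forms_iff[OF N])
  moreover have "ce_diff L 0 = 0" using ce_diff_lin(2)[of L 0 0] by simp
  moreover have "(0 :: ('n list \<Rightarrow> complex, complex^2^2) tensor) = 0 \<otimes>\<^sub>C 0" by simp
  ultimately show ?thesis unfolding Pi_set_def mem_Collect_eq CE_simps using 0 by blast
qed

lemma nonzero_coh_singular:
  assumes \<eta>: "\<eta> \<in> alt_forms N 1" "ce_diff L \<eta> = 0" "\<exists>x\<in>N. \<eta> [x] \<noteq> 0" and g: "g \<in> lie_carrier G"
    and coh: "nonzero_coh N br (\<lambda>x. \<eta> [x]) (\<theta> g) k"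
  shows "endo_det (\<theta> g) = 0"
proof (rule ccontr)
  let ?T = "\<theta> g"
  note T = \<theta>(1)[OF g]
  assume "endo_det ?T \<noteq> 0"
  then have inj0: "?T v \<noteq> 0" if "v \<noteq> 0" for v using endo_det_eq_0_iff[OF V(1) T] that by blast
  have inj: "inj ?T"
  proof (rule injI)
    fix u v assume "?T u = ?T v"
    then have "?T (u - v) = 0" by (simp add: clinear_diff[OF T])
    then show "u = v" using inj0[of "u - v"] by auto
  qed
  then have surj: "surj ?T" by (rule inj_imp_surj(1)[OF V(1) T])
  have T': "clinear (inv_into UNIV ?T)"
  proof -
    have "inv_into UNIV ?T (u + v) = inv_into UNIV ?T u + inv_into UNIV ?T v" "inv_into UNIV ?T (c *\<^sub>C u) = c *\<^sub>C inv_into UNIV ?T u" for u v c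
      by (rule injD[OF inj], simp add: surj_f_inv_f[OF surj] T[unfolded clinear_iff])+
    then show ?thesis by (simp add: clinear_iff)
  qed
  obtain y where y: "y \<in> N" "\<eta> [y] \<noteq> 0" using \<eta>(3) by blast
  define x where "x = inverse (\<eta> [y]) *\<^sub>C y"
  have x: "x \<in> N" "\<eta> [x] = 1"
    using y one_form(2)[OF \<eta>(1) y(1)] by (simp_all add: x_def cvs.subspace_scale[OF N])
  obtain M where M: "\<And>x y. x \<in> N \<Longrightarrow> y \<in> N \<Longrightarrow> (br x ^^ M) y = 0"
    using nilpotent_lie_ad[OF nil] by metis
  have "\<exists>w. below N k w \<and> diff N br (\<lambda>x. \<eta> [x]) ?T w = z"
    if "alt N k z" "diff N br (\<lambda>x. \<eta> [x]) ?T z = 0" for z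
    by (rule cocycle_exact[OF L T T' _ _ _ x M[OF x(1)] that])
      (simp_all add: surj_f_inv_f[OF surj] inv_f_f[OF inj] closed_one_form[OF \<eta>(1,2)])
  then show False using coh unfolding nonzero_coh_def by blast
qed

text \<open>
  Singularity provides both a vector killed by \<open>T\<close> and a functional that vanishes on its range.
\<close>

lemma singular_nonzero_coh:
  assumes \<eta>: "\<eta> \<in> alt_forms N 1" "ce_diff L \<eta> = 0" and g: "g \<in> lie_carrier G"
    and det: "endo_det (\<theta> g) = 0" and k: "k \<le> cvs.dim N"
  shows "nonzero_coh N br (\<lambda>x. \<eta> [x]) (\<theta> g) k"
proof -
  let ?T = "\<theta> g"
  note T = \<theta>(1)[OF g]
  obtain v0 where v0: "v0 \<noteq> 0" "?T v0 = 0" using det endo_det_eq_0_iff[OF V(1) T] by blast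
  have "\<not> inj ?T" using v0 clinear_0[OF T] by (metis injD)
  then have "\<not> surj ?T" using inj_imp_surj(2)[OF V(1) T] by blast
  then obtain v1 where v1: "v1 \<notin> range ?T" by blast
  have "\<exists>f. clinear f \<and> (\<forall>v. f (?T v) = 0) \<and> f v1 = (1::complex)"
    by (rule separating_functional[OF subspace_range[OF T] v1]) blast
  then obtain f where f: "clinear f" "\<And>v. f (?T v) = 0" "f v1 = (1::complex)" by blast
  show ?thesis
    by (rule coh_nonzero[OF nil fin _ _ _ T v0 f k])
      (simp_all add: one_form[OF \<eta>(1)] closed_one_form[OF \<eta>])
qed

lemma resonance_eq_Pi:
  assumes k: "k \<le> cvs.dim N"
  shows "resonance (CE L) G \<theta> k 1 = Pi_set (CE L) G \<theta>"
proof (intro subset_antisym subsetI)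
  fix \<omega> assume "\<omega> \<in> resonance (CE L) G \<theta> k 1"
  then obtain \<eta> g where \<omega>: "\<omega> = \<eta> \<otimes>\<^sub>C g" "\<eta> \<in> alt_forms N 1" "ce_diff L \<eta> = 0" "g \<in> lie_carrier G"
    "nonzero_coh N br (\<lambda>x. \<eta> [x]) (\<theta> g) k"
    unfolding resonance_iff by blast
  show "\<omega> \<in> Pi_set (CE L) G \<theta>"
  proof (cases "\<exists>x\<in>N. \<eta> [x] \<noteq> 0")
    case True
    then have "endo_det (\<theta> g) = 0" using nonzero_coh_singular \<omega> by blast
    then show ?thesis using \<omega> by (auto simp: Pi_set_def)
  next
    case False
    have "\<eta> = 0"
      by (rule alt_1_eqI[OF alt_forms_alt[OF \<omega>(2)] alt_zero]) (use False in \<open>simp add: fun_apply\<close>)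
    then show ?thesis using \<omega>(1) zero_in_Pi by simp
  qed
next
  fix \<omega> assume "\<omega> \<in> Pi_set (CE L) G \<theta>"
  then obtain \<eta> g where \<omega>: "\<omega> = \<eta> \<otimes>\<^sub>C g" "\<eta> \<in> alt_forms N 1" "ce_diff L \<eta> = 0" "g \<in> lie_carrier G"
    "endo_det (\<theta> g) = 0"
    by (auto simp: Pi_set_def)
  then show "\<omega> \<in> resonance (CE L) G \<theta> k 1"
    unfolding resonance_iff using singular_nonzero_coh[OF _ _ _ _ k] by blast
qed

end

section \<open>The group algebra\<close>

declare aug_pow.simps(2) [simp del]

abbreviation pt :: "'p::group_add \<Rightarrow> 'p \<Rightarrow>\<^sub>0 complex"
  where "pt g \<equiv> Poly_Mapping.single g 1"

definition dpt :: "'p::group_add \<Rightarrow> 'p \<Rightarrow>\<^sub>0 complex"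
  where "dpt g = pt g - 1"

lemma pt_mult: "pt g * pt h = pt (g + h)"
  by (simp add: mult_single)

lemma pt_0: "pt 0 = 1"
  by (simp add: single_one)

lemma dpt_0 [simp]: "dpt 0 = 0"
  by (simp add: dpt_def pt_0)

lemma dpt_add: "dpt (g + h) = dpt g + dpt h + dpt g * dpt h"
  by (simp add: dpt_def algebra_simps flip: pt_mult)

lemma clinear_augmentation: "clinear augmentation"
  by (simp add: clinear_iff augmentation_def lin_ext_add lin_ext_scaleC)

lemma clinear_push: "clinear (push f)"
  by (simp add: clinear_iff push_def lin_ext_add lin_ext_scaleC)

lemma clinear_mult:
  "clinear (\<lambda>x :: 'p::monoid_add \<Rightarrow>\<^sub>0 complex. a * x)" "clinear (\<lambda>x :: 'p \<Rightarrow>\<^sub>0 complex. x * a)"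
  unfolding clinear_iff
  by (intro conjI allI distrib_left distrib_right scaleC_mult_left scaleC_mult_right)+

lemma push_pt: "push f (pt g) = pt (f g)"
  by (simp add: push_def lin_ext_single scaleC_one)

lemma augmentation_dpt: "augmentation (dpt g) = 0"
  by (simp add: dpt_def augmentation_def lin_ext_diff lin_ext_single scaleC_complex_def flip: single_one)

lemma group_algebra_linear_eqI:
  assumes "clinear f" "clinear f'" "\<And>g. f (pt g) = f' (pt g)"
  shows "f x = f' x"
proof (induction x rule: group_algebra_induct)
  case zero
  show ?case by (simp add: clinear_0[OF assms(1)] clinear_0[OF assms(2)])
next
  case (add x k c)
  have "Poly_Mapping.single k c = c *\<^sub>C pt k"
    by (rule poly_mapping_eqI) (simp add: lookup_single when_def scaleC_complex_def)
  then show ?case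
    using add assms by (simp add: clinear_iff)
qed

lemma aug_pow_Suc_0: "r \<in> aug_pow (Suc 0) \<longleftrightarrow> augmentation r = 0"
proof
  assume "augmentation r = 0"
  then have "r * 1 \<in> aug_pow (Suc 0)"
    unfolding aug_pow.simps(2) by (intro cvs.span_base CollectI exI[of _ r] exI[of _ 1]) simp
  then show "r \<in> aug_pow (Suc 0)" by simp
qed (rule augmentation_aug_pow_Suc)

lemma dpt_aug_pow: "dpt g \<in> aug_pow (Suc 0)"
  by (simp add: aug_pow_Suc_0 augmentation_dpt)

lemma aug_pow_mult: "a \<in> aug_pow i \<Longrightarrow> b \<in> aug_pow j \<Longrightarrow> a * b \<in> aug_pow (i + j)"
proof (induction i arbitrary: a)
  case 0
  then show ?case by (simp add: aug_pow_left)
next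
  case (Suc i)
  from Suc.prems(1) have "a \<in> cvs.span {a * b |a b. augmentation a = 0 \<and> b \<in> aug_pow i}" by (simp add: aug_pow.simps(2))
  then show ?case
  proof (induction a rule: cvs.span_induct_alt)
    case base
    then show ?case by (simp only: mult_zero_left aug_pow_simps)
  next
    case (step c x y)
    then obtain u v where "x = u * v" "augmentation u = 0" "v \<in> aug_pow i" by auto
    then have "x * b = u * (v * b)" "v * b \<in> aug_pow (i + j)"
      using Suc.IH Suc.prems(2) by (auto simp: mult.assoc)
    then have "x * b \<in> aug_pow (Suc i + j)"
      using \<open>augmentation u = 0\<close> by (auto simp: aug_pow.simps(2) intro: cvs.span_base)
    then show ?case
      using step by (simp only: distrib_right scaleC_mult_left aug_pow_simps)
  qed
qed

lemma aug_pow_Suc_subset: "aug_pow (Suc n) \<subseteq> aug_pow n"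
  unfolding aug_pow.simps(2)
  by (rule cvs.span_minimal) (auto simp: subspace_aug_pow aug_pow_left)

lemma aug_pow_mono: "i \<le> j \<Longrightarrow> aug_pow j \<subseteq> aug_pow i"
  by (rule lift_Suc_antimono_le) (rule aug_pow_Suc_subset)

lemma dpt_mult_aug_pow: "b \<in> aug_pow n \<Longrightarrow> dpt g * b \<in> aug_pow (Suc n)"
  using aug_pow_mult[OF dpt_aug_pow, of b n g] by simp

lemma aug_ideal_span: "augmentation r = 0 \<Longrightarrow> r \<in> cvs.span (range dpt)"
proof -
  have "r - augmentation r *\<^sub>C 1 \<in> cvs.span (range dpt)"
  proof (induction r rule: group_algebra_induct)
    case zero
    then show ?case by (simp add: augmentation_def lin_ext_zero cvs.span_zero)
  next
    case (add x k c)
    have "Poly_Mapping.single k c = c *\<^sub>C pt k"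
      by (rule poly_mapping_eqI) (simp add: lookup_single when_def scaleC_complex_def)
    then have eq: "x + Poly_Mapping.single k c - augmentation (x + Poly_Mapping.single k c) *\<^sub>C 1
        = (x - augmentation x *\<^sub>C 1) + c *\<^sub>C dpt k"
      by (simp add: augmentation_def lin_ext_add lin_ext_scaleC lin_ext_single dpt_def scaleC_one
          scaleC_add_left cvs.scale_right_diff_distrib scaleC_complex_def)
    show ?case unfolding eq by (intro cvs.span_add cvs.span_scale cvs.span_base add) blast
  qed
  then show "augmentation r = 0 \<Longrightarrow> r \<in> cvs.span (range dpt)" by simp
qed

lemma span_mult:
  fixes a b :: "'p::monoid_add \<Rightarrow>\<^sub>0 complex"
  assumes "a \<in> cvs.span A" "b \<in> cvs.span B"
  shows "a * b \<in> cvs.span {p * q |p q. p \<in> A \<and> q \<in> B}"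
  using assms(1)
proof (induction a rule: cvs.span_induct_alt)
  case base
  then show ?case by (simp add: cvs.span_zero)
next
  case (step c x y)
  have "x * b \<in> cvs.span {p * q |p q. p \<in> A \<and> q \<in> B}"
    using assms(2)
  proof (induction b rule: cvs.span_induct_alt)
    case base
    then show ?case by (simp add: cvs.span_zero)
  next
    case (step d u v)
    have "x * u \<in> cvs.span {p * q |p q. p \<in> A \<and> q \<in> B}"
      using \<open>x \<in> A\<close> step(1) by (intro cvs.span_base) blast
    then show ?case
      using step by (simp add: distrib_left scaleC_mult_right cvs.span_add cvs.span_scale)
  qed
  then show ?case
    using step by (simp add: distrib_right scaleC_mult_left cvs.span_add cvs.span_scale)
qed

abbreviation dpts :: "'p::group_add list \<Rightarrow> 'p \<Rightarrow>\<^sub>0 complex"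
  where "dpts gs \<equiv> prod_list (map dpt gs)"

lemma dpts_aug_pow: "dpts gs \<in> aug_pow (length gs)"
  by (induction gs) (simp_all add: dpt_mult_aug_pow)

lemma aug_pow_span:
  "aug_pow (Suc n) \<subseteq> cvs.span {dpts gs |gs :: 'a::group_add list. length gs = Suc n}"
proof (induction n)
  case 0
  have "dpt g \<in> cvs.span {dpts gs |gs. length gs = Suc 0}" for g :: 'a
    by (rule cvs.span_base) (auto intro!: exI[of _ "[g]"])
  then have "cvs.span (range (dpt :: 'a \<Rightarrow> _)) \<subseteq> cvs.span {dpts gs |gs. length gs = Suc 0}"
    by (intro cvs.span_minimal) auto
  then show ?case using aug_ideal_span aug_pow_Suc_0 by blast
next
  case (Suc n)
  show ?case
    unfolding aug_pow.simps(2)[of "Suc n"]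
  proof (rule cvs.span_minimal)
    show "{a * b |a b :: 'a \<Rightarrow>\<^sub>0 complex. augmentation a = 0 \<and> b \<in> aug_pow (Suc n)}
        \<subseteq> cvs.span {dpts gs |gs. length gs = Suc (Suc n)}"
    proof clarify
      fix a b :: "'a \<Rightarrow>\<^sub>0 complex"
      assume "augmentation a = 0" "b \<in> aug_pow (Suc n)"
      then have "a * b \<in> cvs.span {p * q |p q. p \<in> range dpt \<and> q \<in> {dpts gs |gs. length gs = Suc n}}"
        using span_mult aug_ideal_span Suc by blast
      moreover have "{p * q |p q. p \<in> range dpt \<and> q \<in> {dpts gs |gs. length gs = Suc n}}
          \<subseteq> {dpts gs |gs :: 'a list. length gs = Suc (Suc n)}"
        by (auto, metis length_Cons list.simps(9) prod_list.Cons)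
      ultimately show "a * b \<in> cvs.span {dpts gs |gs. length gs = Suc (Suc n)}"
        using cvs.span_mono by blast
    qed
  qed simp
qed

subsection \<open>The quotients by powers of the augmentation ideal\<close>

text \<open>
  As \<open>g \<mapsto> g - 1\<close> is additive modulo \<open>I\<^sup>2\<close>, the ideal \<open>I\<close> is spanned modulo \<open>I\<^sup>2\<close> by the \<open>s - 1\<close> for
  generators \<open>s\<close>, and \<open>I\<^sup>n\<close> is spanned modulo \<open>I\<^sup>n\<^sup>+\<^sup>1\<close> by their \<open>n\<close>-fold products.
\<close>

lemma aug_pow_finite_quotient:
  assumes fg: "finitely_generated_group TYPE('p::group_add)"
  shows "\<exists>B. finite B \<and> (UNIV :: ('p \<Rightarrow>\<^sub>0 complex) set) \<subseteq> cvs.span (B \<union> aug_pow n)"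
proof -
  obtain S :: "'p set" where S: "finite S" "add_subgroup hull S = UNIV"
    using fg by (auto simp: finitely_generated_group_def)
  let ?W = "cvs.span (dpt ` S \<union> aug_pow 2)"
  have I2: "dpt g * dpt h \<in> ?W" for g h
    using aug_pow_mult[OF dpt_aug_pow dpt_aug_pow, of g h]
    by (intro cvs.span_base) (simp add: numeral_2_eq_2)
  have "add_subgroup {g. dpt g \<in> ?W}"
    unfolding add_subgroup_def
  proof (intro conjI ballI)
    show "0 \<in> {g. dpt g \<in> ?W}" by (simp add: cvs.span_zero)
    show "g + h \<in> {g. dpt g \<in> ?W}" if "g \<in> {g. dpt g \<in> ?W}" "h \<in> {g. dpt g \<in> ?W}" for g h
      using that I2 by (simp add: dpt_add cvs.span_add)
    show "- g \<in> {g. dpt g \<in> ?W}" if "g \<in> {g. dpt g \<in> ?W}" for g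
    proof -
      have "dpt (- g) = - (dpt g + dpt g * dpt (- g))"
        using dpt_add[of g "- g"] by (subst eq_neg_iff_add_eq_0) (simp add: add_ac)
      moreover have "- (dpt g + dpt g * dpt (- g)) \<in> ?W"
        using that I2 by (intro cvs.span_neg cvs.span_add) simp_all
      ultimately show ?thesis by (simp only: mem_Collect_eq)
    qed
  qed
  moreover have "S \<subseteq> {g. dpt g \<in> ?W}" by (auto intro: cvs.span_base)
  ultimately have "add_subgroup hull S \<subseteq> {g. dpt g \<in> ?W}" by (rule hull_minimal[rotated])
  then have "range dpt \<subseteq> ?W" using S(2) by auto
  then have "cvs.span (range dpt) \<subseteq> ?W" by (intro cvs.span_minimal) auto
  then have gen: "a \<in> ?W" if "augmentation a = 0" for a using aug_ideal_span that by blast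
  have step: "\<exists>B. finite B \<and> B \<subseteq> aug_pow n \<and> aug_pow n \<subseteq> cvs.span (B \<union> (aug_pow (Suc n) :: ('p \<Rightarrow>\<^sub>0 complex) set))" for n
  proof (induction n)
    case 0
    have "r \<in> cvs.span ({1} \<union> aug_pow (Suc 0))" for r :: "'p \<Rightarrow>\<^sub>0 complex"
    proof -
      have "augmentation (1 :: 'p \<Rightarrow>\<^sub>0 complex) = 1"
        by (simp add: augmentation_def lin_ext_single scaleC_complex_def flip: single_one)
      then have "augmentation (r - augmentation r *\<^sub>C 1) = 0"
        by (simp add: clinear_diff[OF clinear_augmentation]
            clinear_augmentation[unfolded clinear_iff] scaleC_complex_def)
      then have "augmentation r *\<^sub>C 1 + (r - augmentation r *\<^sub>C 1) \<in> cvs.span ({1} \<union> aug_pow (Suc 0))"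
        by (intro cvs.span_add cvs.span_scale cvs.span_base) (simp_all add: aug_pow_Suc_0)
      then show ?thesis by simp
    qed
    then show ?case by (intro exI[of _ "{1}"]) auto
  next
    case (Suc n)
    then obtain B :: "('p \<Rightarrow>\<^sub>0 complex) set" where B: "finite B" "B \<subseteq> aug_pow n"
      "aug_pow n \<subseteq> cvs.span (B \<union> aug_pow (Suc n))" by blast
    let ?B = "{p * q |p q. p \<in> dpt ` S \<and> q \<in> B}"
    have "?B = (\<lambda>(p, q). p * q) ` (dpt ` S \<times> B)" by auto
    then have "finite ?B" using S(1) B(1) by simp
    moreover have "?B \<subseteq> aug_pow (Suc n)" using B(2) dpt_mult_aug_pow by blast
    moreover have "aug_pow (Suc n) \<subseteq> cvs.span (?B \<union> aug_pow (Suc (Suc n)))"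
      unfolding aug_pow.simps(2)[of n]
    proof (rule cvs.span_minimal)
      show "{a * b |a b. augmentation a = 0 \<and> b \<in> aug_pow n} \<subseteq> cvs.span (?B \<union> aug_pow (Suc (Suc n)))"
      proof clarify
        fix a b :: "'p \<Rightarrow>\<^sub>0 complex"
        assume "augmentation a = 0" "b \<in> aug_pow n"
        then have "a * b \<in> cvs.span {p * q |p q. p \<in> dpt ` S \<union> aug_pow 2 \<and> q \<in> B \<union> aug_pow (Suc n)}"
          using span_mult gen B(3) by blast
        moreover have "p * q \<in> ?B \<union> aug_pow (Suc (Suc n))"
          if "p \<in> dpt ` S \<union> aug_pow 2" "q \<in> B \<union> aug_pow (Suc n)" for p q
        proof -
          have q: "q \<in> aug_pow n" using that(2) B(2) aug_pow_Suc_subset by blast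
          show ?thesis
          proof (cases "p \<in> aug_pow 2")
            case True
            then show ?thesis using aug_pow_mult[OF True q] by (simp add: numeral_2_eq_2)
          next
            case False
            then have p: "p \<in> dpt ` S" using that(1) by blast
            then show ?thesis
              using that(2) dpt_mult_aug_pow[of q "Suc n"] by (cases "q \<in> B") auto
          qed
        qed
        then have "{p * q |p q. p \<in> dpt ` S \<union> aug_pow 2 \<and> q \<in> B \<union> aug_pow (Suc n)}
            \<subseteq> ?B \<union> aug_pow (Suc (Suc n))" by blast
        ultimately show "a * b \<in> cvs.span (?B \<union> aug_pow (Suc (Suc n)))"
          using cvs.span_mono by blast
      qed
    qed simp
    ultimately show ?case by blast
  qed
  show ?thesis
  proof (induction n)
    case 0
    show ?case by (intro exI[of _ "{}"]) (simp add: cvs.span_UNIV)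
  next
    case (Suc n)
    then obtain B :: "('p \<Rightarrow>\<^sub>0 complex) set" where B: "finite B" "UNIV \<subseteq> cvs.span (B \<union> aug_pow n)" by blast
    obtain B' :: "('p \<Rightarrow>\<^sub>0 complex) set" where B': "finite B'" "aug_pow n \<subseteq> cvs.span (B' \<union> aug_pow (Suc n))"
      using step[of n] by blast
    have "B \<union> aug_pow n \<subseteq> cvs.span ((B \<union> B') \<union> aug_pow (Suc n))"
    proof (rule Un_least)
      show "B \<subseteq> cvs.span ((B \<union> B') \<union> aug_pow (Suc n))"
        using cvs.span_superset[of "(B \<union> B') \<union> aug_pow (Suc n)"] by simp
      show "aug_pow n \<subseteq> cvs.span ((B \<union> B') \<union> aug_pow (Suc n))"
        by (rule subset_trans[OF B'(2)], rule cvs.span_mono) blast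
    qed
    then have "cvs.span (B \<union> aug_pow n) \<subseteq> cvs.span ((B \<union> B') \<union> aug_pow (Suc n))"
      by (rule cvs.span_minimal) simp
    then show ?case using B B'(1) by (intro exI[of _ "B \<union> B'"]) auto
  qed
qed

subsection \<open>The Dynkin operator\<close>

abbreviation inl :: "('p::group_add \<Rightarrow>\<^sub>0 complex) \<Rightarrow> 'p \<times> 'p \<Rightarrow>\<^sub>0 complex"
  where "inl \<equiv> push (\<lambda>g. (g, 0))"

abbreviation inr :: "('p::group_add \<Rightarrow>\<^sub>0 complex) \<Rightarrow> 'p \<times> 'p \<Rightarrow>\<^sub>0 complex"
  where "inr \<equiv> push (\<lambda>g. (0, g))"

abbreviation diag :: "('p::group_add \<Rightarrow>\<^sub>0 complex) \<Rightarrow> 'p \<times> 'p \<Rightarrow>\<^sub>0 complex"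
  where "diag \<equiv> push (\<lambda>g. (g, g))"

definition antipode :: "('p::group_add \<Rightarrow>\<^sub>0 complex) \<Rightarrow> 'p \<Rightarrow>\<^sub>0 complex"
  where "antipode = push uminus"

lemma push_one: "f 0 = 0 \<Longrightarrow> push f 1 = 1" for f :: "'p::group_add \<Rightarrow> 'q::group_add"
  using push_pt[of f 0] by (simp add: pt_0)

lemma push_pair_one [simp]: "inl 1 = 1" "inr 1 = 1" "diag 1 = 1"
  by (simp_all add: push_one zero_prod_def)

lemma inl_mult: "inl (x * y) = inl x * inl y" and inr_mult: "inr (x * y) = inr x * inr y"
  and diag_mult: "diag (x * y) = diag x * diag y"
  by (rule push_mult, simp)+

lemma inl_inr_commute: "inr y * inl x = inl x * inr y"
proof -
  have "inr y * inl (pt g) = inl (pt g) * inr y" for g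
    by (rule group_algebra_linear_eqI[of "\<lambda>y. inr y * inl (pt g)" "\<lambda>y. inl (pt g) * inr y"])
      (rule clinear_compose[OF clinear_push] clinear_mult | simp only: push_pt pt_mult, simp)+
  then show ?thesis
    by (rule group_algebra_linear_eqI[of "\<lambda>x. inr y * inl x" "\<lambda>x. inl x * inr y", rotated 2])
      (rule clinear_compose[OF clinear_push] clinear_mult)+
qed

lemma clinear_antipode: "clinear antipode"
  by (simp add: antipode_def clinear_push)

lemma antipode_mult: "antipode (x * y) = antipode y * antipode x"
proof -
  have "antipode (pt g * y) = antipode y * antipode (pt g)" for g
  proof (rule group_algebra_linear_eqI[of "\<lambda>y. antipode (pt g * y)" "\<lambda>y. antipode y * antipode (pt g)"])
    show "antipode (pt g * pt h) = antipode (pt h) * antipode (pt g)" for h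
      by (simp only: antipode_def push_pt pt_mult minus_add)
  qed (rule clinear_compose[OF clinear_mult(1) clinear_antipode]
      clinear_compose[OF clinear_antipode clinear_mult(2)])+
  then show ?thesis
    by (rule group_algebra_linear_eqI[of "\<lambda>x. antipode (x * y)" "\<lambda>x. antipode y * antipode x", rotated 2])
      (rule clinear_compose[OF clinear_mult(2) clinear_antipode]
        clinear_compose[OF clinear_antipode clinear_mult(1)])+
qed

lemma aug_pow_ideal_right: "b \<in> aug_pow n \<Longrightarrow> augmentation a = 0 \<Longrightarrow> b * a \<in> aug_pow (Suc n)"
  using aug_pow_mult[of b n a "Suc 0"] by (simp add: aug_pow_Suc_0)

lemma augmentation_antipode: "augmentation (antipode x) = augmentation x"
  by (simp add: antipode_def augmentation_push)

lemma antipode_aug_pow: "x \<in> aug_pow n \<Longrightarrow> antipode x \<in> aug_pow n"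
proof (induction n arbitrary: x)
  case (Suc n)
  have "cvs.span {a * b |a b :: 'a \<Rightarrow>\<^sub>0 complex. augmentation a = 0 \<and> b \<in> aug_pow n}
      \<subseteq> {x. antipode x \<in> aug_pow (Suc n)}"
  proof (rule cvs.span_minimal)
    show "{a * b |a b :: 'a \<Rightarrow>\<^sub>0 complex. augmentation a = 0 \<and> b \<in> aug_pow n}
        \<subseteq> {x. antipode x \<in> aug_pow (Suc n)}"
    proof clarify
      fix a b :: "'a \<Rightarrow>\<^sub>0 complex"
      assume "augmentation a = 0" "b \<in> aug_pow n"
      then show "antipode (a * b) \<in> aug_pow (Suc n)"
        unfolding antipode_mult
        by (intro aug_pow_ideal_right Suc.IH) (simp_all add: augmentation_antipode)
    qed
    show "cvs.subspace {x :: 'a \<Rightarrow>\<^sub>0 complex. antipode x \<in> aug_pow (Suc n)}"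
      by (rule subspace_preimage[OF clinear_antipode subspace_aug_pow])
  qed
  then show ?case using Suc.prems unfolding aug_pow.simps(2) by blast
qed simp

lemma antipode_dpt: "antipode (dpt g) + dpt g = - (dpt g * dpt (- g))"
  by (simp add: antipode_def dpt_def clinear_diff[OF clinear_push] push_pt push_one algebra_simps pt_mult pt_0)

lemma antipode_dpt_add: "antipode (dpt g) + dpt g \<in> aug_pow 2"
  using aug_pow_mult[OF dpt_aug_pow dpt_aug_pow, of g "- g"]
  by (simp add: antipode_dpt aug_pow_simps(4) numeral_2_eq_2)

lemma dpt_pair: "dpt (g, h) = inl (dpt g) + inr (dpt h) + inl (dpt g) * inr (dpt h)"
  by (simp add: dpt_def clinear_diff[OF clinear_push] push_pt push_one algebra_simps pt_mult)

lemma diag_dpt: "diag (dpt g) = inl (dpt g) + inr (dpt g) + inl (dpt g) * inr (dpt g)"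
  using dpt_pair[of g g] by (simp add: dpt_def clinear_diff[OF clinear_push] push_pt push_one)

text \<open>
  By \<open>dpt_pair\<close>, multiplication with \<open>(g, h) - 1\<close> raises the degree in at least one of the two factors.
\<close>

lemma aug_pow_prod:
  "aug_pow m \<subseteq> cvs.span {inl a * inr b |(a :: 'p::group_add \<Rightarrow>\<^sub>0 complex) b i. i \<le> m \<and> a \<in> aug_pow i \<and> b \<in> aug_pow (m - i)}"
proof (induction m)
  case 0
  let ?T = "{inl a * inr b |(a :: 'p \<Rightarrow>\<^sub>0 complex) b i. i \<le> 0 \<and> a \<in> aug_pow i \<and> b \<in> aug_pow (0 - i)}"
  have "x \<in> cvs.span ?T" for x :: "'p \<times> 'p \<Rightarrow>\<^sub>0 complex"
  proof (induction x rule: group_algebra_induct)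
    case (add x k c)
    have "Poly_Mapping.single k c = c *\<^sub>C (inl (pt (fst k)) * inr (pt (snd k)))"
      by (rule poly_mapping_eqI) (simp add: push_pt pt_mult lookup_single when_def scaleC_complex_def)
    moreover have "inl (pt (fst k)) * inr (pt (snd k)) \<in> cvs.span ?T" by (rule cvs.span_base) auto
    ultimately show ?case using add by (simp only: cvs.span_add cvs.span_scale)
  qed (simp add: cvs.span_zero)
  then show ?case by blast
next
  case (Suc m)
  let ?T = "\<lambda>m. {inl a * inr b |(a :: 'p \<Rightarrow>\<^sub>0 complex) b i. i \<le> m \<and> a \<in> aug_pow i \<and> b \<in> aug_pow (m - i)}"
  have TI: "inl a * inr b \<in> ?T k" if "i \<le> k" "a \<in> aug_pow i" "b \<in> aug_pow (k - i)"
    for a b :: "'p \<Rightarrow>\<^sub>0 complex" and i k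
    using that by blast
  have gen: "dpt (g, h) * (inl a * inr b) \<in> cvs.span (?T (Suc m))"
    if "i \<le> m" "a \<in> aug_pow i" "b \<in> aug_pow (m - i)" for g h a b i
  proof -
    have "dpt (g, h) * (inl a * inr b) = inl (dpt g * a) * inr b + inl a * inr (dpt h * b)
        + inl (dpt g * a) * inr (dpt h * b)"
    proof -
      have "inr y * (inl a * r) = inl a * (inr y * r)" for y r
        by (simp only: mult.assoc[symmetric] inl_inr_commute)
      then show ?thesis by (simp add: dpt_pair inl_mult inr_mult distrib_right mult.assoc)
    qed
    moreover have "inl (dpt g * a) * inr b \<in> ?T (Suc m)"
      by (rule TI[of "Suc i"]) (use that dpt_mult_aug_pow[OF that(2)] in simp_all)
    moreover have "inl a * inr (dpt h * b) \<in> ?T (Suc m)"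
      by (rule TI[of i]) (use that dpt_mult_aug_pow[OF that(3)] in \<open>simp_all add: Suc_diff_le\<close>)
    moreover have "inl (dpt g * a) * inr (dpt h * b) \<in> ?T (Suc m)"
      by (rule TI[of "Suc i"]) (use that dpt_mult_aug_pow[OF that(2)] aug_pow_left[OF that(3)] in simp_all)
    ultimately show ?thesis by (simp add: cvs.span_add cvs.span_base)
  qed
  show ?case
    unfolding aug_pow.simps(2)[of m]
  proof (rule cvs.span_minimal)
    show "{a * b |a b :: 'p \<times> 'p \<Rightarrow>\<^sub>0 complex. augmentation a = 0 \<and> b \<in> aug_pow m} \<subseteq> cvs.span (?T (Suc m))"
    proof clarify
      fix a b :: "'p \<times> 'p \<Rightarrow>\<^sub>0 complex"
      assume "augmentation a = 0" "b \<in> aug_pow m"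
      then have "a * b \<in> cvs.span {p * q |p q. p \<in> range dpt \<and> q \<in> ?T m}"
        using span_mult aug_ideal_span Suc by blast
      moreover have "cvs.span {p * q |p q. p \<in> range dpt \<and> q \<in> ?T m} \<subseteq> cvs.span (?T (Suc m))"
      proof (rule cvs.span_minimal)
        show "{p * q |p q. p \<in> range dpt \<and> q \<in> ?T m} \<subseteq> cvs.span (?T (Suc m))"
          using gen by auto
      qed simp
      ultimately show "a * b \<in> cvs.span (?T (Suc m))" by blast
    qed
  qed simp
qed

text \<open>
  A substitute for multiplication by the degree: modulo the next power it multiplies \<open>I\<^sup>b\<close> by \<open>b\<close>.  It is
  the sum of projections onto \<open>I\<^sup>1, \<dots>, I\<^sup>n\<close>, of which exactly the first \<open>b\<close> fix the elements of \<open>I\<^sup>b\<close>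
  while the others map into \<open>I\<^sup>b\<^sup>+\<^sup>1\<close>.
\<close>

lemma degree_operator:
  "\<exists>E. clinear E \<and> (\<forall>a. \<forall>y\<in>aug_pow a. E y \<in> aug_pow a) \<and>
    (\<forall>b\<le>n. \<forall>y\<in>aug_pow b. E y - of_nat b *\<^sub>C y \<in> aug_pow (Suc b)) \<and>
    (\<forall>y :: 'p::group_add \<Rightarrow>\<^sub>0 complex. y \<in> aug_pow n \<longrightarrow> E y = of_nat n *\<^sub>C y)"
proof (induction n)
  case 0
  show ?case
    by (rule exI[of _ "\<lambda>_. 0"]) (simp add: clinear_iff aug_pow_simps)
next
  case (Suc n)
  then obtain E :: "('p \<Rightarrow>\<^sub>0 complex) \<Rightarrow> 'p \<Rightarrow>\<^sub>0 complex" where E: "clinear E"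
    "\<And>a y. y \<in> aug_pow a \<Longrightarrow> E y \<in> aug_pow a"
    "\<And>b y. b \<le> n \<Longrightarrow> y \<in> aug_pow b \<Longrightarrow> E y - of_nat b *\<^sub>C y \<in> aug_pow (Suc b)"
    "\<And>y. y \<in> aug_pow n \<Longrightarrow> E y = of_nat n *\<^sub>C y" by blast
  obtain q :: "('p \<Rightarrow>\<^sub>0 complex) \<Rightarrow> 'p \<Rightarrow>\<^sub>0 complex" where q: "clinear q"
    "\<And>x. q x \<in> aug_pow (Suc n)" "\<And>x. x \<in> aug_pow (Suc n) \<Longrightarrow> q x = x"
    using projection_exists[OF subspace_aug_pow[of "Suc n"]] by blast
  show ?case
  proof (intro exI[of _ "\<lambda>y. E y + q y"] conjI allI impI ballI)
    show "clinear (\<lambda>y. E y + q y)"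
      using E(1) q(1) by (simp add: clinear_iff scaleC_add_right)
    have top: "E y + q y = of_nat (Suc n) *\<^sub>C y" if "y \<in> aug_pow (Suc n)" for y
    proof -
      have "y \<in> aug_pow n" using that aug_pow_Suc_subset by blast
      then show ?thesis using E(4) q(3)[OF that] by (simp add: scaleC_add_left scaleC_one)
    qed
    then show "E y + q y = of_nat (Suc n) *\<^sub>C y" if "y \<in> aug_pow (Suc n)" for y using that by blast
    show "E y + q y \<in> aug_pow a" if "y \<in> aug_pow a" for a y
    proof (cases "a \<le> Suc n")
      case True
      then show ?thesis using E(2)[OF that] q(2)[of y] aug_pow_mono[OF True] by (blast intro: aug_pow_simps(2))
    next
      case False
      then have "y \<in> aug_pow (Suc n)" using that aug_pow_mono[of "Suc n" a] by auto
      then show ?thesis using q(3) E(2)[OF that] that by (simp add: aug_pow_simps(2))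
    qed
    show "E y + q y - of_nat b *\<^sub>C y \<in> aug_pow (Suc b)" if "b \<le> Suc n" "y \<in> aug_pow b" for b y
    proof (cases "b = Suc n")
      case True
      then show ?thesis using top that(2) by (simp add: aug_pow_simps(1))
    next
      case False
      then have b: "b \<le> n" using that(1) by simp
      have "q y \<in> aug_pow (Suc b)" using q(2)[of y] aug_pow_mono[of "Suc b" "Suc n"] b by auto
      then have "(E y - of_nat b *\<^sub>C y) + q y \<in> aug_pow (Suc b)"
        using E(3)[OF b that(2)] by (intro aug_pow_simps(2))
      then show ?thesis by (simp add: algebra_simps)
    qed
  qed
qed

text \<open>
  Composed with the coproduct, \<open>\<Theta>\<close> becomes the convolution product of the antipode and \<open>E\<close>.
\<close>

lemma convolution:
  assumes "clinear E"
  shows "\<exists>\<Theta>. clinear \<Theta> \<and> (\<forall>a b. \<Theta> (inl a * inr b) = antipode a * E b)"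
proof -
  define \<Theta> where "\<Theta> = lin_ext (\<lambda>(g, h). antipode (pt g) * E (pt h))"
  have \<Theta>: "clinear \<Theta>" by (simp add: \<Theta>_def clinear_iff lin_ext_add lin_ext_scaleC)
  have pt: "\<Theta> (inl (pt g) * inr b) = antipode (pt g) * E b" for g b
  proof (rule group_algebra_linear_eqI[of "\<lambda>b. \<Theta> (inl (pt g) * inr b)" "\<lambda>b. antipode (pt g) * E b"])
    show "clinear (\<lambda>b. \<Theta> (inl (pt g) * inr b))"
      by (rule clinear_compose[OF clinear_compose[OF clinear_push clinear_mult(1)] \<Theta>])
    show "clinear (\<lambda>b. antipode (pt g) * E b)"
      by (rule clinear_compose[OF assms clinear_mult(1)])
    show "\<Theta> (inl (pt g) * inr (pt h)) = antipode (pt g) * E (pt h)" for h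
      by (simp add: push_pt pt_mult \<Theta>_def lin_ext_single scaleC_one)
  qed
  have "\<Theta> (inl a * inr b) = antipode a * E b" for a b
  proof (rule group_algebra_linear_eqI[of "\<lambda>a. \<Theta> (inl a * inr b)" "\<lambda>a. antipode a * E b"])
    show "\<Theta> (inl (pt g) * inr b) = antipode (pt g) * E b" for g by (rule pt)
    show "clinear (\<lambda>a. \<Theta> (inl a * inr b))"
      by (rule clinear_compose[OF clinear_compose[OF clinear_push clinear_mult(2)] \<Theta>])
    show "clinear (\<lambda>a. antipode a * E b)"
      by (rule clinear_compose[OF clinear_antipode clinear_mult(2)])
  qed
  then show ?thesis using \<Theta> by blast
qed

text \<open>All ways to split a list into two complementary sublists.\<close>

primrec shuf :: "'a list \<Rightarrow> ('a list \<times> 'a list) list"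
  where "shuf [] = [([], [])]"
  | "shuf (x # xs) = map (\<lambda>(u, v). (x # u, v)) (shuf xs) @ map (\<lambda>(u, v). (u, x # v)) (shuf xs)"

lemma shuf_length: "(u, v) \<in> set (shuf xs) \<Longrightarrow> length u + length v = length xs"
  by (induction xs arbitrary: u v) auto

lemma aug_pow_sum_list: "(\<And>x. x \<in> set xs \<Longrightarrow> f x \<in> aug_pow n) \<Longrightarrow> (\<Sum>x\<leftarrow>xs. f x) \<in> aug_pow n"
  by (induction xs) (auto simp: aug_pow_simps(1,2))

text \<open>
  Up to sign and modulo higher powers of \<open>I\<close>, the iterated commutator of \<open>z\<close> with the elements
  \<open>g - 1\<close>.
\<close>

definition dynkin :: "('p::group_add \<Rightarrow>\<^sub>0 complex) \<Rightarrow> 'p list \<Rightarrow> 'p \<Rightarrow>\<^sub>0 complex"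
  where "dynkin z gs = (\<Sum>(u, v)\<leftarrow>shuf gs. antipode (dpts u) * z * dpts v)"

text \<open>
  The same sum weighted by the degree of the second factor, as it arises from convolution of the
  antipode with the degree operator.
\<close>

definition wdynkin :: "('p::group_add \<Rightarrow>\<^sub>0 complex) \<Rightarrow> 'p list \<Rightarrow> 'p \<Rightarrow>\<^sub>0 complex"
  where "wdynkin z gs = (\<Sum>(u, v)\<leftarrow>shuf gs. of_nat (length v) *\<^sub>C (antipode (dpts u) * z * dpts v))"

lemma antipode_1 [simp]: "antipode 1 = 1"
  by (simp add: antipode_def push_one)

lemma dynkin_Nil: "dynkin z [] = z" and wdynkin_Nil: "wdynkin z [] = 0"
  by (simp_all add: dynkin_def wdynkin_def)

lemma dynkin_add: "dynkin (z + z') gs = dynkin z gs + dynkin z' gs"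
  and wdynkin_add: "wdynkin (z + z') gs = wdynkin z gs + wdynkin z' gs"
  by (simp_all add: dynkin_def wdynkin_def case_prod_unfold distrib_left distrib_right sum_list_addf
      scaleC_add_right)

lemma dynkin_minus: "dynkin (- z) gs = - dynkin z gs"
  using dynkin_add[of z "- z" gs] dynkin_add[of 0 0 gs] by (simp add: eq_neg_iff_add_eq_0 add.commute)

text \<open>
  Modulo higher powers of \<open>I\<close> the antipode of \<open>g - 1\<close> is \<open>-(g - 1)\<close>, so each step replaces \<open>z\<close> by its
  commutator with \<open>g - 1\<close>.
\<close>

lemma dynkin_Cons: "dynkin z (g # gs) = dynkin (antipode (dpt g) * z + z * dpt g) gs"
  by (simp add: dynkin_add) (simp add: dynkin_def comp_def case_prod_unfold antipode_mult mult.assoc)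

lemma wdynkin_Cons:
  "wdynkin z (g # gs) = wdynkin (antipode (dpt g) * z + z * dpt g) gs + dynkin (z * dpt g) gs"
  by (simp add: wdynkin_add)
    (simp add: dynkin_def wdynkin_def comp_def case_prod_unfold antipode_mult mult.assoc
      scaleC_add_left scaleC_one sum_list_addf add_ac)

lemma dynkin_aug_pow:
  "z \<in> aug_pow m \<Longrightarrow> dynkin z gs \<in> aug_pow (m + length gs)"
  "z \<in> aug_pow m \<Longrightarrow> wdynkin z gs \<in> aug_pow (m + length gs)"
proof (induction gs arbitrary: z m)
  case (Cons g gs)
  have z': "antipode (dpt g) * z + z * dpt g \<in> aug_pow (Suc m)" "z * dpt g \<in> aug_pow (Suc m)"
    if "z \<in> aug_pow m" for m z
  proof -
    show "z * dpt g \<in> aug_pow (Suc m)" by (rule aug_pow_ideal_right[OF that augmentation_dpt])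
    moreover have "antipode (dpt g) * z \<in> aug_pow (Suc m)"
      using aug_pow_mult[OF antipode_aug_pow[OF dpt_aug_pow] that, of g] by simp
    ultimately show "antipode (dpt g) * z + z * dpt g \<in> aug_pow (Suc m)" by (rule aug_pow_simps(2)[rotated])
  qed
  { case 1
    show ?case using Cons.IH(1)[OF z'(1)[OF 1]] by (simp add: dynkin_Cons)
  next
    case 2
    show ?case
      using Cons.IH(2)[OF z'(1)[OF 2]] Cons.IH(1)[OF z'(2)[OF 2]]
      by (simp add: wdynkin_Cons aug_pow_simps(2)) }
qed (simp_all add: dynkin_Nil wdynkin_Nil aug_pow_simps(1))

lemma commutator_dpt:
  fixes g w :: "'p::group_add"
  defines "w' \<equiv> g + w - g - w"
  shows "dpt w * dpt g - dpt g * dpt w = - (dpt w' + dpt w' * dpt (w + g))"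
    "dpt w' = (dpt g * dpt w - dpt w * dpt g) * pt (- (w + g))"
proof -
  have w': "w' + (w + g) = g + w"
    by (simp add: w'_def diff_conv_add_uminus add.assoc del: add_uminus_conv_diff)
  have 1: "dpt g * dpt w - dpt w * dpt g = pt (g + w) - pt (w + g)"
    by (simp add: dpt_def algebra_simps pt_mult)
  have "dpt w' + dpt w' * dpt (w + g) = dpt w' * pt (w + g)"
    by (simp add: dpt_def[of "w + g"] algebra_simps)
  also have "\<dots> = pt (g + w) - pt (w + g)"
    by (simp add: dpt_def left_diff_distrib pt_mult w')
  finally have 2: "dpt w' + dpt w' * dpt (w + g) = pt (g + w) - pt (w + g)" .
  show "dpt w * dpt g - dpt g * dpt w = - (dpt w' + dpt w' * dpt (w + g))"
    unfolding 2 1[symmetric] by simp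
  have "w' = g + w + - (w + g)"
    by (simp add: w'_def minus_add diff_conv_add_uminus add.assoc del: add_uminus_conv_diff)
  then show "dpt w' = (dpt g * dpt w - dpt w * dpt g) * pt (- (w + g))"
    unfolding 1 by (simp add: dpt_def left_diff_distrib pt_mult pt_0)
qed

text \<open>
  For \<open>z = w - 1\<close> each step replaces \<open>w\<close> by a group commutator \<open>(g, w)\<close>, up to sign and higher powers of
  \<open>I\<close>; at the end of the lower central series nothing but the higher powers is left.
\<close>

lemma dynkin_commutator:
  "(w :: 'p::group_add) \<in> lower_central j \<Longrightarrow> dpt w \<in> aug_pow m \<Longrightarrow> lower_central (j + length gs) = {0 :: 'p}
    \<Longrightarrow> dynkin (dpt w) gs \<in> aug_pow (Suc (m + length gs))"
proof (induction gs arbitrary: w j m)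
  case Nil
  then have "w = 0" by simp
  then show ?case by (simp add: dynkin_Nil aug_pow_simps(1))
next
  case (Cons g gs)
  define w' where "w' = g + w - g - w"
  note c = commutator_dpt[where g = g and w = w, folded w'_def]
  have "w' \<in> lower_central (Suc j)"
    unfolding w'_def lower_central.simps using Cons.prems(1) by (intro hull_inc) blast
  moreover have dw': "dpt w' \<in> aug_pow (Suc m)"
    unfolding c(2)
    by (intro aug_pow_right aug_pow_simps(3) dpt_mult_aug_pow Cons.prems(2)
        aug_pow_ideal_right[OF Cons.prems(2) augmentation_dpt])
  ultimately have 1: "dynkin (dpt w') gs \<in> aug_pow (Suc (Suc m + length gs))"
    using Cons.prems(3) by (intro Cons.IH[of w' "Suc j" "Suc m"]) simp_all
  have 2: "dynkin (dpt w' * dpt (w + g)) gs \<in> aug_pow (Suc (Suc m) + length gs)"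
    by (rule dynkin_aug_pow(1)[OF aug_pow_ideal_right[OF dw' augmentation_dpt]])
  have 3: "dynkin ((antipode (dpt g) + dpt g) * dpt w) gs \<in> aug_pow (2 + m + length gs)"
    by (rule dynkin_aug_pow(1)[OF aug_pow_mult[OF antipode_dpt_add Cons.prems(2)]])
  have "antipode (dpt g) * dpt w + dpt w * dpt g
      = (antipode (dpt g) + dpt g) * dpt w + (dpt w * dpt g - dpt g * dpt w)"
    by (simp add: algebra_simps)
  then have "dynkin (dpt w) (g # gs) = dynkin ((antipode (dpt g) + dpt g) * dpt w) gs
      + - (dynkin (dpt w') gs + dynkin (dpt w' * dpt (w + g)) gs)"
    by (simp only: dynkin_Cons dynkin_add dynkin_minus c(1))
  then show ?case
    using 1 2 3 by (simp add: aug_pow_simps)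
qed

lemma wdynkin_one:
  assumes "lower_central (length gs) = {0 :: 'p::group_add}"
  shows "wdynkin 1 (g # gs :: 'p list) \<in> aug_pow (Suc (Suc (length gs)))"
proof -
  have "dynkin (dpt g) gs \<in> aug_pow (Suc (Suc 0 + length gs))"
    using assms by (intro dynkin_commutator[of g 0] dpt_aug_pow) simp_all
  moreover have "wdynkin (antipode (dpt g) + dpt g) gs \<in> aug_pow (2 + length gs)"
    by (rule dynkin_aug_pow(2)[OF antipode_dpt_add])
  ultimately show ?thesis by (simp add: wdynkin_Cons aug_pow_simps(2))
qed

text \<open>
  The coproduct of a product of primitive elements, in the leading order for \<open>g - 1\<close>.
\<close>

definition shuffle_sum :: "'p::group_add list \<Rightarrow> 'p \<times> 'p \<Rightarrow>\<^sub>0 complex"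
  where "shuffle_sum gs = (\<Sum>(u, v)\<leftarrow>shuf gs. inl (dpts u) * inr (dpts v))"

lemma shuffle_sum_Cons: "shuffle_sum (g # gs) = (inl (dpt g) + inr (dpt g)) * shuffle_sum gs"
proof -
  have c: "inr y * (inl a * r) = inl a * (inr y * r)" for y a :: "'a \<Rightarrow>\<^sub>0 complex" and r
    by (simp only: mult.assoc[symmetric] inl_inr_commute)
  show ?thesis
    by (simp add: shuffle_sum_def comp_def case_prod_unfold inl_mult inr_mult distrib_right mult.assoc
        c sum_list_addf flip: sum_list_const_mult)
qed

text \<open>
  The coproduct of \<open>g - 1\<close> is \<open>(g - 1) \<otimes> 1 + 1 \<otimes> (g - 1)\<close> up to an element of the square of the ideal.
\<close>

lemma diag_dpts: "diag (dpts gs) - shuffle_sum gs \<in> aug_pow (Suc (length gs))"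
proof (induction gs)
  case Nil
  show ?case by (simp add: shuffle_sum_def aug_pow_simps(1))
next
  case (Cons g gs)
  let ?x = "inl (dpt g) + inr (dpt g)"
  have l: "inl (dpt g) \<in> aug_pow (Suc 0)" "inr (dpt g) \<in> aug_pow (Suc 0)"
    by (simp_all add: aug_pow_Suc_0 augmentation_push augmentation_dpt)
  then have x: "?x \<in> aug_pow (Suc 0)" by (rule aug_pow_simps(2))
  have d: "diag (dpts gs) \<in> aug_pow (length gs)"
    by (rule push_aug_pow[OF _ dpts_aug_pow]) simp
  have "inl (dpt g) * inr (dpt g) * diag (dpts gs) \<in> aug_pow (Suc 0 + Suc 0 + length gs)"
    by (intro aug_pow_mult l d)
  moreover have "?x * (diag (dpts gs) - shuffle_sum gs) \<in> aug_pow (Suc 0 + Suc (length gs))"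
    by (rule aug_pow_mult[OF x Cons.IH])
  moreover have "diag (dpts (g # gs)) - shuffle_sum (g # gs)
      = inl (dpt g) * inr (dpt g) * diag (dpts gs) + ?x * (diag (dpts gs) - shuffle_sum gs)"
    by (simp add: shuffle_sum_Cons diag_mult diag_dpt algebra_simps)
  ultimately show ?case by (simp add: aug_pow_simps(2))
qed

text \<open>
  Let \<open>n = m + 1\<close> be the degree of \<open>y\<close>.  The convolution \<open>\<Theta>\<close> sends \<open>y \<otimes> 1 + 1 \<otimes> y\<close> to \<open>n y\<close>, up to an
  element of \<open>I\<^sup>n\<^sup>+\<^sup>1\<close>, as the degree operator kills \<open>1\<close> modulo \<open>I\<close> and multiplies \<open>y\<close> by \<open>n\<close>.  It sends the
  coproduct of an \<open>n\<close>-fold product of elements \<open>g - 1\<close> to their iterated bracket, which lies in \<open>I\<^sup>n\<^sup>+\<^sup>1\<close>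
  because the group has class at most \<open>m\<close>.  Comparing the two gives the claim, since \<open>n\<close> is invertible.
\<close>

lemma primitive_in_next_power:
  fixes y :: "'p::group_add \<Rightarrow>\<^sub>0 complex"
  assumes nil: "lower_central m = {0 :: 'p}" and y: "y \<in> aug_pow (Suc m)"
    and prim: "diag y - (inl y + inr y) \<in> aug_pow (Suc (Suc m))"
  shows "y \<in> aug_pow (Suc (Suc m))"
proof -
  let ?I = "aug_pow (Suc (Suc m)) :: ('p \<Rightarrow>\<^sub>0 complex) set"
  obtain E :: "('p \<Rightarrow>\<^sub>0 complex) \<Rightarrow> 'p \<Rightarrow>\<^sub>0 complex" where E: "clinear E"
    "\<And>a y. y \<in> aug_pow a \<Longrightarrow> E y \<in> aug_pow a"
    "\<And>b y. b \<le> Suc m \<Longrightarrow> y \<in> aug_pow b \<Longrightarrow> E y - of_nat b *\<^sub>C y \<in> aug_pow (Suc b)"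
    "\<And>y. y \<in> aug_pow (Suc m) \<Longrightarrow> E y = of_nat (Suc m) *\<^sub>C y"
    using degree_operator[of "Suc m"] by blast
  obtain \<Theta> where \<Theta>: "clinear \<Theta>" "\<And>a b. \<Theta> (inl a * inr b) = antipode a * E b"
    using convolution[OF E(1)] by blast
  have kill: "\<Theta> x \<in> ?I" if "x \<in> aug_pow (Suc (Suc m))" for x
  proof -
    have "cvs.span {inl a * inr b |(a :: 'p \<Rightarrow>\<^sub>0 complex) b i. i \<le> Suc (Suc m) \<and> a \<in> aug_pow i \<and>
        b \<in> aug_pow (Suc (Suc m) - i)} \<subseteq> {x. \<Theta> x \<in> ?I}"
    proof (rule cvs.span_minimal)
      show "{inl a * inr b |(a :: 'p \<Rightarrow>\<^sub>0 complex) b i. i \<le> Suc (Suc m) \<and> a \<in> aug_pow i \<and>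
          b \<in> aug_pow (Suc (Suc m) - i)} \<subseteq> {x. \<Theta> x \<in> ?I}"
      proof clarify
        fix a b :: "'p \<Rightarrow>\<^sub>0 complex" and i
        assume i: "i \<le> Suc (Suc m)" "a \<in> aug_pow i" "b \<in> aug_pow (Suc (Suc m) - i)"
        show "\<Theta> (inl a * inr b) \<in> ?I"
          using aug_pow_mult[OF antipode_aug_pow[OF i(2)] E(2)[OF i(3)]] i(1) by (simp add: \<Theta>(2))
      qed
    qed (rule subspace_preimage[OF \<Theta>(1) subspace_aug_pow])
    then show ?thesis using aug_pow_prod[of "Suc (Suc m)"] that by blast
  qed
  have "cvs.span {dpts gs |gs :: 'p list. length gs = Suc m} \<subseteq> {y. \<Theta> (diag y) \<in> ?I}"
  proof (rule cvs.span_minimal)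
    show "{dpts gs |gs :: 'p list. length gs = Suc m} \<subseteq> {y. \<Theta> (diag y) \<in> ?I}"
    proof clarify
      fix gs :: "'p list" assume len: "length gs = Suc m"
      then obtain h hs where gs: "gs = h # hs" "length hs = m" by (cases gs) auto
      have "\<Theta> (diag (dpts gs) - shuffle_sum gs) \<in> ?I"
        using kill diag_dpts[of gs] len by simp
      moreover have "\<Theta> (shuffle_sum gs) - wdynkin 1 gs \<in> ?I"
      proof -
        have "\<Theta> (shuffle_sum gs) - wdynkin 1 gs
            = (\<Sum>(u, v)\<leftarrow>shuf gs. antipode (dpts u) * (E (dpts v) - of_nat (length v) *\<^sub>C dpts v))"
          by (simp add: shuffle_sum_def wdynkin_def clinear_sum_list[OF \<Theta>(1)] case_prod_unfold \<Theta>(2)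
              right_diff_distrib scaleC_mult_right sum_list_subtractf)
        also have "\<dots> \<in> ?I"
        proof (rule aug_pow_sum_list, clarify)
          fix u v assume "(u, v) \<in> set (shuf gs)"
          then have l: "length u + length v = Suc m" using shuf_length len by metis
          have "antipode (dpts u) * (E (dpts v) - of_nat (length v) *\<^sub>C dpts v)
              \<in> aug_pow (length u + Suc (length v))"
            by (intro aug_pow_mult antipode_aug_pow dpts_aug_pow E(3)) (use l in simp)
          then show "antipode (dpts u) * (E (dpts v) - of_nat (length v) *\<^sub>C dpts v) \<in> ?I"
            using l by simp
        qed
        finally show ?thesis .
      qed
      moreover have "wdynkin 1 gs \<in> ?I" using wdynkin_one[of hs h] nil gs by simp
      ultimately have "\<Theta> (diag (dpts gs) - shuffle_sum gs) + (\<Theta> (shuffle_sum gs) - wdynkin 1 gs)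
          + wdynkin 1 gs \<in> ?I"
        by (intro aug_pow_simps(2))
      then show "\<Theta> (diag (dpts gs)) \<in> ?I" by (simp add: clinear_diff[OF \<Theta>(1)])
    qed
    show "cvs.subspace {y :: 'p \<Rightarrow>\<^sub>0 complex. \<Theta> (diag y) \<in> ?I}"
      by (rule subspace_preimage[OF clinear_compose[OF clinear_push \<Theta>(1)] subspace_aug_pow])
  qed
  then have diag_y: "\<Theta> (diag y) \<in> ?I" using y aug_pow_span[of m] by blast
  have "E 1 \<in> aug_pow (Suc 0)" using E(3)[of 0 1] by simp
  then have inl_y: "\<Theta> (inl y) \<in> ?I"
    using \<Theta>(2)[of y 1] aug_pow_mult[OF antipode_aug_pow[OF y] \<open>E 1 \<in> aug_pow (Suc 0)\<close>] by simp
  have "\<Theta> (inr y) = of_nat (Suc m) *\<^sub>C y"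
    using \<Theta>(2)[of 1 y] E(4)[OF y] by simp
  moreover have "\<Theta> (inr y) = \<Theta> (diag y) - \<Theta> (inl y) - \<Theta> (diag y - (inl y + inr y))"
    using \<Theta>(1) by (simp add: clinear_diff[OF \<Theta>(1)] clinear_iff)
  ultimately have "of_nat (Suc m) *\<^sub>C y = \<Theta> (diag y) - \<Theta> (inl y) - \<Theta> (diag y - (inl y + inr y))"
    by simp
  also have "\<dots> \<in> ?I" by (intro aug_pow_simps(3) diag_y inl_y kill[OF prim])
  finally have "of_nat (Suc m) *\<^sub>C y \<in> ?I" .
  then have "inverse (of_nat (Suc m)) *\<^sub>C of_nat (Suc m) *\<^sub>C y \<in> ?I" by (rule aug_pow_simps(5))
  then show ?thesis by (simp add: scaleC_scaleC scaleC_one del: of_nat_Suc)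
qed

section \<open>The Malcev Lie algebra of a nilpotent group\<close>

text \<open>A representative modulo \<open>I\<^sup>n\<close>.\<close>

definition level :: "nat \<Rightarrow> 'p::group_add completed_group_algebra \<Rightarrow> 'p \<Rightarrow>\<^sub>0 complex"
  where "level n X = rep_completed_group_algebra X n"

lemma completion_eq_rep:
  "completion_eq (rep_completed_group_algebra X) (rep_completed_group_algebra X)"
  by (rule Quotient_rep_reflp[OF Quotient_completed_group_algebra])

lemma level_compatible: "n \<le> m \<Longrightarrow> level m X - level n X \<in> aug_pow n"
proof (induction m)
  case 0
  then show ?case by (simp add: aug_pow_simps(1))
next
  case (Suc m)
  show ?case
  proof (cases "n = Suc m")
    case False
    then have n: "n \<le> m" using Suc.prems by simp
    have "level (Suc m) X - level m X \<in> aug_pow m"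
      using completion_eq_rep[of X] by (simp add: level_def completion_eq_def compatible_def)
    then have "(level (Suc m) X - level m X) + (level m X - level n X) \<in> aug_pow n"
      using aug_pow_mono[OF n] Suc.IH[OF n] by (intro aug_pow_simps(2)) auto
    then show ?thesis by simp
  qed (simp add: aug_pow_simps(1))
qed

lemma level_abs: "compatible x \<Longrightarrow> level n (abs_completed_group_algebra x) - x n \<in> aug_pow n"
proof -
  assume "compatible x"
  then have "completion_eq x x" by (rule completion_eqI) (rule refl)
  then have "completion_eq (rep_completed_group_algebra (abs_completed_group_algebra x)) x"
    by (rule Quotient_rep_abs[OF Quotient_completed_group_algebra])
  then show ?thesis by (simp add: level_def completion_eq_def)
qed

lemma abs_level: "abs_completed_group_algebra (\<lambda>n. level n X) = X"
  unfolding level_def by (rule Quotient_abs_rep[OF Quotient_completed_group_algebra])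

lemma level_eqI: "(\<And>n. level n X - level n Y \<in> aug_pow n) \<Longrightarrow> X = Y"
proof -
  assume "\<And>n. level n X - level n Y \<in> aug_pow n"
  then have "completion_eq (rep_completed_group_algebra X) (rep_completed_group_algebra Y)"
    using completion_eq_rep[of X] completion_eq_rep[of Y] by (simp add: level_def completion_eq_def)
  then show "X = Y"
    using Quotient_rel_rep[OF Quotient_completed_group_algebra, of X Y] by simp
qed

lemma compatible_level: "compatible (\<lambda>n. level n X)"
  using completion_eq_rep[of X] by (simp add: level_def completion_eq_def)

lemma completion_eq_level: "completion_eq (\<lambda>n. level n X) (\<lambda>n. level n X)"
  by (rule completion_eqI[OF compatible_level refl])

lemma level_plus: "level n (X + Y) - (level n X + level n Y) \<in> aug_pow n"
  using level_abs[OF compatible_intros(2)[OF compatible_level compatible_level], of n X Y]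
    plus_completed_group_algebra.abs_eq[OF completion_eq_level[of X] completion_eq_level[of Y]]
  by (simp add: abs_level)

lemma level_times: "level n (X * Y) - level n X * level n Y \<in> aug_pow n"
  using level_abs[OF compatible_intros(5)[OF compatible_level compatible_level], of n X Y]
    times_completed_group_algebra.abs_eq[OF completion_eq_level[of X] completion_eq_level[of Y]]
  by (simp add: abs_level)

lemma level_minus: "level n (X - Y) - (level n X - level n Y) \<in> aug_pow n"
  using level_abs[OF compatible_intros(3)[OF compatible_level compatible_level], of n X Y]
    minus_completed_group_algebra.abs_eq[OF completion_eq_level[of X] completion_eq_level[of Y]]
  by (simp add: abs_level)

lemma level_scaleC: "level n (c *\<^sub>C X) - c *\<^sub>C level n X \<in> aug_pow n"
  using level_abs[OF compatible_intros(6)[OF compatible_level], of n c X]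
    scaleC_completed_group_algebra.abs_eq[OF completion_eq_level[of X]]
  by (simp add: abs_level)

lemma level_zero: "level n 0 \<in> aug_pow n"
  using level_abs[OF compatible_intros(1)[of 0], of n] by (simp add: zero_completed_group_algebra_def)

lemma compatible_push: "(\<And>a b. f (a + b) = f a + f b) \<Longrightarrow> compatible x \<Longrightarrow> compatible (\<lambda>n. push f (x n))"
  using completion_eq_push[of f x x] by (simp add: completion_eq_def aug_pow_simps(1))

lemma level_coproduct:
  "level n (coproduct X) - diag (level n X) \<in> aug_pow n"
  "level n (tensor_one X) - inl (level n X) \<in> aug_pow n"
  "level n (one_tensor X) - inr (level n X) \<in> aug_pow n"
  using level_abs[OF compatible_push[OF _ compatible_level], of "\<lambda>g. (g, g)" n X]
    level_abs[OF compatible_push[OF _ compatible_level], of "\<lambda>g. (g, 0)" n X]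
    level_abs[OF compatible_push[OF _ compatible_level], of "\<lambda>g. (0, g)" n X]
    coproduct.abs_eq[OF completion_eq_level[of X]] tensor_one.abs_eq[OF completion_eq_level[of X]]
    one_tensor.abs_eq[OF completion_eq_level[of X]]
  by (simp_all add: abs_level)

lemma aug_pow_trans: "a - b \<in> aug_pow n \<Longrightarrow> b - c \<in> aug_pow n \<Longrightarrow> a - c \<in> aug_pow n"
  using aug_pow_simps(2)[of "a - b" n "b - c"] by simp

lemma aug_pow_sym: "a - b \<in> aug_pow n \<Longrightarrow> b - a \<in> aug_pow n"
  using aug_pow_simps(4)[of "a - b" n] by simp

lemma aug_pow_transfer: "a - b \<in> aug_pow n \<Longrightarrow> b \<in> aug_pow n \<Longrightarrow> a \<in> aug_pow n"
  using aug_pow_simps(2)[of "a - b" n b] by simp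

definition primitive :: "'p::group_add completed_group_algebra \<Rightarrow> bool"
  where "primitive X \<longleftrightarrow> coproduct X = tensor_one X + one_tensor X"

lemma malcev_lie_simps: "lie_carrier malcev_lie = {X. primitive X}" "lie_bracket malcev_lie X Y = X * Y - Y * X"
  by (simp_all add: malcev_lie_def primitive_def)

lemma primitive_level:
  assumes "primitive X"
  shows "diag (level n X) - (inl (level n X) + inr (level n X)) \<in> aug_pow n"
proof -
  have "diag (level n X) - level n (tensor_one X + one_tensor X) \<in> aug_pow n"
    using level_coproduct(1)[of n X] assms by (simp add: primitive_def aug_pow_sym)
  moreover have "level n (tensor_one X + one_tensor X) - (level n (tensor_one X) + level n (one_tensor X)) \<in> aug_pow n"
    by (rule level_plus)
  moreover have "(level n (tensor_one X) + level n (one_tensor X)) - (inl (level n X) + inr (level n X)) \<in> aug_pow n"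
    by (rule add_diff_aug_pow[OF level_coproduct(2,3)])
  ultimately show ?thesis using aug_pow_trans by blast
qed

lemma completed_hom:
  "coproduct (X + Y) = coproduct X + coproduct Y" "tensor_one (X + Y) = tensor_one X + tensor_one Y"
  "one_tensor (X + Y) = one_tensor X + one_tensor Y"
  "coproduct (c *\<^sub>C X) = c *\<^sub>C coproduct X" "tensor_one (c *\<^sub>C X) = c *\<^sub>C tensor_one X"
  "one_tensor (c *\<^sub>C X) = c *\<^sub>C one_tensor X"
  "coproduct (X * Y) = coproduct X * coproduct Y" "tensor_one (X * Y) = tensor_one X * tensor_one Y"
  "one_tensor (X * Y) = one_tensor X * one_tensor Y"
  by (transfer, rule completion_eqI, (intro compatible_intros compatible_push; simp add: completion_eq_def),
      simp add: clinear_push[unfolded clinear_iff] diag_mult inl_mult inr_mult)+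

lemma tensor_one_commute: "one_tensor Y * tensor_one X = tensor_one X * one_tensor Y"
  by (transfer, rule completion_eqI, (intro compatible_intros compatible_push; simp add: completion_eq_def),
      simp add: inl_inr_commute)

lemma completed_scaleC: "(c *\<^sub>C X) * Y = c *\<^sub>C (X * Y)" "X * (c *\<^sub>C Y) = c *\<^sub>C (X * Y)"
  for X Y :: "'p::group_add completed_group_algebra"
  by (transfer, rule completion_eqI, (intro compatible_intros; simp add: completion_eq_def),
      simp add: scaleC_mult_left scaleC_mult_right)+

lemma completed_hom_minus:
  "coproduct (X - Y) = coproduct X - coproduct Y" "tensor_one (X - Y) = tensor_one X - tensor_one Y"
  "one_tensor (X - Y) = one_tensor X - one_tensor Y"
  by (rule clinear_diff; simp add: clinear_iff completed_hom)+

lemma completed_hom_zero: "coproduct 0 = 0" "tensor_one 0 = 0" "one_tensor 0 = 0"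
  by (rule clinear_0; simp add: clinear_iff completed_hom)+

lemma subspace_primitive: "cvs.subspace {X. primitive X}"
  by (simp add: cvs.subspace_def primitive_def completed_hom completed_hom_zero scaleC_add_right add_ac)

lemma primitive_bracket:
  assumes "primitive X" "primitive Y"
  shows "primitive (X * Y - Y * X)"
  using assms unfolding primitive_def
  by (simp add: completed_hom completed_hom_minus algebra_simps tensor_one_commute)

lemma lie_on_primitive: "lie_on {X. primitive X} (\<lambda>X Y. X * Y - Y * X)"
  unfolding lie_on_def bilinear_on_def
  by (auto simp: subspace_primitive primitive_bracket algebra_simps completed_scaleC)

text \<open>
  The augmentation of \<open>\<Delta> x = x \<otimes> 1 + 1 \<otimes> x\<close> reads \<open>\<epsilon>(x) = 2 \<epsilon>(x)\<close>.
\<close>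

lemma primitive_augmentation:
  assumes "primitive X" "0 < n"
  shows "augmentation (level n X) = 0"
proof -
  have "diag (level n X) - (inl (level n X) + inr (level n X)) \<in> aug_pow (Suc 0)"
    using primitive_level[OF assms(1), of n] aug_pow_mono[of "Suc 0" n] assms(2) by auto
  then show ?thesis
    by (simp add: aug_pow_Suc_0 clinear_diff[OF clinear_augmentation] augmentation_push
        clinear_augmentation[unfolded clinear_iff])
qed

definition prim_filt :: "nat \<Rightarrow> 'p::group_add completed_group_algebra set"
  where "prim_filt i = {X. primitive X \<and> level i X \<in> aug_pow i}"

lemma subspace_prim_filt: "cvs.subspace (prim_filt i)"
proof -
  have "level i (X + Y) \<in> aug_pow i" if "level i X \<in> aug_pow i" "level i Y \<in> aug_pow i"
    for X Y :: "'a completed_group_algebra"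
    using aug_pow_transfer[OF level_plus] aug_pow_simps(2)[OF that] by blast
  moreover have "level i (c *\<^sub>C X) \<in> aug_pow i" if "level i X \<in> aug_pow i"
    for c and X :: "'a completed_group_algebra"
    using aug_pow_transfer[OF level_scaleC] aug_pow_simps(5)[OF that] by blast
  ultimately show ?thesis
    using subspace_primitive level_zero unfolding cvs.subspace_def prim_filt_def by blast
qed

lemma prim_filt_Suc: "prim_filt (Suc i) \<subseteq> prim_filt i"
proof
  fix X :: "'a completed_group_algebra" assume "X \<in> prim_filt (Suc i)"
  then have "primitive X" "level (Suc i) X \<in> aug_pow i"
    using aug_pow_Suc_subset by (auto simp: prim_filt_def)
  then show "X \<in> prim_filt i"
    using aug_pow_transfer[OF aug_pow_sym[OF level_compatible[of i "Suc i" X]]] by (simp add: prim_filt_def)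
qed

lemma prim_filt_level: "X \<in> prim_filt i \<Longrightarrow> level (Suc i) X \<in> aug_pow i"
  using aug_pow_transfer[OF level_compatible[of i "Suc i" X]] by (simp add: prim_filt_def)

lemma prim_filt_bracket:
  assumes X: "primitive X" and Y: "Y \<in> prim_filt i"
  shows "X * Y - Y * X \<in> prim_filt (Suc i)"
proof -
  let ?x = "level (Suc i) X" and ?y = "level (Suc i) Y"
  have x: "?x \<in> aug_pow (Suc 0)" using primitive_augmentation[OF X] by (simp add: aug_pow_Suc_0)
  have y: "?y \<in> aug_pow i" by (rule prim_filt_level[OF Y])
  have "?x * ?y \<in> aug_pow (Suc i)" "?y * ?x \<in> aug_pow (Suc i)"
    using aug_pow_mult[OF x y] aug_pow_mult[OF y x] by simp_all
  then have "level (Suc i) (X * Y) \<in> aug_pow (Suc i)" "level (Suc i) (Y * X) \<in> aug_pow (Suc i)"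
    using aug_pow_transfer[OF level_times] by blast+
  then have "level (Suc i) (X * Y - Y * X) \<in> aug_pow (Suc i)"
    using aug_pow_transfer[OF level_minus] aug_pow_simps(3) by blast
  then show ?thesis
    using X Y by (simp add: prim_filt_def primitive_bracket)
qed

lemma lower_central_mono:
  assumes "lower_central c = {0 :: 'p::group_add}"
  shows "lower_central (c + i) = {0 :: 'p}"
proof (induction i)
  case (Suc i)
  have "{x + y - x - y |x y :: 'p. y \<in> lower_central (c + i)} = {0}"
    using Suc by (auto simp: diff_conv_add_uminus simp del: add_uminus_conv_diff)
  moreover have "add_subgroup hull {0 :: 'p} = {0}"
    by (rule hull_same) (simp add: add_subgroup_def)
  ultimately show ?case by simp
qed (use assms in simp)

text \<open>
  Once in \<open>I\<^sup>n\<close> with \<open>n\<close> above the class, a primitive element lies in every power of \<open>I\<close>, and the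
  completion is separated.
\<close>

lemma prim_filt_zero:
  assumes nil: "lower_central c = {0 :: 'p::group_add}"
  shows "prim_filt (Suc c) = {0 :: 'p completed_group_algebra}"
proof -
  have "X = 0" if X: "X \<in> prim_filt (Suc c)" for X :: "'p completed_group_algebra"
  proof (rule level_eqI)
    have up: "X \<in> prim_filt (Suc c + i)" for i
    proof (induction i)
      case (Suc i)
      then have p: "primitive X" by (simp add: prim_filt_def)
      have y: "level (Suc (Suc (c + i))) X \<in> aug_pow (Suc (c + i))"
        using prim_filt_level[OF Suc] by simp
      have "level (Suc (Suc (c + i))) X \<in> aug_pow (Suc (Suc (c + i)))"
        by (rule primitive_in_next_power[OF lower_central_mono[OF nil] y primitive_level[OF p]])
      then show ?case using p by (simp add: prim_filt_def)
    qed (use X in simp)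
    have down: "prim_filt (j + i) \<subseteq> (prim_filt j :: 'p completed_group_algebra set)" for i j
      by (induction i) (use prim_filt_Suc in auto)
    fix n
    have "X \<in> prim_filt n" using up[of n] down[of n "Suc c"] by (auto simp: add.commute)
    then show "level n X - level n 0 \<in> aug_pow n"
      using level_zero by (auto simp: prim_filt_def intro: aug_pow_simps(3))
  qed
  then show ?thesis using cvs.subspace_0[OF subspace_prim_filt] by blast
qed

lemma nilpotent_malcev_lie:
  assumes "nilpotent_group TYPE('p::group_add)"
  shows "nilpotent_lie (lie_carrier (malcev_lie :: 'p completed_group_algebra lie)) (lie_bracket malcev_lie)"
proof -
  obtain c where c: "lower_central c = {0 :: 'p}" using assms by (auto simp: nilpotent_group_def)
  have br: "lie_bracket malcev_lie = (\<lambda>X Y :: 'p completed_group_algebra. X * Y - Y * X)"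
    by (simp add: malcev_lie_def)
  have 0: "prim_filt 0 = {X :: 'p completed_group_algebra. primitive X}" by (simp add: prim_filt_def)
  show ?thesis
    unfolding nilpotent_lie_def malcev_lie_simps(1) br
  proof (rule conjI[OF lie_on_primitive], rule exI[of _ prim_filt], rule exI[of _ "Suc c"])
    show "prim_filt 0 = {X :: 'p completed_group_algebra. primitive X} \<and>
        prim_filt (Suc c) = {0 :: 'p completed_group_algebra} \<and>
        (\<forall>i. cvs.subspace (prim_filt i :: 'p completed_group_algebra set) \<and>
          prim_filt (Suc i) \<subseteq> (prim_filt i :: 'p completed_group_algebra set) \<and>
          (\<forall>X\<in>{X :: 'p completed_group_algebra. primitive X}. \<forall>Y\<in>prim_filt i.
            X * Y - Y * X \<in> prim_filt (Suc i)))"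
      by (intro conjI allI ballI 0 prim_filt_zero[OF c] subspace_prim_filt prim_filt_Suc prim_filt_bracket)
        simp_all
  qed
qed

text \<open>
  As the filtration reaches \<open>0\<close>, primitive elements are determined by their component modulo one
  power of \<open>I\<close>; composing with a projection along that power makes this component well-defined.
\<close>

lemma finite_dim_malcev_lie:
  assumes fg: "finitely_generated_group TYPE('p::group_add)" and nil: "nilpotent_group TYPE('p)"
  shows "finite_dim (lie_carrier (malcev_lie :: 'p completed_group_algebra lie))"
proof -
  obtain c where c: "lower_central c = {0 :: 'p}" using nil by (auto simp: nilpotent_group_def)
  let ?n = "Suc c"
  obtain B :: "('p \<Rightarrow>\<^sub>0 complex) set" where B: "finite B" "UNIV \<subseteq> cvs.span (B \<union> aug_pow ?n)"
    using aug_pow_finite_quotient[OF fg] by blast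
  obtain p :: "('p \<Rightarrow>\<^sub>0 complex) \<Rightarrow> 'p \<Rightarrow>\<^sub>0 complex" where p: "clinear p" "\<And>x. p x \<in> aug_pow ?n"
    "\<And>x. x \<in> aug_pow ?n \<Longrightarrow> p x = x"
    using projection_exists[OF subspace_aug_pow] by blast
  define q where "q x = x - p x" for x
  have q: "clinear q" using p(1) by (simp add: q_def clinear_iff cvs.scale_right_diff_distrib algebra_simps)
  have q_eq: "q x = q y" if "x - y \<in> aug_pow ?n" for x y
    using p(3)[OF that] clinear_diff[OF p(1), of x y] by (simp add: q_def algebra_simps)
  have q_0: "x \<in> aug_pow ?n" if "q x = 0" for x using that p(2)[of x] by (simp add: q_def)
  define Q where "Q X = q (level ?n X)" for X
  have "Q (X + Y) = Q X + Q Y" "Q (a *\<^sub>C X) = a *\<^sub>C Q X" for X Y a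
    using q_eq[OF level_plus] q_eq[OF level_scaleC] q by (simp_all add: Q_def clinear_iff)
  then have Q: "clinear Q" by (simp add: clinear_iff)
  show ?thesis
    unfolding malcev_lie_simps(1)
  proof (rule finite_dim_inj[OF Q subspace_primitive])
    show "finite (insert 0 (q ` B))" using B(1) by simp
    show "X = 0" if "X \<in> {X. primitive X}" "Q X = 0" for X
      using prim_filt_zero[OF c] q_0[of "level ?n X"] that by (auto simp: Q_def prim_filt_def)
    show "Q X \<in> cvs.span (insert 0 (q ` B))" for X
    proof -
      have "cvs.span (B \<union> aug_pow ?n) \<subseteq> {x. q x \<in> cvs.span (insert 0 (q ` B))}"
      proof (rule cvs.span_minimal)
        have "q x = 0" if "x \<in> aug_pow ?n" for x using p(3)[OF that] by (simp add: q_def)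
        then show "B \<union> aug_pow ?n \<subseteq> {x. q x \<in> cvs.span (insert 0 (q ` B))}"
          by (auto intro: cvs.span_base cvs.span_zero)
      qed (rule subspace_preimage[OF q cvs.subspace_span])
      then show ?thesis unfolding Q_def using B(2) by blast
    qed
  qed
qed

theorem theorem4p15:
  fixes \<nn> :: "'p::group_add completed_group_algebra lie"
    and \<gg> :: "(complex^2^2) lie"
    and \<theta> :: "complex^2^2 \<Rightarrow> 'v::complex_vector \<Rightarrow> 'v"
    and k :: nat
  assumes "finitely_generated_group TYPE('p)"
    and "nilpotent_group TYPE('p)"
    and "\<nn> = malcev_lie"
    and "\<gg> = sl2 \<or> \<gg> = sol2"
    and "lie_module \<gg> \<theta>"
    and "finite_dim (UNIV :: 'v set)"
    and "\<exists>v::'v. v \<noteq> 0"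
  shows "(k > cvs.dim (lie_carrier \<nn>) \<longrightarrow> resonance (CE \<nn>) \<gg> \<theta> k 1 = {}) \<and>
         (k \<le> cvs.dim (lie_carrier \<nn>) \<longrightarrow>
            resonance (CE \<nn>) \<gg> \<theta> k 1 = Pi_set (CE \<nn>) \<gg> \<theta> \<and> Pi_set (CE \<nn>) \<gg> \<theta> \<noteq> {})"
proof -
  have "two_by_two \<gg>" using assms(4) two_by_two by auto
  then interpret nilpotent_resonance \<nn> \<gg> \<theta>
    using assms nilpotent_malcev_lie finite_dim_malcev_lie by unfold_locales auto
  show ?thesis using resonance_above_dim resonance_eq_Pi zero_in_Pi by blast
qed

end
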